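(* Let $E$ be a countable Borel equivalence relation on a standard Borel space $X$ and $\mathfrak{w}:E\to\mathbb{R}^+$ a Borel cocycle. For any Borel collection $\mathcal{S} \subseteq [X]_E^{<\infty}$ there are a Borel tiling $\mathcal{P} \subseteq \overline{\mathcal{S}}$ and an $E$-invariant $\mathfrak{w}$-deficient Borel set $D\subseteq X$ such that, on $X\setminus D$ (i.e. for $\mathcal{P}|_{X\setminus D}$ and $\mathcal{S}|_{X\setminus D}$), $\mathcal{P}$ is approximately saturated within $\mathcal{S}$. In fact, given a Borel tiling $\mathcal{P}_0 \subseteq \mathcal{S}$, the tiling $\mathcal{P}$ (and $D$) can be chosen so that, on $X\setminus D$, $\mathcal{P}$ admits a saturating $\mathcal{S}$-approximation whose first term is $\mathcal{P}_0$.
   Context: Cocycle: $\mathfrak{w}:E\to\mathbb{R}^+=(0,\infty)$, $(x,y)\mapsto\mathfrak{w}_x(y)$, with $\mathfrak{w}_x(y)\mathfrak{w}_y(z)=\mathfrak{w}_x(z)$ for $E$-related $x,y,z$. For $A$ contained in an $E$-class ("$E$-related"), $\mathfrak{w}_x(A):=\sum_{y\in A}\mathfrak{w}_x(y)$; $A$ is $\mathfrak{w}$-finite if this is finite for some (equivalently any) $x\in[A]_E$. $[X]_E^{<\infty}$ is the standard Borel space of finite nonempty $E$-related sets, and $[X]_E^{\mathfrak{w}<\infty}$ is the space of nonempty $\mathfrak{w}$-finite $E$-related sets. The latter is standard Borel: fix a Borel linear order $<_X$ on $X$, put $x<_{\mathfrak{w}}y$ iff $x\mathrel{E}y$ and ($\mathfrak{w}_x(y)>1$,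 or $\mathfrak{w}_x(y)=1$ and $x<_Xy$), and identify each $\mathfrak{w}$-finite set with its $<_{\mathfrak{w}}$-decreasing enumeration (of length $\le\omega$), an element of $X^{<\mathbb{N}}\cup X^{\mathbb{N}}$. Tilings: A tiling is a collection $\mathcal{P}$ of pairwise disjoint sets; $\mathrm{dom}(\mathcal{P}):=\bigcup\mathcal{P}$; $E(\mathcal{P})$ is the equivalence relation whose classes are the sets in $\mathcal{P}$ and the singletons outside $\mathrm{dom}(\mathcal{P})$. $\mathcal{S}|_Y:=\{U\in\mathcal{S}:U\subseteq Y\}$. $\overline{\mathcal{S}}$ is the collection of all $\mathfrak{w}$-finite sets that are countable increasing unions of sets in $\mathcal{S}$. A sequence $(\mathcal{P}_n)_{n\in\mathbb{N}}$ of tilings is injective if for each $n$: every set in $\mathcal{P}_{n+1}$ is $E(\mathcal{P}_n)$-invariant and contains at most one tile of $\mathcal{P}_n$, and $\mathrm{dom}(\mathcal{P}_{n+1})\supseteq\mathrm{dom}(\mathcal{P}_n)$. Then $\bigvee_n\mathcal{P}_n$ is the collection of classes of the equivalence relation $\mathrm{Id}_X\cup\bigcup_nE(\mathcal{P}_n)$ contained in $\bigcup_n\mathrm{dom}(\mathcal{P}_n)$. A tiling $\mathcal{P}\subseteq[X]_E^{\mathfrak{w}<\infty}$ is approximately saturated within $\mathcal{S}$ if $\mathcal{P}=\bigvee_n\mathcal{P}_n$ for some injective sequence $(\mathcal{P}_n)_{n\in\mathbb{N}}$ of tilings contained in $\mathcal{S}$ such that there is no $Q\in[X]_E^{\mathfrak{w}<\infty}$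 disjoint from $\mathrm{dom}(\mathcal{P})$ for which either $Q\in\mathcal{S}$ or there is $x\in\mathrm{dom}(\mathcal{P})$ with $[x]_{E(\mathcal{P}_n)}\cup Q\in\mathcal{S}$ for all large enough $n$. Such $(\mathcal{P}_n)$ is called a saturating $\mathcal{S}$-approximation for $\mathcal{P}$. Deficiency: A transport is a function $\varphi:E\to[0,\infty)$; put $\mathrm{out}\,\varphi(x):=\sum_{y\in[x]_E}\varphi(x,y)$ and $\mathrm{in}\,\varphi(x):=\sum_{y\in[x]_E}\varphi(y,x)\mathfrak{w}_x(y)$. It is $\mathfrak{w}$-bounded if both functions are bounded by $1$. A point $x$ is a source (resp. sink) of $\varphi$ if $\mathrm{out}\,\varphi(x)-\mathrm{in}\,\varphi(x)$ is positive (resp. negative). $\varphi$ disbalances an $E$-class if the class contains at least one source and no sink, or at least one sink and no source. A set $Y\subseteq X$ is $\mathfrak{w}$-deficient if there is a $\mathfrak{w}$-bounded Borel transport disbalancing every $E$-class contained in $[Y]_E$. *)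

theory Defs
  imports "HOL-Analysis.Analysis"
begin

text \<open>
  A Borel space is given by a measure \<open>M\<close>, of which only \<open>space M\<close> and \<open>sets M\<close> are
  used. Equivalence relations are sets of pairs on \<open>space M\<close>, so the \<open>E\<close>-class of \<open>x\<close>
  is \<open>E `` {x}\<close> and the \<open>E\<close>-saturation of \<open>Y\<close> is \<open>E `` Y\<close>.
\<close>

definition standard_borel :: "'a measure \<Rightarrow> bool" where
  "standard_borel M \<longleftrightarrow>
     (\<exists>T. completely_metrizable_space T \<and> second_countable T \<and> topspace T = space M \<and>
          sets M = sigma_sets (space M) {U. openin T U})"

definition countable_borel_equiv :: "'a measure \<Rightarrow> 'a rel \<Rightarrow> bool" where
  "countable_borel_equiv M E \<longleftrightarrow>
     equiv (space M) E \<and> E \<in> sets (M \<Otimes>\<^sub>M M) \<and> (\<forall>x\<in>space M. countable (E `` {x}))"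

text \<open>
  The value \<open>w x y\<close> is the weight of \<open>y\<close> as seen from \<open>x\<close>. Functions defined on \<open>E\<close> are
  represented by curried total functions whose values outside \<open>E\<close> are irrelevant.
\<close>

definition borel_cocycle :: "'a measure \<Rightarrow> 'a rel \<Rightarrow> ('a \<Rightarrow> 'a \<Rightarrow> real) \<Rightarrow> bool" where
  "borel_cocycle M E w \<longleftrightarrow>
     (\<lambda>(x, y). w x y) \<in> borel_measurable (restrict_space (M \<Otimes>\<^sub>M M) E) \<and>
     (\<forall>x y. (x, y) \<in> E \<longrightarrow> w x y > 0) \<and>
     (\<forall>x y z. (x, y) \<in> E \<longrightarrow> (y, z) \<in> E \<longrightarrow> w x y * w y z = w x z)"


subsection \<open>The spaces of finite and of weight-finite sets\<close>

definition related_set :: "'a measure \<Rightarrow> 'a rel \<Rightarrow> 'a set \<Rightarrow> bool" where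
  "related_set M E A \<longleftrightarrow> (\<exists>x\<in>space M. A \<subseteq> E `` {x})"

definition weight :: "('a \<Rightarrow> 'a \<Rightarrow> real) \<Rightarrow> 'a \<Rightarrow> 'a set \<Rightarrow> ennreal" where
  "weight w x A = (\<Sum>\<^sub>\<infinity>y\<in>A. ennreal (w x y))"

definition fin_sets :: "'a measure \<Rightarrow> 'a rel \<Rightarrow> 'a set set" where
  "fin_sets M E = {A. A \<noteq> {} \<and> related_set M E A \<and> finite A}"

definition wfin_sets :: "'a measure \<Rightarrow> 'a rel \<Rightarrow> ('a \<Rightarrow> 'a \<Rightarrow> real) \<Rightarrow> 'a set set" where
  "wfin_sets M E w = {A. A \<noteq> {} \<and> related_set M E A \<and> (\<exists>x\<in>E `` A. weight w x A < \<infinity>)}"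

definition borel_linear_order :: "'a measure \<Rightarrow> 'a rel \<Rightarrow> bool" where
  "borel_linear_order M L \<longleftrightarrow> strict_linear_order_on (space M) L \<and> L \<in> sets (M \<Otimes>\<^sub>M M)"

text \<open>Fixing a Borel linear order on a standard Borel space is no restriction:\<close>

lemma borel_linear_order_exists:
  assumes "standard_borel M"
  shows "\<exists>L. borel_linear_order M L"
proof -
  obtain T where T: "completely_metrizable_space T" "second_countable T" "topspace T = space M"
    and sets_T: "sets M = sigma_sets (space M) {U. openin T U}"
    using assms unfolding standard_borel_def by blast
  have haus: "Hausdorff_space T"
    using T(1) completely_metrizable_imp_metrizable_space metrizable_imp_Hausdorff_space by blast
  obtain \<B> where \<B>: "countable \<B>" "\<And>V. V \<in> \<B> \<Longrightarrow> openin T V"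
    "\<And>U x. openin T U \<Longrightarrow> x \<in> U \<Longrightarrow> \<exists>V\<in>\<B>. x \<in> V \<and> V \<subseteq> U"
    using T(2) unfolding second_countable_def by metis
  define B where "B = from_nat_into (insert {} \<B>)"
  have range_B: "range B = insert {} \<B>"
    unfolding B_def using \<B>(1) by (intro range_from_nat_into) auto
  have open_B: "openin T (B n)" for n
  proof -
    have "B n \<in> insert {} \<B>" unfolding range_B[symmetric] by simp
    then show ?thesis using \<B>(2) by auto
  qed
  have meas_B[measurable]: "B n \<in> sets M" for n
    unfolding sets_T using open_B by (auto intro: sigma_sets.Basic)
  have sep: "\<exists>n. (x \<in> B n) \<noteq> (y \<in> B n)" if xy: "x \<in> space M" "y \<in> space M" "x \<noteq> y" for x y
  proof -
    obtain U V where UV: "openin T U" "openin T V" "x \<in> U" "y \<in> V" "disjnt U V"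
      using haus[unfolded Hausdorff_space_def, rule_format, of x y] xy T(3) by auto
    obtain W where "W \<in> \<B>" "x \<in> W" "W \<subseteq> U" using \<B>(3)[OF UV(1,3)] by blast
    moreover have "y \<notin> W" using \<open>W \<subseteq> U\<close> UV by (auto simp: disjnt_iff)
    moreover obtain n where "B n = W"
    proof -
      have "W \<in> range B" unfolding range_B using \<open>W \<in> \<B>\<close> by simp
      then show ?thesis using that by auto
    qed
    ultimately show ?thesis by auto
  qed
  define L where "L = {p \<in> space (M \<Otimes>\<^sub>M M). \<exists>n. fst p \<notin> B n \<and> snd p \<in> B n \<and>
      (\<forall>m\<in>{..<n}. fst p \<in> B m \<longleftrightarrow> snd p \<in> B m)}"
  have L_iff: "(x, y) \<in> L \<longleftrightarrow> x \<in> space M \<and> y \<in> space M \<and>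
      (\<exists>n. x \<notin> B n \<and> y \<in> B n \<and> (\<forall>m<n. x \<in> B m \<longleftrightarrow> y \<in> B m))" for x y
    by (auto simp: L_def space_pair_measure)
  have "L \<in> sets (M \<Otimes>\<^sub>M M)"
    unfolding L_def by measurable
  moreover have "irrefl L"
    by (auto simp: irrefl_def L_iff)
  moreover have "trans L"
  proof (rule transI)
    fix x y z assume "(x, y) \<in> L" "(y, z) \<in> L"
    then obtain i j where
      i: "x \<notin> B i" "y \<in> B i" "\<forall>m<i. x \<in> B m \<longleftrightarrow> y \<in> B m" and
      j: "y \<notin> B j" "z \<in> B j" "\<forall>m<j. y \<in> B m \<longleftrightarrow> z \<in> B m" and
      sp: "x \<in> space M" "z \<in> space M"
      unfolding L_iff by auto
    have "i \<noteq> j" using i(2) j(1) by auto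
    then have "x \<notin> B (min i j) \<and> z \<in> B (min i j) \<and> (\<forall>m<min i j. x \<in> B m \<longleftrightarrow> z \<in> B m)"
      using i j by (cases "i < j") (auto simp: min_def)
    then show "(x, z) \<in> L" using sp unfolding L_iff by blast
  qed
  moreover have "total_on (space M) L"
  proof (rule total_onI)
    fix x y assume xy: "x \<in> space M" "y \<in> space M" "x \<noteq> y"
    define n where "n = (LEAST n. (x \<in> B n) \<noteq> (y \<in> B n))"
    have "(x \<in> B n) \<noteq> (y \<in> B n)" unfolding n_def using sep[OF xy] by (rule LeastI_ex)
    moreover have "x \<in> B m \<longleftrightarrow> y \<in> B m" if "m < n" for m
      using not_less_Least[OF that[unfolded n_def]] by blast
    ultimately show "(x, y) \<in> L \<or> (y, x) \<in> L" using xy unfolding L_iff by blast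
  qed
  ultimately show ?thesis
    unfolding borel_linear_order_def strict_linear_order_on_def by blast
qed

definition wless :: "'a rel \<Rightarrow> 'a rel \<Rightarrow> ('a \<Rightarrow> 'a \<Rightarrow> real) \<Rightarrow> 'a \<Rightarrow> 'a \<Rightarrow> bool" where
  "wless L E w x y \<longleftrightarrow> (x, y) \<in> E \<and> (w x y > 1 \<or> w x y = 1 \<and> (x, y) \<in> L)"

text \<open>
  The decreasing enumeration of a weight-finite set. In such a set every element has only
  finitely many elements above it, and the entry with index \<open>n\<close> is the element with exactly
  \<open>n\<close> elements above it; it is \<open>None\<close> if the set has at most \<open>n\<close> elements. Thus finite and
  infinite sequences in \<open>X\<close> are encoded as functions \<open>nat \<Rightarrow> 'a option\<close>, a finite sequence
  being continued by \<open>None\<close>.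
\<close>

definition wenum :: "'a rel \<Rightarrow> 'a rel \<Rightarrow> ('a \<Rightarrow> 'a \<Rightarrow> real) \<Rightarrow> 'a set \<Rightarrow> nat \<Rightarrow> 'a option" where
  "wenum L E w A n =
     (let at_rank = (\<lambda>y. y \<in> A \<and> finite {z\<in>A. wless L E w y z} \<and> card {z\<in>A. wless L E w y z} = n)
      in if \<exists>y. at_rank y then Some (THE y. at_rank y) else None)"

text \<open>The space \<open>M\<close> with the isolated point \<open>None\<close> added.\<close>

definition option_space :: "'a measure \<Rightarrow> 'a option measure" where
  "option_space M = sigma (insert None (Some ` space M)) ((`) Some ` sets M)"

text \<open>
  The Borel structure of the space of weight-finite sets is the one pulled back along the
  enumeration. It does not depend on the Borel linear order \<open>L\<close>. The finite nonempty
  related sets form a Borel subset of this space, and a Borel collection of finite sets is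
  one that is Borel in this space.
\<close>

definition wfin_space :: "'a measure \<Rightarrow> 'a rel \<Rightarrow> 'a rel \<Rightarrow> ('a \<Rightarrow> 'a \<Rightarrow> real) \<Rightarrow> 'a set measure" where
  "wfin_space M L E w =
     vimage_algebra (wfin_sets M E w) (wenum L E w) (\<Pi>\<^sub>M n\<in>(UNIV :: nat set). option_space M)"


subsection \<open>Tilings\<close>

text \<open>A tiling is a collection \<open>P\<close> with \<open>disjoint P\<close>, and its domain is \<open>\<Union>P\<close>.\<close>

definition tile_rel :: "'a measure \<Rightarrow> 'a set set \<Rightarrow> 'a rel" where
  "tile_rel M P = Id_on (space M) \<union> (\<Union>U\<in>P. U \<times> U)"

definition restrict_to :: "'a set set \<Rightarrow> 'a set \<Rightarrow> 'a set set" where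
  "restrict_to S Y = {U\<in>S. U \<subseteq> Y}"

definition increasing_closure ::
    "'a measure \<Rightarrow> 'a rel \<Rightarrow> ('a \<Rightarrow> 'a \<Rightarrow> real) \<Rightarrow> 'a set set \<Rightarrow> 'a set set" where
  "increasing_closure M E w S =
     {A\<in>wfin_sets M E w. \<exists>F :: nat \<Rightarrow> 'a set. incseq F \<and> range F \<subseteq> S \<and> A = (\<Union>n. F n)}"

definition injective_tilings :: "'a measure \<Rightarrow> (nat \<Rightarrow> 'a set set) \<Rightarrow> bool" where
  "injective_tilings M P \<longleftrightarrow>
     (\<forall>n. disjoint (P n)) \<and>
     (\<forall>n. \<forall>U\<in>P (Suc n). tile_rel M (P n) `` U \<subseteq> U \<and>
            (\<forall>V\<in>P n. \<forall>V'\<in>P n. V \<subseteq> U \<longrightarrow> V' \<subseteq> U \<longrightarrow> V = V')) \<and>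
     (\<forall>n. \<Union>(P n) \<subseteq> \<Union>(P (Suc n)))"

definition tiling_join :: "'a measure \<Rightarrow> (nat \<Rightarrow> 'a set set) \<Rightarrow> 'a set set" where
  "tiling_join M P =
     {C \<in> space M // (Id_on (space M) \<union> (\<Union>n. tile_rel M (P n))). C \<subseteq> (\<Union>n. \<Union>(P n))}"

definition saturating_approximation ::
    "'a measure \<Rightarrow> 'a rel \<Rightarrow> ('a \<Rightarrow> 'a \<Rightarrow> real) \<Rightarrow> 'a set set \<Rightarrow> 'a set set \<Rightarrow>
     (nat \<Rightarrow> 'a set set) \<Rightarrow> bool" where
  "saturating_approximation M E w S P Pn \<longleftrightarrow>
     disjoint P \<and> P \<subseteq> wfin_sets M E w \<and>
     injective_tilings M Pn \<and> (\<forall>n. Pn n \<subseteq> S) \<and> P = tiling_join M Pn \<and>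
     \<not> (\<exists>Q\<in>wfin_sets M E w. Q \<inter> \<Union>P = {} \<and>
          (Q \<in> S \<or>
           (\<exists>x\<in>\<Union>P. \<forall>\<^sub>F n in sequentially. tile_rel M (Pn n) `` {x} \<union> Q \<in> S)))"

definition approximately_saturated ::
    "'a measure \<Rightarrow> 'a rel \<Rightarrow> ('a \<Rightarrow> 'a \<Rightarrow> real) \<Rightarrow> 'a set set \<Rightarrow> 'a set set \<Rightarrow> bool" where
  "approximately_saturated M E w S P \<longleftrightarrow> (\<exists>Pn. saturating_approximation M E w S P Pn)"


subsection \<open>Transports and deficiency\<close>

definition borel_transport :: "'a measure \<Rightarrow> 'a rel \<Rightarrow> ('a \<Rightarrow> 'a \<Rightarrow> real) \<Rightarrow> bool" where
  "borel_transport M E \<phi> \<longleftrightarrow>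
     (\<lambda>(x, y). \<phi> x y) \<in> borel_measurable (restrict_space (M \<Otimes>\<^sub>M M) E) \<and>
     (\<forall>x y. (x, y) \<in> E \<longrightarrow> \<phi> x y \<ge> 0)"

definition outflow :: "'a rel \<Rightarrow> ('a \<Rightarrow> 'a \<Rightarrow> real) \<Rightarrow> 'a \<Rightarrow> ennreal" where
  "outflow E \<phi> x = (\<Sum>\<^sub>\<infinity>y\<in>E `` {x}. ennreal (\<phi> x y))"

definition inflow :: "'a rel \<Rightarrow> ('a \<Rightarrow> 'a \<Rightarrow> real) \<Rightarrow> ('a \<Rightarrow> 'a \<Rightarrow> real) \<Rightarrow> 'a \<Rightarrow> ennreal" where
  "inflow E w \<phi> x = (\<Sum>\<^sub>\<infinity>y\<in>E `` {x}. ennreal (\<phi> y x * w x y))"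

definition w_bounded ::
    "'a measure \<Rightarrow> 'a rel \<Rightarrow> ('a \<Rightarrow> 'a \<Rightarrow> real) \<Rightarrow> ('a \<Rightarrow> 'a \<Rightarrow> real) \<Rightarrow> bool" where
  "w_bounded M E w \<phi> \<longleftrightarrow> (\<forall>x\<in>space M. outflow E \<phi> x \<le> 1 \<and> inflow E w \<phi> x \<le> 1)"

text \<open>
  Sources and sinks compare the two flows instead of taking the sign of their difference,
  because subtraction on \<^typ>\<open>ennreal\<close> truncates.
\<close>

definition is_source :: "'a rel \<Rightarrow> ('a \<Rightarrow> 'a \<Rightarrow> real) \<Rightarrow> ('a \<Rightarrow> 'a \<Rightarrow> real) \<Rightarrow> 'a \<Rightarrow> bool" where
  "is_source E w \<phi> x \<longleftrightarrow> outflow E \<phi> x > inflow E w \<phi> x"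

definition is_sink :: "'a rel \<Rightarrow> ('a \<Rightarrow> 'a \<Rightarrow> real) \<Rightarrow> ('a \<Rightarrow> 'a \<Rightarrow> real) \<Rightarrow> 'a \<Rightarrow> bool" where
  "is_sink E w \<phi> x \<longleftrightarrow> outflow E \<phi> x < inflow E w \<phi> x"

definition disbalances ::
    "'a rel \<Rightarrow> ('a \<Rightarrow> 'a \<Rightarrow> real) \<Rightarrow> ('a \<Rightarrow> 'a \<Rightarrow> real) \<Rightarrow> 'a set \<Rightarrow> bool" where
  "disbalances E w \<phi> C \<longleftrightarrow>
     ((\<exists>x\<in>C. is_source E w \<phi> x) \<and> \<not> (\<exists>x\<in>C. is_sink E w \<phi> x)) \<or>
     ((\<exists>x\<in>C. is_sink E w \<phi> x) \<and> \<not> (\<exists>x\<in>C. is_source E w \<phi> x))"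

definition deficient :: "'a measure \<Rightarrow> 'a rel \<Rightarrow> ('a \<Rightarrow> 'a \<Rightarrow> real) \<Rightarrow> 'a set \<Rightarrow> bool" where
  "deficient M E w Y \<longleftrightarrow>
     (\<exists>\<phi>. borel_transport M E \<phi> \<and> w_bounded M E w \<phi> \<and>
          (\<forall>C\<in>space M // E. C \<subseteq> E `` Y \<longrightarrow> disbalances E w \<phi> C))"

end

theory Submission
  imports Defs
begin

text \<open>
  By the Lusin--Novikov theorem the classes of \<open>E\<close> are enumerated by Borel functions \<open>\<gamma> n\<close>, so
  quantifiers over classes preserve Borelness, and the finite related sets are covered by
  countably many Borel families of pairwise disjoint sets (the colours). For a fixed \<open>\<epsilon> > 0\<close> one
  runs through all colours infinitely often, adds sets in \<open>S\<close> that are disjoint from the current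
  tiling, and enlarges a tile \<open>V\<close> to \<open>V \<union> Q \<in> S\<close>, with \<open>Q\<close> disjoint from the tiling, whenever the weight of \<open>Q\<close> is at least \<open>\<epsilon>\<close> times that of
  \<open>V\<close>. A tile that grows infinitely often in this phase has infinite weight; all other tiles
  stabilise, and then no such \<open>Q\<close> is left. Repeating this with \<open>\<epsilon> = 1 / (k + 1)\<close> for all \<open>k\<close>
  gives the saturating approximation, since a \<open>Q\<close> violating saturation for a tile of finite final
  weight would already violate it for some \<open>\<epsilon>\<close>. The classes with a tile of infinite weight are
  deficient: two tiles are never merged, so such a tile has a distinguished root, and mass can be
  pushed from the root to infinity.
\<close>

section \<open>Analytic sets\<close>

text \<open>The terms of the approximation must consist of sets in \<open>S\<close>, which are
  finite. Without a threshold a tile could absorb infinitely many light sets within one phase; the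
  union would be infinite, hence outside \<open>S\<close>, although its weight may be finite, and
  then \<open>D\<close> could not absorb it. The factor \<open>1 + \<epsilon>\<close> is what turns
  infinitely many growth steps into infinite weight. A tile may also reach infinite weight only in
  the course of all phases, so \<open>D\<close> is read off from the union of the whole run. Inside
  \<open>D\<close> tiles may be infinite from an early phase on, so membership in \<open>S\<close>
  is proved for the tile of one point at a time. Colours answer another obstacle: uncountably many
  sets compete for extension at each moment, and one colour provides sets that can all be added at
  once by a Borel rule. The condition that an added set contains at most one tile gives injectivity
  as well as the persistence of roots.\<close>

definition cyl :: "nat list \<Rightarrow> (nat \<Rightarrow> nat) set" where
  "cyl s = {z. \<forall>i<length s. z i = s ! i}"

abbreviation seg :: "(nat \<Rightarrow> nat) \<Rightarrow> nat \<Rightarrow> nat list" where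
  "seg z n \<equiv> map z [0..<n]"

lemma cyl_Nil [simp]: "cyl [] = UNIV"
  by (simp add: cyl_def)

lemma mem_cyl_seg: "z' \<in> cyl (seg z n) \<longleftrightarrow> (\<forall>i<n. z' i = z i)"
  by (simp add: cyl_def)

lemma self_mem_cyl_seg [simp]: "z \<in> cyl (seg z n)"
  by (simp add: mem_cyl_seg)

lemma cyl_seg_mono: "m \<le> n \<Longrightarrow> cyl (seg z n) \<subseteq> cyl (seg z m)"
  by (auto simp: mem_cyl_seg)

lemma cyl_seg_subset: "z \<in> cyl s \<Longrightarrow> length s \<le> n \<Longrightarrow> cyl (seg z n) \<subseteq> cyl s"
  by (auto simp: cyl_def)

lemma cyl_snoc: "cyl s = (\<Union>i. cyl (s @ [i]))"
proof -
  have "z \<in> cyl (s @ [z (length s)])" if "z \<in> cyl s" for z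
    using that by (auto simp: cyl_def nth_append less_Suc_eq)
  moreover have "z \<in> cyl s" if "z \<in> cyl (s @ [i])" for z i
    using that by (auto simp: cyl_def nth_append)
  ultimately show ?thesis by blast
qed

lemma cyl_nbhd:
  assumes "open U" "z \<in> U"
  obtains n where "cyl (seg z n) \<subseteq> U"
proof -
  have "openin (product_topology (\<lambda>i::nat. euclidean :: nat topology) UNIV) U"
    using assms(1) by (simp add: open_fun_def)
  from product_topology_open_contains_basis[OF this assms(2)]
  obtain X where X: "z \<in> (\<Pi>\<^sub>E i\<in>UNIV. X i)" "finite {i. X i \<noteq> UNIV}" "(\<Pi>\<^sub>E i\<in>UNIV. X i) \<subseteq> U"
    by auto
  obtain n where n: "{i. X i \<noteq> UNIV} \<subseteq> {..<n}"
    using finite_nat_bounded[OF X(2)] by auto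
  have "z' \<in> U" if z': "z' \<in> cyl (seg z n)" for z'
  proof -
    have "z' i \<in> X i" for i
    proof (cases "i < n")
      case True
      then have "z' i = z i" using z' by (simp add: mem_cyl_seg)
      moreover have "z i \<in> X i" using X(1) by (simp add: PiE_iff)
      ultimately show ?thesis by simp
    next
      case False
      then have "X i = UNIV" using n by auto
      then show ?thesis by simp
    qed
    then have "z' \<in> (\<Pi>\<^sub>E i\<in>UNIV. X i)" by (simp add: PiE_iff)
    then show "z' \<in> U" using X(3) by (rule subsetD[rotated])
  qed
  then show thesis using that by (meson subsetI)
qed

lemma continuous_on_cyl:
  assumes "continuous_on C f" "z \<in> C" "open U" "f z \<in> U"
  obtains n where "\<And>m. m \<ge> n \<Longrightarrow> f ` (C \<inter> cyl (seg z m)) \<subseteq> U"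
proof -
  obtain V where V: "open V" "z \<in> V" "\<forall>y\<in>C. y \<in> V \<longrightarrow> f y \<in> U"
    using assms unfolding continuous_on_topological by meson
  obtain n where "cyl (seg z n) \<subseteq> V" using cyl_nbhd[OF V(1,2)] .
  then show thesis using that[of n] cyl_seg_mono[of n _ z] V(3) by blast
qed

lemma closed_mem_cyl:
  assumes "closed C" "\<And>n. C \<inter> cyl (seg z n) \<noteq> {}"
  shows "z \<in> C"
proof (rule ccontr)
  assume "z \<notin> C"
  then obtain n where "cyl (seg z n) \<subseteq> - C"
    using cyl_nbhd[of "- C" z] assms(1) by (auto simp: open_Compl)
  then show False using assms(2)[of n] by blast
qed

text \<open>Coordinate \<open>i\<close> of \<open>z e\<close> is prescribed by
  \<open>u (Suc i)\<close> as soon as \<open>e \<ge> Suc i\<close>, since that list has length at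
  least \<open>Suc i\<close>; the limit is the diagonal of these values.\<close>

lemma cyl_limit:
  fixes z :: "nat \<Rightarrow> nat \<Rightarrow> nat"
  assumes dec: "\<And>e. cyl (u (Suc e)) \<subseteq> cyl (u e)" and len: "\<And>e. length (u e) \<ge> e"
    and z: "\<And>e. z e \<in> cyl (u e)"
  obtains \<zeta> where "z \<longlonglongrightarrow> \<zeta>" "\<And>e. \<zeta> \<in> cyl (u e)"
proof -
  have mono: "cyl (u e') \<subseteq> cyl (u e)" if "e \<le> e'" for e e'
    using that dec by (rule lift_Suc_antimono_le[of "\<lambda>e. cyl (u e)", rotated])
  have eq: "z e' i = z (Suc i) i" if "Suc i \<le> e'" for e' i
  proof -
    have "z e' \<in> cyl (u (Suc i))" "z (Suc i) \<in> cyl (u (Suc i))"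
      using mono[OF that] z by blast+
    then show ?thesis using len[of "Suc i"] by (auto simp: cyl_def)
  qed
  define \<zeta> where "\<zeta> = (\<lambda>i. z (Suc i) i)"
  have mem: "\<zeta> \<in> cyl (u e)" for e
    unfolding cyl_def
  proof (intro CollectI allI impI)
    fix i assume i: "i < length (u e)"
    define m where "m = max e (Suc i)"
    have "z m \<in> cyl (u e)" using mono[of e m] z[of m] by (auto simp: m_def)
    then have "z m i = u e ! i" using i by (auto simp: cyl_def)
    then show "\<zeta> i = u e ! i" using eq[of i m] by (simp add: \<zeta>_def m_def)
  qed
  have "z \<longlonglongrightarrow> \<zeta>"
  proof (rule topological_tendstoI)
    fix U assume "open U" "\<zeta> \<in> U"
    then obtain n where n: "cyl (seg \<zeta> n) \<subseteq> U" using cyl_nbhd[of U \<zeta>] by metis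
    have "z e \<in> U" if "e \<ge> n" for e
    proof -
      have "z e \<in> cyl (seg \<zeta> n)"
        unfolding mem_cyl_seg \<zeta>_def by (intro allI impI eq) (use that in simp)
      then show ?thesis using n by blast
    qed
    then show "\<forall>\<^sub>F e in sequentially. z e \<in> U"
      by (auto simp: eventually_sequentially)
  qed
  then show thesis using that mem by blast
qed

text \<open>Closed subsets of the Baire space are allowed as parameter sets, not only the whole
  space. This covers the empty set, and coincidence conditions can be imposed by shrinking the
  parameter set.\<close>

definition analytic :: "'b::t2_space set \<Rightarrow> bool" where
  "analytic A \<longleftrightarrow> (\<exists>C f. closed (C :: (nat \<Rightarrow> nat) set) \<and> continuous_on C f \<and> A = f ` C)"

lemma analytic_image:
  assumes "analytic A" "continuous_on A f"
  shows "analytic (f ` A)"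
proof -
  obtain C h where *: "closed (C :: (nat \<Rightarrow> nat) set)" "continuous_on C h" "A = h ` C"
    using assms(1) unfolding analytic_def by blast
  have "continuous_on C (\<lambda>z. f (h z))"
    by (rule continuous_on_compose2[OF assms(2) *(2)]) (simp add: *(3))
  moreover have "f ` A = (\<lambda>z. f (h z)) ` C" using *(3) by auto
  ultimately show ?thesis using *(1) unfolding analytic_def by blast
qed

lemma continuous_on_reindex:
  fixes z :: "nat \<Rightarrow> nat"
  shows "continuous_on X (\<lambda>z i. (z (r i) :: nat))"
  by (rule continuous_on_coordinatewise_then_product)
    (rule continuous_on_product_then_coordinatewise[OF continuous_on_id])

text \<open>Coordinate 0 of a parameter selects the piece and the shifted sequence parametrises it.
  The sets on which coordinate 0 is constant are open, so closedness and continuity are checked on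
  each of them.\<close>

lemma analytic_Union:
  assumes "\<And>n::nat. analytic (A n)"
  shows "analytic (\<Union>n. A n)"
proof -
  obtain C f where Cf: "\<And>n. closed (C n :: (nat \<Rightarrow> nat) set)" "\<And>n. continuous_on (C n) (f n)"
    "\<And>n. A n = f n ` C n"
    using assms unfolding analytic_def by metis
  define t :: "(nat \<Rightarrow> nat) \<Rightarrow> nat \<Rightarrow> nat" where "t z = (\<lambda>i. z (Suc i))" for z
  have ct: "continuous_on X t" for X
    unfolding t_def[abs_def] by (rule continuous_on_reindex)
  have op0: "open {z :: nat \<Rightarrow> nat. z 0 = n}" for n
  proof -
    have "open ((\<lambda>z :: nat \<Rightarrow> nat. z 0) -` {n})"
      by (rule open_vimage) (auto simp: open_discrete)
    then show ?thesis by (simp add: vimage_def)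
  qed
  define K where "K = {z. t z \<in> C (z 0)}"
  have "- K = (\<Union>n. {z. z 0 = n} \<inter> t -` (- C n))"
    by (auto simp: K_def)
  moreover have "open (\<Union>n. {z :: nat \<Rightarrow> nat. z 0 = n} \<inter> t -` (- C n))"
    using Cf(1) ct by (intro open_UN open_Int ballI op0 open_vimage) auto
  ultimately have "closed K" by (simp add: closed_def)
  moreover have "continuous_on K (\<lambda>z. f (z 0) (t z))"
    unfolding continuous_on_topological
  proof (intro ballI allI impI)
    fix z U assume z: "z \<in> K" and U: "open U" "f (z 0) (t z) \<in> U"
    have "t z \<in> C (z 0)" using z by (simp add: K_def)
    then obtain V where V: "open V" "t z \<in> V" "\<forall>y\<in>C (z 0). y \<in> V \<longrightarrow> f (z 0) y \<in> U"
      using Cf(2)[of "z 0"] U unfolding continuous_on_topological by meson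
    have "open (t -` V \<inter> {z'. z' 0 = z 0})"
      using V(1) ct by (intro open_Int op0 open_vimage) auto
    moreover have "\<forall>y\<in>K. y \<in> t -` V \<inter> {z'. z' 0 = z 0} \<longrightarrow> f (y 0) (t y) \<in> U"
      using V(3) by (auto simp: K_def)
    ultimately show "\<exists>W. open W \<and> z \<in> W \<and> (\<forall>y\<in>K. y \<in> W \<longrightarrow> f (y 0) (t y) \<in> U)"
      using V(2) by (intro exI[of _ "t -` V \<inter> {z'. z' 0 = z 0}"]) auto
  qed
  moreover have "(\<Union>n. A n) = (\<lambda>z. f (z 0) (t z)) ` K"
  proof (intro subset_antisym subsetI)
    fix x assume "x \<in> (\<Union>n. A n)"
    then obtain n y where y: "y \<in> C n" "x = f n y" using Cf(3) by auto
    define z where "z = case_nat n y"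
    have "t z = y" "z 0 = n" by (auto simp: z_def t_def)
    then show "x \<in> (\<lambda>z. f (z 0) (t z)) ` K" using y by (intro image_eqI[of _ _ z]) (auto simp: K_def)
  qed (auto simp: K_def Cf(3))
  ultimately show ?thesis unfolding analytic_def by blast
qed

text \<open>One sequence codes countably many sequences \<open>r n z\<close> through the pairing
  function. In a Hausdorff space the parameters at which all \<open>f n (r n z)\<close> coincide
  form a closed set, and the common values are the points of the intersection.\<close>

lemma analytic_Inter:
  fixes A :: "nat \<Rightarrow> 'b::t2_space set"
  assumes "\<And>n::nat. analytic (A n)"
  shows "analytic (\<Inter>n. A n)"
proof -
  obtain C f where Cf: "\<And>n. closed (C n :: (nat \<Rightarrow> nat) set)" "\<And>n. continuous_on (C n) (f n)"
    "\<And>n. A n = f n ` C n"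
    using assms unfolding analytic_def by metis
  define r :: "nat \<Rightarrow> (nat \<Rightarrow> nat) \<Rightarrow> nat \<Rightarrow> nat"
    where "r n z = (\<lambda>i. z (prod_encode (n, i)))" for n z
  have cr: "continuous_on X (r n)" for X n
    unfolding r_def[abs_def] by (rule continuous_on_reindex)
  define K where "K = (\<Inter>n. r n -` C n)"
  have K: "closed K"
    unfolding K_def using Cf(1) cr by (intro closed_INT ballI closed_vimage) auto
  have cf: "continuous_on K (\<lambda>z. f n (r n z))" for n
    using Cf(2) by (rule continuous_on_compose2) (auto simp: K_def intro: cr)
  define H where "H = (\<Inter>n. K \<inter> (\<lambda>z. (f n (r n z), f 0 (r 0 z))) -` {p. fst p = snd p})"
  have diag: "closed {p :: 'b \<times> 'b. fst p = snd p}"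
    by (intro closed_Collect_eq continuous_on_fst continuous_on_snd continuous_on_id)
  have "closed H"
    unfolding H_def
    by (intro closed_INT ballI continuous_closed_preimage continuous_on_Pair cf K diag)
  moreover have "continuous_on H (\<lambda>z. f 0 (r 0 z))"
    using cf by (rule continuous_on_subset) (auto simp: H_def)
  moreover have "(\<Inter>n. A n) = (\<lambda>z. f 0 (r 0 z)) ` H"
  proof (intro subset_antisym subsetI)
    fix x assume "x \<in> (\<Inter>n. A n)"
    then have "\<forall>n. \<exists>y. y \<in> C n \<and> x = f n y" using Cf(3) by auto
    then obtain y where y: "\<And>n. y n \<in> C n" "\<And>n. x = f n (y n)" by metis
    define z where "z k = y (fst (prod_decode k)) (snd (prod_decode k))" for k
    have "r n z = y n" for n by (auto simp: r_def z_def)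
    then show "x \<in> (\<lambda>z. f 0 (r 0 z)) ` H"
      using y by (intro image_eqI[of _ _ z]) (auto simp: H_def K_def)
  next
    fix x assume "x \<in> (\<lambda>z. f 0 (r 0 z)) ` H"
    then obtain z where z: "z \<in> H" "x = f 0 (r 0 z)" by blast
    have "f n (r n z) = f 0 (r 0 z)" "r n z \<in> C n" for n using z(1) by (auto simp: H_def K_def)
    then have "x \<in> A n" for n unfolding Cf(3) z(2) by (metis image_eqI)
    then show "x \<in> (\<Inter>n. A n)" by blast
  qed
  ultimately show ?thesis unfolding analytic_def by blast
qed

lemma analytic_Int:
  assumes "analytic A" "analytic B"
  shows "analytic (A \<inter> B)"
proof -
  have "analytic (\<Inter>n::nat. if n = 0 then A else B)"
    using assms by (intro analytic_Inter) auto
  moreover have "(\<Inter>n::nat. if n = 0 then A else B) = A \<inter> B"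
  proof (intro subset_antisym subsetI)
    fix x assume "x \<in> (\<Inter>n::nat. if n = 0 then A else B)"
    then have "x \<in> (if n = 0 then A else B)" for n :: nat by blast
    from this[of 0] this[of 1] show "x \<in> A \<inter> B" by simp
  qed simp
  ultimately show ?thesis by metis
qed

lemma analytic_finite_Inter:
  assumes "finite I" "I \<noteq> {}" "\<And>i. i \<in> I \<Longrightarrow> analytic (A i)"
  shows "analytic (\<Inter>i\<in>I. A i)"
  using assms by (induction rule: finite_ne_induct) (auto intro: analytic_Int)

text \<open>Complements of analytic sets need not be analytic, so the induction over the Borel sets
  carries \<open>A\<close> and \<open>- A\<close> together. It starts from open sets, which are
  countable unions of closed sets because the space is metric.\<close>

lemma analytic_range:
  fixes e :: "(nat \<Rightarrow> nat) \<Rightarrow> 'b::metric_space"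
  assumes e: "continuous_on UNIV e" and "A \<in> sets borel"
  shows "analytic (A \<inter> range e)"
proof -
  have cl: "analytic (A \<inter> range e)" if "closed A" for A
  proof -
    have "closed (e -` A)" using e that by (intro closed_vimage)
    moreover have "A \<inter> range e = e ` (e -` A)" by auto
    ultimately show ?thesis unfolding analytic_def
      using continuous_on_subset[OF e] by blast
  qed
  have op: "analytic (U \<inter> range e)" if "open U" for U
  proof -
    define F where "F n = (\<Inter>y\<in>- U. {x. dist y x \<ge> inverse (real (Suc n))})" for n :: nat
    have "closed (F n)" for n
      unfolding F_def
      by (intro closed_INT ballI closed_Collect_le continuous_on_const continuous_on_dist continuous_on_id)
    moreover have "(\<Union>n. F n) = U"
    proof (intro subset_antisym subsetI)
      fix x assume "x \<in> U"
      then obtain \<epsilon> where \<epsilon>: "\<epsilon> > 0" "\<forall>y. dist y x < \<epsilon> \<longrightarrow> y \<in> U"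
        using \<open>open U\<close>[unfolded open_dist, rule_format, of x] by metis
      obtain n where n: "inverse (real (Suc n)) < \<epsilon>" using reals_Archimedean[OF \<epsilon>(1)] by blast
      have "inverse (real (Suc n)) \<le> dist y x" if "y \<in> - U" for y
      proof (rule ccontr)
        assume "\<not> inverse (real (Suc n)) \<le> dist y x"
        then have "dist x y < \<epsilon>"
          using n by (simp add: dist_commute)
        then show False using \<epsilon>(2) that by (simp add: dist_commute)
      qed
      then have "x \<in> F n" by (simp add: F_def)
      then show "x \<in> (\<Union>n. F n)" by blast
    next
      fix x assume "x \<in> (\<Union>n. F n)"
      then obtain n where n: "x \<in> F n" by blast
      show "x \<in> U"
      proof (rule ccontr)
        assume "x \<notin> U"
        then have "inverse (real (Suc n)) \<le> dist x x"
          using n unfolding F_def by blast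
        moreover have "0 < inverse (real (Suc n))" by simp
        ultimately show False by simp
      qed
    qed
    ultimately show ?thesis using analytic_Union[of "\<lambda>n. F n \<inter> range e"] cl by auto
  qed
  have "A \<in> sigma_sets UNIV {S. open S}"
    using assms(2) by (simp add: borel_def)
  then have "analytic (A \<inter> range e) \<and> analytic (- A \<inter> range e)"
  proof (induction rule: sigma_sets.induct)
    case (Basic a)
    then show ?case using op[of a] cl[of "- a"] by (simp add: closed_Compl)
  next
    case Empty
    then show ?case using cl[of "{}"] cl[of UNIV] by auto
  next
    case (Compl a)
    then show ?case by (simp add: Compl_eq_Diff_UNIV[symmetric])
  next
    case (Union a)
    have "- (\<Union>n. a n) \<inter> range e = (\<Inter>n. - a n \<inter> range e)" by auto
    then show ?case
      using analytic_Union[of "\<lambda>n. a n \<inter> range e"] analytic_Inter[of "\<lambda>n. - a n \<inter> range e"] Union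
      by simp
  qed
  then show ?thesis ..
qed

section \<open>The Cantor set and the Borel subsets of its square\<close>

definition cantor :: "(nat \<Rightarrow> real) set" where
  "cantor = {y. \<forall>n. y n = 0 \<or> y n = 1}"

definition to_cantor :: "(nat \<Rightarrow> nat) \<Rightarrow> nat \<Rightarrow> real" where
  "to_cantor z i = of_bool (z i \<noteq> 0)"

lemma range_to_cantor: "range to_cantor = cantor"
proof (intro subset_antisym subsetI)
  fix y assume "y \<in> cantor"
  then have "to_cantor (\<lambda>i. if y i = 0 then 0 else 1) = y"
    unfolding cantor_def to_cantor_def by fastforce
  then show "y \<in> range to_cantor" by (metis rangeI)
qed (auto simp: cantor_def to_cantor_def)

lemma continuous_on_to_cantor: "continuous_on X to_cantor"
proof (rule continuous_on_coordinatewise_then_product)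
  fix i
  have "continuous_on UNIV (\<lambda>n::nat. of_bool (n \<noteq> 0) :: real)"
    by simp
  then have "continuous_on X (\<lambda>z. (\<lambda>n::nat. of_bool (n \<noteq> 0) :: real) (z i))"
    by (rule continuous_on_compose2)
      (auto intro: continuous_on_product_then_coordinatewise continuous_on_id)
  then show "continuous_on X (\<lambda>z. to_cantor z i)" by (simp add: to_cantor_def)
qed

definition evens :: "(nat \<Rightarrow> nat) \<Rightarrow> nat \<Rightarrow> nat" where
  "evens z = (\<lambda>i. z (2 * i))"

definition odds :: "(nat \<Rightarrow> nat) \<Rightarrow> nat \<Rightarrow> nat" where
  "odds z = (\<lambda>i. z (2 * i + 1))"

lemma continuous_on_evens_odds: "continuous_on X evens" "continuous_on X odds"
  unfolding evens_def[abs_def] odds_def[abs_def] by (intro continuous_on_reindex)+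

lemma evens_odds_surj: obtains z where "evens z = x" "odds z = y"
proof
  let ?z = "\<lambda>k. if even k then x (k div 2) else y (k div 2)"
  show "evens ?z = x" "odds ?z = y" by (auto simp: evens_def odds_def)
qed

lemma analytic_Times_cantor:
  assumes "analytic (A :: 'b::t2_space set)"
  shows "analytic (A \<times> cantor)"
proof -
  obtain C h where *: "closed (C :: (nat \<Rightarrow> nat) set)" "continuous_on C h" "A = h ` C"
    using assms(1) unfolding analytic_def by blast
  have "closed (evens -` C)" using *(1) continuous_on_evens_odds by (intro closed_vimage)
  moreover have "continuous_on (evens -` C) (\<lambda>z. (h (evens z), to_cantor (odds z)))"
    by (intro continuous_on_Pair continuous_on_compose2[OF *(2)]
        continuous_on_compose2[OF continuous_on_to_cantor] continuous_on_evens_odds) auto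
  moreover have "A \<times> cantor = (\<lambda>z. (h (evens z), to_cantor (odds z))) ` (evens -` C)"
  proof (intro subset_antisym subsetI)
    fix p assume "p \<in> A \<times> cantor"
    then obtain a b where ab: "p = (a, b)" "a \<in> A" "b \<in> range to_cantor"
      unfolding range_to_cantor by blast
    then obtain x y where xy: "x \<in> C" "p = (h x, to_cantor y)"
      using *(3) by blast
    obtain z where z: "evens z = x" "odds z = y" by (rule evens_odds_surj)
    show "p \<in> (\<lambda>z. (h (evens z), to_cantor (odds z))) ` (evens -` C)"
      using z xy by (intro image_eqI[of _ _ z]) auto
  qed (use range_to_cantor *(3) in auto)
  ultimately show ?thesis unfolding analytic_def by blast
qed

text \<open>Even and odd coordinates parametrise the two factors, which makes the square of the
  Cantor set a continuous image of the Baire space; traces of Borel sets on such an image are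
  analytic.\<close>

lemma borel_imp_analytic:
  assumes "A \<in> sets borel" "A \<subseteq> cantor \<times> cantor"
  shows "analytic A"
proof -
  let ?e = "\<lambda>z. (to_cantor (evens z), to_cantor (odds z))"
  have "continuous_on UNIV ?e"
    by (intro continuous_on_Pair continuous_on_compose2[OF continuous_on_to_cantor]
        continuous_on_evens_odds) auto
  then have "analytic (A \<inter> range ?e)" using assms(1) by (rule analytic_range)
  moreover have "range ?e = cantor \<times> cantor"
  proof (intro subset_antisym subsetI)
    fix p assume "p \<in> cantor \<times> cantor"
    then obtain x y where xy: "p = (to_cantor x, to_cantor y)"
      unfolding range_to_cantor[symmetric] by blast
    obtain z where z: "evens z = x" "odds z = y" by (rule evens_odds_surj)
    show "p \<in> range ?e" using z xy by (intro image_eqI[of _ _ z]) auto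
  qed (use range_to_cantor in auto)
  ultimately show ?thesis using assms(2) by (simp add: Int_absorb2)
qed

section \<open>Separation of disjoint analytic sets by Borel sets\<close>

definition borel_separated :: "'b::topological_space set \<Rightarrow> 'b set \<Rightarrow> bool" where
  "borel_separated A B \<longleftrightarrow> (\<exists>D\<in>sets borel. A \<subseteq> D \<and> D \<inter> B = {})"

text \<open>Read contrapositively, two unions that cannot be separated have a pair of members that
  cannot; this drives the descent through cylinders below.\<close>

lemma borel_separated_Union:
  assumes "\<And>(i::nat) (j::nat). borel_separated (A i) (B j)"
  shows "borel_separated (\<Union>i. A i) (\<Union>j. B j)"
proof -
  obtain D where D: "\<And>i j. D i j \<in> sets borel" "\<And>i j. A i \<subseteq> D i j" "\<And>i j. D i j \<inter> B j = {}"
    using assms unfolding borel_separated_def by metis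
  have "(\<Union>i. \<Inter>j. D i j) \<in> sets borel" using D(1) by (intro sets.countable_UN' sets.countable_INT') auto
  moreover have "(\<Union>i. A i) \<subseteq> (\<Union>i. \<Inter>j. D i j)" using D(2) by blast
  moreover have "(\<Union>i. \<Inter>j. D i j) \<inter> (\<Union>j. B j) = {}" using D(3) by (auto 4 3 simp: disjoint_iff)
  ultimately show ?thesis unfolding borel_separated_def by blast
qed

text \<open>If the images could not be separated, neither could those of the cylinders of every
  length along two branches \<open>z\<close> and \<open>z'\<close>. But
  \<open>f z \<noteq> g z'\<close>, and disjoint neighbourhoods of these points separate the images
  of long cylinders.\<close>

theorem lusin_separation:
  assumes "analytic A" "analytic B" "A \<inter> B = {}"
  shows "borel_separated A B"
proof (rule ccontr)
  assume nsep: "\<not> borel_separated A B"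
  obtain C f where C: "closed (C :: (nat \<Rightarrow> nat) set)" "continuous_on C f" "A = f ` C"
    using assms(1) unfolding analytic_def by blast
  obtain D g where D: "closed (D :: (nat \<Rightarrow> nat) set)" "continuous_on D g" "B = g ` D"
    using assms(2) unfolding analytic_def by blast
  define P where "P p \<longleftrightarrow> \<not> borel_separated (f ` (C \<inter> cyl (fst p))) (g ` (D \<inter> cyl (snd p)))" for p
  have "\<exists>F. \<forall>n. (P (F n) \<and> (n = 0 \<longrightarrow> F n = ([], []))) \<and>
      (\<exists>i j. F (Suc n) = (fst (F n) @ [i], snd (F n) @ [j]))"
  proof (rule dependent_nat_choice)
    show "\<exists>p. P p \<and> (0 = (0::nat) \<longrightarrow> p = ([], []))"
      using nsep C D by (auto simp: P_def)
  next
    fix p and n :: nat assume "P p \<and> (n = 0 \<longrightarrow> p = ([], []))"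
    then have "\<not> borel_separated (\<Union>i. f ` (C \<inter> cyl (fst p @ [i]))) (\<Union>j. g ` (D \<inter> cyl (snd p @ [j])))"
      unfolding P_def using cyl_snoc[of "fst p"] cyl_snoc[of "snd p"]
      by (simp add: image_UN[symmetric] Int_UN_distrib[symmetric])
    then obtain i j where "\<not> borel_separated (f ` (C \<inter> cyl (fst p @ [i]))) (g ` (D \<inter> cyl (snd p @ [j])))"
      using borel_separated_Union[of "\<lambda>i. f ` (C \<inter> cyl (fst p @ [i]))" "\<lambda>j. g ` (D \<inter> cyl (snd p @ [j]))"]
      by metis
    then show "\<exists>q. (P q \<and> (Suc n = 0 \<longrightarrow> q = ([], []))) \<and> (\<exists>i j. q = (fst p @ [i], snd p @ [j]))"
      by (intro exI[of _ "(fst p @ [i], snd p @ [j])"]) (auto simp: P_def)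
  qed
  then obtain F where F: "\<And>n. P (F n)" "F 0 = ([], [])"
    "\<And>n. \<exists>i j. F (Suc n) = (fst (F n) @ [i], snd (F n) @ [j])"
    by metis
  define z where "z n = fst (F (Suc n)) ! n" for n
  define z' where "z' n = snd (F (Suc n)) ! n" for n
  have F_eq: "F n = (seg z n, seg z' n)" for n
  proof (induction n)
    case (Suc n)
    obtain i j where "F (Suc n) = (fst (F n) @ [i], snd (F n) @ [j])" using F(3) by blast
    then show ?case using Suc by (simp add: z_def z'_def nth_append)
  qed (simp add: F(2))
  have nsep': "\<not> borel_separated (f ` (C \<inter> cyl (seg z n))) (g ` (D \<inter> cyl (seg z' n)))" for n
    using F(1)[of n] by (simp add: P_def F_eq)
  have "C \<inter> cyl (seg z n) \<noteq> {}" "D \<inter> cyl (seg z' n) \<noteq> {}" for n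
    using nsep'[of n] unfolding borel_separated_def by auto
  then have z: "z \<in> C" "z' \<in> D" using C(1) D(1) closed_mem_cyl by blast+
  then have "f z \<noteq> g z'" using assms(3) C(3) D(3) by blast
  then obtain U V where UV: "open U" "open V" "f z \<in> U" "g z' \<in> V" "U \<inter> V = {}"
    using hausdorff[of "f z" "g z'"] by metis
  obtain n where n: "\<And>m. m \<ge> n \<Longrightarrow> f ` (C \<inter> cyl (seg z m)) \<subseteq> U"
    using continuous_on_cyl[OF C(2) z(1) UV(1,3)] by metis
  obtain n' where n': "\<And>m. m \<ge> n' \<Longrightarrow> g ` (D \<inter> cyl (seg z' m)) \<subseteq> V"
    using continuous_on_cyl[OF D(2) z(2) UV(2,4)] by metis
  define m where "m = max n n'"
  have "f ` (C \<inter> cyl (seg z m)) \<subseteq> U" "g ` (D \<inter> cyl (seg z' m)) \<subseteq> V"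
    using n[of m] n'[of m] by (auto simp: m_def)
  then have "borel_separated (f ` (C \<inter> cyl (seg z m))) (g ` (D \<inter> cyl (seg z' m)))"
    unfolding borel_separated_def using UV by (intro bexI[of _ U]) auto
  then show False using nsep' by blast
qed

text \<open>The projection of the graph is only known to be analytic, so the function is extended
  instead of being measured on its domain. For each coordinate \<open>n\<close>, the arguments with
  value 1 and those with value 0 are disjoint analytic sets, and a Borel set separating them defines
  coordinate \<open>n\<close> of the extension.\<close>

lemma analytic_graph_extends:
  fixes A :: "('b::t2_space \<times> (nat \<Rightarrow> real)) set"
  assumes A: "analytic A" "A \<subseteq> UNIV \<times> cantor"
    and graph: "\<And>x y y'. (x, y) \<in> A \<Longrightarrow> (x, y') \<in> A \<Longrightarrow> y = y'"
  shows "\<exists>g\<in>borel_measurable borel. \<forall>x y. (x, y) \<in> A \<longrightarrow> y = g x"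
proof -
  have an: "analytic (fst ` (A \<inter> {p. snd p n = c}))" for n c
  proof (rule analytic_image)
    obtain C f where C: "closed (C :: (nat \<Rightarrow> nat) set)" "continuous_on C f" "A = f ` C"
      using A(1) unfolding analytic_def by blast
    have "continuous_on C (\<lambda>z. snd (f z) n)"
      by (rule continuous_on_product_then_coordinatewise) (intro continuous_on_snd C(2))
    then have "closed (C \<inter> (\<lambda>z. snd (f z) n) -` {c})"
      using C(1) by (intro continuous_closed_preimage) auto
    moreover have "A \<inter> {p. snd p n = c} = f ` (C \<inter> (\<lambda>z. snd (f z) n) -` {c})"
      using C(3) by auto
    moreover have "continuous_on (C \<inter> (\<lambda>z. snd (f z) n) -` {c}) f"
      by (rule continuous_on_subset[OF C(2)]) blast
    ultimately show "analytic (A \<inter> {p. snd p n = c})"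
      unfolding analytic_def by metis
  qed (intro continuous_intros)
  have "borel_separated (fst ` (A \<inter> {p. snd p n = 1})) (fst ` (A \<inter> {p. snd p n = 0}))" for n
  proof (rule lusin_separation)
    show "fst ` (A \<inter> {p. snd p n = 1}) \<inter> fst ` (A \<inter> {p. snd p n = 0}) = {}"
      using graph by force
  qed (rule an)+
  then obtain D where D: "\<And>n. D n \<in> sets borel" "\<And>n. fst ` (A \<inter> {p. snd p n = 1}) \<subseteq> D n"
    "\<And>n. D n \<inter> fst ` (A \<inter> {p. snd p n = 0}) = {}"
    unfolding borel_separated_def by metis
  define g where "g x n = (indicator (D n) x :: real)" for x n
  have "g \<in> borel_measurable borel"
    by (rule measurable_coordinatewise_then_product) (simp add: g_def borel_measurable_indicator D(1))
  moreover have "y = g x" if xy: "(x, y) \<in> A" for x y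
  proof
    fix n
    have "y n = 0 \<or> y n = 1" using xy A(2) by (auto simp: cantor_def)
    then show "y n = g x n"
    proof
      assume "y n = 0"
      then have "x \<in> fst ` (A \<inter> {p. snd p n = 0})" using xy by force
      then show ?thesis using D(3)[of n] \<open>y n = 0\<close> by (auto simp: g_def indicator_def)
    next
      assume "y n = 1"
      then have "x \<in> fst ` (A \<inter> {p. snd p n = 1})" using xy by force
      then show ?thesis using D(2)[of n] \<open>y n = 1\<close> by (auto simp: g_def indicator_def)
    qed
  qed
  ultimately show ?thesis by blast
qed

section \<open>The Lusin--Novikov theorem\<close>

text \<open>Deletes the leading binary digit of a positive number. The cylinder that is new at time
  \<open>m\<close> is split off from the one with index \<open>binary_parent m\<close>.\<close>

definition binary_parent :: "nat \<Rightarrow> nat" where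
  "binary_parent m = m - 2 ^ (GREATEST e. 2 ^ e \<le> m)"

lemma binary_parent_eq:
  assumes "i < 2 ^ e"
  shows "binary_parent (2 ^ e + i) = i"
proof -
  have "(GREATEST k. 2 ^ k \<le> 2 ^ e + i) = e"
  proof (rule Greatest_equality)
    fix k assume "2 ^ k \<le> 2 ^ e + i"
    also have "\<dots> < 2 ^ Suc e" using assms by simp
    finally show "k \<le> e" using power_less_imp_less_exp[of "2::nat" k "Suc e"] by simp
  qed simp
  then show ?thesis by (simp add: binary_parent_def)
qed

lemma binary_parent_le: "binary_parent (Suc n) \<le> n"
proof -
  have "(1::nat) \<le> 2 ^ (GREATEST e. 2 ^ e \<le> Suc n)" by simp
  then show ?thesis unfolding binary_parent_def by linarith
qed

text \<open>The number with binary digits \<open>\<beta> 0\<close>, ...,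
  \<open>\<beta> (e - 1)\<close>, least significant first. It is the index of the cylinder that the
  branch \<open>\<beta>\<close> follows at level \<open>e\<close>; a false digit keeps the index and
  a true one moves on to the newly split-off index.\<close>

primrec binary_index :: "(nat \<Rightarrow> bool) \<Rightarrow> nat \<Rightarrow> nat" where
  "binary_index \<beta> 0 = 0"
| "binary_index \<beta> (Suc e) = (if \<beta> e then 2 ^ e else 0) + binary_index \<beta> e"

lemma binary_index_less: "binary_index \<beta> e < 2 ^ e"
  by (induction e) auto

lemma binary_index_cong: "(\<And>i. i < e \<Longrightarrow> \<beta> i = \<gamma> i) \<Longrightarrow> binary_index \<beta> e = binary_index \<gamma> e"
  by (induction e) auto

lemma uncountable_bool_seq: "\<not> countable (UNIV :: (nat \<Rightarrow> bool) set)"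
proof
  assume "countable (UNIV :: (nat \<Rightarrow> bool) set)"
  then obtain f :: "nat \<Rightarrow> nat \<Rightarrow> bool" where f: "range f = UNIV"
    by (metis UNIV_not_empty range_from_nat_into)
  then obtain n where "f n = (\<lambda>i. \<not> f i i)" by (metis surjD)
  then show False by (metis (full_types))
qed

text \<open>
  Here \<open>a n\<close> lists \<open>n + 1\<close> cylinders, and \<open>a (n + 1)\<close> splits the one with index
  \<open>binary_parent (n + 1)\<close>. Since every index below \<open>2 ^ e\<close> is split between the times
  \<open>2 ^ e - 1\<close> and \<open>2 ^ (e + 1) - 1\<close>, the branches form a Cantor set, and since all members
  of \<open>x n\<close> lie over the same point, so do all branches.
\<close>

lemma cantor_scheme:
  fixes f :: "(nat \<Rightarrow> nat) \<Rightarrow> 'b::t2_space \<times> 'c::t2_space" and a :: "nat \<Rightarrow> nat list list"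
  assumes C: "closed C" "continuous_on C f"
    and len: "\<And>n. length (a n) = Suc n" "\<And>n i. i \<le> n \<Longrightarrow> length (a n ! i) \<ge> n"
    and live: "\<And>n. \<exists>x. \<forall>i\<le>n. \<exists>z\<in>C \<inter> cyl (a n ! i). fst (f z) = x"
    and ext: "\<And>n i. i \<le> n \<Longrightarrow> cyl (a (Suc n) ! i) \<subseteq> cyl (a n ! i)"
    and new: "\<And>n. cyl (a (Suc n) ! Suc n) \<subseteq> cyl (a n ! binary_parent (Suc n))"
    and disj: "\<And>n. f ` (C \<inter> cyl (a (Suc n) ! binary_parent (Suc n)))
                   \<inter> f ` (C \<inter> cyl (a (Suc n) ! Suc n)) = {}"
  shows "\<exists>x. \<not> countable ((f ` C) `` {x})"
proof -
  \<comment> \<open>A list \<open>a n\<close> has \<open>n + 1\<close> entries, so at this time the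
    indices are exactly those below \<open>2 ^ e\<close>, one for each string of \<open>e\<close>
    binary digits.\<close>
  define T where "T e = 2 ^ e - (1::nat)" for e :: nat
  have T_Suc: "T (Suc e) = T e + 2 ^ e" for e by (simp add: T_def)
  have T_ge: "T e \<ge> e" for e
    unfolding T_def using less_exp[of e] by linarith
  have ext': "cyl (a n' ! i) \<subseteq> cyl (a n ! i)" if "i \<le> n" "n \<le> n'" for n n' i
    using that(2)
  proof (induction n' rule: dec_induct)
    case (step m)
    then show ?case using ext[of i m] that by auto
  qed simp
  obtain x where x: "\<And>n i. i \<le> n \<Longrightarrow> \<exists>z\<in>C \<inter> cyl (a n ! i). fst (f z) = x n"
    using live by metis
  define u where "u \<beta> e = a (T e) ! binary_index \<beta> e" for \<beta> e
  have idx: "binary_index \<beta> e \<le> T e" for \<beta> e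
    using binary_index_less[of \<beta> e] by (simp add: T_def)
  have u_Suc: "cyl (u \<beta> (Suc e)) \<subseteq> cyl (u \<beta> e)" for \<beta> e
  proof (cases "\<beta> e")
    case False
    then show ?thesis using ext'[OF idx, of e "T (Suc e)" \<beta>] by (simp add: u_def T_Suc)
  next
    case True
    define i where "i = binary_index \<beta> e"
    \<comment> \<open>The cylinder with index \<open>2 ^ e + i\<close> splits off from index
      \<open>i\<close> between the times \<open>n\<close> and \<open>Suc n\<close>, and
      \<open>Suc n\<close> equals its index.\<close>
    define n where "n = T e + i"
    have i: "i < 2 ^ e" unfolding i_def by (rule binary_index_less)
    have Sn: "Suc n = 2 ^ e + i" by (simp add: n_def T_def)
    have "cyl (u \<beta> (Suc e)) \<subseteq> cyl (a (Suc n) ! Suc n)"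
      using ext'[of "Suc n" "Suc n" "T (Suc e)"] True Sn i
      by (simp add: u_def i_def[symmetric] T_def)
    also have "\<dots> \<subseteq> cyl (a n ! i)" using new[of n] binary_parent_eq[OF i] Sn by simp
    also have "\<dots> \<subseteq> cyl (a (T e) ! i)" using ext'[of i "T e" n] idx[of \<beta> e] by (simp add: n_def i_def)
    finally show ?thesis by (simp add: u_def i_def)
  qed
  have u_mono: "cyl (u \<beta> e') \<subseteq> cyl (u \<beta> e)" if "e \<le> e'" for \<beta> e e'
    using that u_Suc by (rule lift_Suc_antimono_le[of "\<lambda>e. cyl (u \<beta> e)", rotated])
  have "\<exists>\<zeta>\<in>C. (\<lambda>e. x (T e)) \<longlonglongrightarrow> fst (f \<zeta>) \<and> (\<forall>e. \<zeta> \<in> cyl (u \<beta> e))" for \<beta>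
  proof -
    have "\<forall>e. \<exists>z. z \<in> C \<and> z \<in> cyl (u \<beta> e) \<and> fst (f z) = x (T e)"
      using x[OF idx] by (fastforce simp: u_def)
    then obtain z where z: "\<And>e. z e \<in> C" "\<And>e. z e \<in> cyl (u \<beta> e)" "\<And>e. fst (f (z e)) = x (T e)"
      by metis
    have "length (u \<beta> e) \<ge> e" for e
      using len(2)[OF idx, of e \<beta>] T_ge[of e] by (simp add: u_def)
    then obtain \<zeta> where \<zeta>: "z \<longlonglongrightarrow> \<zeta>" "\<And>e. \<zeta> \<in> cyl (u \<beta> e)"
      using cyl_limit[of "u \<beta>" z] u_Suc z(2) by metis
    have "C \<inter> cyl (seg \<zeta> n) \<noteq> {}" for n
    proof -
      have "open (cyl (seg \<zeta> n))"
      proof -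
        have "cyl (seg \<zeta> n) = (\<Inter>i\<in>{..<n}. (\<lambda>y. y i) -` {\<zeta> i})"
          by (auto simp: mem_cyl_seg)
        then show ?thesis by (auto intro!: open_INT open_vimage open_discrete)
      qed
      then have "\<forall>\<^sub>F e in sequentially. z e \<in> cyl (seg \<zeta> n)"
        using topological_tendstoD[OF \<zeta>(1)] by simp
      then obtain e where "z e \<in> cyl (seg \<zeta> n)" by (auto simp: eventually_sequentially)
      then show ?thesis using z(1) by blast
    qed
    then have "\<zeta> \<in> C" using C(1) closed_mem_cyl by metis
    have "(\<lambda>e. f (z e)) \<longlonglongrightarrow> f \<zeta>"
      by (rule continuous_on_tendsto_compose[OF C(2) \<zeta>(1) \<open>\<zeta> \<in> C\<close>]) (simp add: z(1))
    then have "(\<lambda>e. fst (f (z e))) \<longlonglongrightarrow> fst (f \<zeta>)" by (rule tendsto_fst)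
    then show ?thesis using \<open>\<zeta> \<in> C\<close> \<zeta>(2) z(3) by auto
  qed
  then obtain \<zeta> where \<zeta>: "\<And>\<beta>. \<zeta> \<beta> \<in> C" "\<And>\<beta>. (\<lambda>e. x (T e)) \<longlonglongrightarrow> fst (f (\<zeta> \<beta>))"
    "\<And>\<beta> e. \<zeta> \<beta> \<in> cyl (u \<beta> e)"
    by metis
  define x' where "x' = fst (f (\<zeta> (\<lambda>_. False)))"
  have fst_eq: "fst (f (\<zeta> \<beta>)) = x'" for \<beta>
    unfolding x'_def using \<zeta>(2) LIMSEQ_unique by blast
  \<comment> \<open>At the first difference \<open>e\<close> both branches have index
    \<open>i\<close>; then one keeps it and the other passes to \<open>2 ^ e + i\<close>. The images
    of these two cylinders are disjoint from the moment of the splitting, and later cylinders only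
    shrink.\<close>
  have split: "f (\<zeta> \<beta>) \<noteq> f (\<zeta> \<gamma>)" if e: "\<And>i. i < e \<Longrightarrow> \<beta> i = \<gamma> i" "\<not> \<beta> e" "\<gamma> e" for \<beta> \<gamma> e
  proof -
    define i where "i = binary_index \<beta> e"
    have i': "binary_index \<gamma> e = i" using binary_index_cong[of e \<beta> \<gamma>] e(1) by (simp add: i_def)
    define n where "n = T e + i"
    have i: "i < 2 ^ e" unfolding i_def by (rule binary_index_less)
    have Sn: "Suc n = 2 ^ e + i" by (simp add: n_def T_def)
    have le: "Suc n \<le> T (Suc e)" using i by (simp add: Sn T_def)
    have "u \<beta> (Suc e) = a (T (Suc e)) ! i" "u \<gamma> (Suc e) = a (T (Suc e)) ! Suc n"
      using e i' by (simp_all add: u_def i_def Sn)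
    then have "\<zeta> \<beta> \<in> cyl (a (Suc n) ! i)" "\<zeta> \<gamma> \<in> cyl (a (Suc n) ! Suc n)"
      using \<zeta>(3)[of \<beta> "Suc e"] \<zeta>(3)[of \<gamma> "Suc e"] ext'[of i "Suc n" "T (Suc e)"]
        ext'[of "Suc n" "Suc n" "T (Suc e)"] le Sn
      by auto
    then show ?thesis
      using disj[of n] \<zeta>(1) binary_parent_eq[OF i] Sn by auto
  qed
  have inj: "inj (\<lambda>\<beta>. snd (f (\<zeta> \<beta>)))"
  proof (rule injI, rule ccontr)
    fix \<beta> \<gamma> assume eq: "snd (f (\<zeta> \<beta>)) = snd (f (\<zeta> \<gamma>))" and "\<beta> \<noteq> \<gamma>"
    then have ex: "\<exists>e. \<beta> e \<noteq> \<gamma> e" by auto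
    define e where "e = (LEAST e. \<beta> e \<noteq> \<gamma> e)"
    have e: "\<beta> e \<noteq> \<gamma> e" "\<And>i. i < e \<Longrightarrow> \<beta> i = \<gamma> i"
      using LeastI_ex[OF ex] not_less_Least by (auto simp: e_def)
    have "f (\<zeta> \<beta>) = f (\<zeta> \<gamma>)" using eq fst_eq by (metis prod_eqI)
    then show False using split[of e \<beta> \<gamma>] split[of e \<gamma> \<beta>] e by metis
  qed
  have "range (\<lambda>\<beta>. snd (f (\<zeta> \<beta>))) \<subseteq> (f ` C) `` {x'}"
  proof (rule image_subsetI)
    fix \<beta>
    have "f (\<zeta> \<beta>) = (x', snd (f (\<zeta> \<beta>)))" by (simp add: fst_eq[symmetric, of \<beta>])
    then show "snd (f (\<zeta> \<beta>)) \<in> (f ` C) `` {x'}" using \<zeta>(1)[of \<beta>] by (metis Image_singleton_iff image_eqI)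
  qed
  then have "\<not> countable ((f ` C) `` {x'})"
    using inj uncountable_bool_seq by (metis countable_image_inj_on countable_subset countable_image_inj_eq)
  then show ?thesis by blast
qed


lemma closed_cyl: "closed (cyl s)"
proof -
  have "cyl s = (\<Inter>i\<in>{..<length s}. (\<lambda>z. z i) -` {s ! i})"
    by (auto simp: cyl_def)
  moreover have "closed (\<Inter>i\<in>{..<length s}. (\<lambda>z :: nat \<Rightarrow> nat. z i) -` {s ! i})"
    by (intro closed_INT ballI closed_vimage) auto
  ultimately show ?thesis by simp
qed

section \<open>Countable unions of Borel graphs\<close>

definition graph_union :: "(nat \<Rightarrow> 'b \<Rightarrow> 'c) \<Rightarrow> ('b \<times> 'c) set" where
  "graph_union g = {(x, y). \<exists>n. y = g n x}"

text \<open>These serve as the negligible sets: the family is closed under countable unions, and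
  since the functions are total and Borel, its members are Borel.\<close>

definition small :: "((nat \<Rightarrow> real) \<times> (nat \<Rightarrow> real)) set \<Rightarrow> bool" where
  "small B \<longleftrightarrow> (\<exists>g. (\<forall>n. g n \<in> borel_measurable borel) \<and> B = graph_union g)"

lemma small_graph:
  assumes "g \<in> borel_measurable borel"
  shows "small {(x, y). y = g x}"
  unfolding small_def graph_union_def using assms by (intro exI[of _ "\<lambda>_. g"]) auto

lemma small_Union:
  assumes "\<And>n::nat. small (B n)"
  shows "small (\<Union>n. B n)"
proof -
  obtain g where g: "\<And>n k. g n k \<in> borel_measurable borel" "\<And>n. B n = graph_union (g n)"
    using assms unfolding small_def by metis
  have "(\<Union>n. B n) = graph_union (\<lambda>k. g (fst (prod_decode k)) (snd (prod_decode k)))"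
  proof (intro subset_antisym subsetI)
    fix p assume "p \<in> (\<Union>n. B n)"
    then obtain n k where nk: "snd p = g n k (fst p)" by (auto simp: g(2) graph_union_def)
    then have "snd p = g (fst (prod_decode (prod_encode (n, k)))) (snd (prod_decode (prod_encode (n, k)))) (fst p)"
      by simp
    then show "p \<in> graph_union (\<lambda>k. g (fst (prod_decode k)) (snd (prod_decode k)))"
      unfolding graph_union_def case_prod_unfold by blast
  next
    fix p assume "p \<in> graph_union (\<lambda>k. g (fst (prod_decode k)) (snd (prod_decode k)))"
    then obtain k where "snd p = g (fst (prod_decode k)) (snd (prod_decode k)) (fst p)"
      unfolding graph_union_def case_prod_unfold by blast
    then have "\<exists>k'. snd p = g (fst (prod_decode k)) k' (fst p)" by blast
    then have "p \<in> graph_union (g (fst (prod_decode k)))"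
      unfolding graph_union_def by (simp add: case_prod_unfold)
    then show "p \<in> (\<Union>n. B n)" unfolding g(2) by blast
  qed
  then show ?thesis
    unfolding small_def
    by (intro exI[of _ "\<lambda>k. g (fst (prod_decode k)) (snd (prod_decode k))"] conjI allI g(1))
qed

lemma small_Un:
  assumes "small A" "small B"
  shows "small (A \<union> B)"
proof -
  have "small (\<Union>n::nat. if n = 0 then A else B)" using assms by (intro small_Union) auto
  moreover have "(\<Union>n::nat. if n = 0 then A else B) = A \<union> B"
  proof (intro subset_antisym subsetI)
    fix x assume "x \<in> A \<union> B"
    then have "x \<in> (if (0::nat) = 0 then A else B) \<or> x \<in> (if (1::nat) = 0 then A else B)" by simp
    then show "x \<in> (\<Union>n::nat. if n = 0 then A else B)" by blast
  qed (auto split: if_splits)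
  ultimately show ?thesis by metis
qed

lemma small_borel:
  assumes "small B"
  shows "B \<in> sets borel"
proof -
  obtain g where g: "\<And>n. g n \<in> borel_measurable borel" "B = graph_union g"
    using assms unfolding small_def by blast
  have fst: "fst \<in> borel_measurable (borel :: ((nat \<Rightarrow> real) \<times> (nat \<Rightarrow> real)) measure)"
    and snd: "snd \<in> borel_measurable (borel :: ((nat \<Rightarrow> real) \<times> (nat \<Rightarrow> real)) measure)"
    by (intro borel_measurable_continuous_onI continuous_on_fst continuous_on_snd continuous_on_id)+
  have "{p \<in> space borel. snd p = g n (fst p)} \<in> sets borel" for n
    by (intro measurable_equality_set snd measurable_compose[OF fst g(1)])
  then have "(\<Union>n. {p \<in> space borel. snd p = g n (fst p)}) \<in> sets borel"
    by blast
  moreover have "B = (\<Union>n. {p \<in> space borel. snd p = g n (fst p)})"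
    unfolding g(2) graph_union_def by auto
  ultimately show ?thesis by simp
qed

text \<open>If a point of \<open>R\<close> were left outside \<open>B\<close>, the list
  \<open>[[]]\<close> would survive \<open>B\<close> and could be split again and again, following
  \<open>binary_parent\<close>; the resulting scheme would contradict the countability of the
  sections.\<close>

theorem lusin_novikov_cantor:
  fixes R :: "((nat \<Rightarrow> real) \<times> (nat \<Rightarrow> real)) set"
  assumes R: "R \<in> sets borel" "R \<subseteq> cantor \<times> cantor" and count: "\<And>x. countable (R `` {x})"
  obtains g where "\<And>n::nat. g n \<in> borel_measurable borel" "R \<subseteq> graph_union g"
proof -
  obtain C f where C: "closed (C :: (nat \<Rightarrow> nat) set)" "continuous_on C f" "R = f ` C"
    using borel_imp_analytic[OF R] unfolding analytic_def by blast
  \<comment> \<open>The point \<open>x\<close> is common to all members of the list; this is what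
    puts all branches of the scheme into a single section.\<close>
  define live where "live B a \<longleftrightarrow> (\<exists>x. \<forall>u\<in>set a. \<exists>z\<in>C \<inter> cyl u. fst (f z) = x \<and> f z \<notin> B)"
    for B and a :: "nat list list"
  have live_mono: "live B a" if "live B' a" "B \<subseteq> B'" for B B' a
    using that unfolding live_def by (meson subsetD)
  txt \<open>
    Only countably many approximations \<open>a\<close> exist, so a single small set \<open>B\<close> kills all those that
    some small set kills. An approximation surviving \<open>B\<close> can be split at any of its members:
    otherwise the points that survive at this member would form the graph of a function, which
    extends to a Borel function and hence is contained in a small set.
  \<close>
  define d where "d a = (if \<exists>B. small B \<and> \<not> live B a then SOME B. small B \<and> \<not> live B a
      else {(x, y). y = x})" for a
  have d: "small (d a)" "(\<exists>B. small B \<and> \<not> live B a) \<Longrightarrow> \<not> live (d a) a" for a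
  proof -
    have "small {(x, y). y = x}" using small_graph[of "\<lambda>x. x"] by simp
    moreover have "small (SOME B. small B \<and> \<not> live B a) \<and> \<not> live (SOME B. small B \<and> \<not> live B a) a"
      if "\<exists>B. small B \<and> \<not> live B a"
      using that by (rule someI_ex)
    ultimately show "small (d a)" "(\<exists>B. small B \<and> \<not> live B a) \<Longrightarrow> \<not> live (d a) a"
      by (auto simp: d_def)
  qed
  define B where "B = (\<Union>n. d (from_nat n))"
  have B: "small B" unfolding B_def by (intro small_Union d)
  have live_B: "live B' a" if "live B a" "small B'" for B' a
  proof (rule ccontr)
    assume "\<not> live B' a"
    then have "\<not> live (d a) a" using that(2) d(2) by blast
    moreover have "d (from_nat (to_nat a)) \<subseteq> B" unfolding B_def by blast
    then have "d a \<subseteq> B" by simp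
    ultimately show False using live_mono that(1) by blast
  qed
  define Z where "Z u = f ` (C \<inter> cyl u) \<inter> (R - B)" for u
  have Z: "analytic (Z u)" for u
  proof -
    have "analytic (f ` (C \<inter> cyl u))"
      unfolding analytic_def
      by (intro exI[of _ "C \<inter> cyl u"] exI[of _ f] conjI closed_Int C(1) closed_cyl refl
          continuous_on_subset[OF C(2)]) blast
    moreover have "analytic (R - B)"
      using R small_borel[OF B] by (intro borel_imp_analytic) auto
    ultimately show ?thesis unfolding Z_def by (rule analytic_Int)
  qed
  have step: "\<exists>a'. live B a' \<and> length a' = Suc (length a) \<and> (\<forall>u\<in>set a'. length u \<ge> m) \<and>
      (\<forall>j<length a. cyl (a' ! j) \<subseteq> cyl (a ! j)) \<and> cyl (a' ! length a) \<subseteq> cyl (a ! i) \<and>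
      f ` (C \<inter> cyl (a' ! i)) \<inter> f ` (C \<inter> cyl (a' ! length a)) = {}"
    if a: "live B a" "i < length a" for a i m
  proof -
    \<comment> \<open>The first coordinates over which every member of \<open>a\<close> has a
      surviving point. A splitting of \<open>a ! i\<close> over such a point leaves all other
      members alive over that same point.\<close>
    define X where "X = (\<Inter>u\<in>set a. fst ` Z u)"
    have "analytic X"
      unfolding X_def using a(2)
      by (intro analytic_finite_Inter analytic_image Z continuous_intros) auto
    then have "analytic (Z (a ! i) \<inter> X \<times> cantor)"
      by (intro analytic_Int Z analytic_Times_cantor)
    moreover have "Z (a ! i) \<inter> X \<times> cantor \<subseteq> UNIV \<times> cantor" by blast
    ultimately have an: "analytic (Z (a ! i) \<inter> X \<times> cantor)" "Z (a ! i) \<inter> X \<times> cantor \<subseteq> UNIV \<times> cantor"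
      by blast+
    have "\<exists>x y y'. (x, y) \<in> Z (a ! i) \<and> (x, y') \<in> Z (a ! i) \<and> y \<noteq> y' \<and> x \<in> X"
    proof (rule ccontr)
      assume no: "\<nexists>x y y'. (x, y) \<in> Z (a ! i) \<and> (x, y') \<in> Z (a ! i) \<and> y \<noteq> y' \<and> x \<in> X"
      have gr: "y = y'" if "(x, y) \<in> Z (a ! i) \<inter> X \<times> cantor" "(x, y') \<in> Z (a ! i) \<inter> X \<times> cantor" for x y y'
        using no that by blast
      obtain g where g: "g \<in> borel_measurable borel"
        "\<And>x y. (x, y) \<in> Z (a ! i) \<inter> X \<times> cantor \<Longrightarrow> y = g x"
        using analytic_graph_extends[OF an] gr by metis
      have "small (B \<union> {(x, y). y = g x})" by (intro small_Un B small_graph g)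
      then have "live (B \<union> {(x, y). y = g x}) a" using live_B a(1) by blast
      then obtain x where x: "\<And>u. u \<in> set a \<Longrightarrow> \<exists>z\<in>C \<inter> cyl u. fst (f z) = x \<and> f z \<notin> B \<union> {(x, y). y = g x}"
        unfolding live_def by blast
      have "x \<in> X"
        unfolding X_def
      proof (rule INT_I)
        fix u assume "u \<in> set a"
        then obtain z where z: "z \<in> C \<inter> cyl u" "fst (f z) = x" "f z \<notin> B" using x by blast
        then have "f z \<in> Z u" using C(3) by (simp add: Z_def)
        then show "x \<in> fst ` Z u" using z(2) by (metis imageI)
      qed
      moreover obtain z where z: "z \<in> C \<inter> cyl (a ! i)" "fst (f z) = x" "f z \<notin> B \<union> {(x, y). y = g x}"
        using x[of "a ! i"] a(2) by (metis nth_mem)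
      moreover have "f z \<in> R" using z(1) C(3) by blast
      ultimately have "(x, snd (f z)) \<in> Z (a ! i) \<inter> X \<times> cantor" and "snd (f z) \<noteq> g x"
        using R(2) by (auto simp: Z_def case_prod_unfold)
      then show False using g(2) by blast
    qed
    then obtain x y y' where xy: "(x, y) \<in> Z (a ! i)" "(x, y') \<in> Z (a ! i)" "y \<noteq> y'" "x \<in> X"
      by blast
    obtain p q where pq: "p \<in> C \<inter> cyl (a ! i)" "f p = (x, y)" "q \<in> C \<inter> cyl (a ! i)" "f q = (x, y')"
      using xy unfolding Z_def by auto
    have notB: "(x, y) \<notin> B" "(x, y') \<notin> B" using xy by (auto simp: Z_def)
    have "f p \<noteq> f q" using pq xy(3) by simp
    then obtain U V where UV: "open U" "open V" "f p \<in> U" "f q \<in> V" "U \<inter> V = {}"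
      using hausdorff[of "f p" "f q"] by metis
    obtain n where n: "\<And>k. k \<ge> n \<Longrightarrow> f ` (C \<inter> cyl (seg p k)) \<subseteq> U"
      using continuous_on_cyl[OF C(2) _ UV(1,3)] pq(1) by (metis IntD1)
    obtain n' where n': "\<And>k. k \<ge> n' \<Longrightarrow> f ` (C \<inter> cyl (seg q k)) \<subseteq> V"
      using continuous_on_cyl[OF C(2) _ UV(2,4)] pq(3) by (metis IntD1)
    have "\<exists>z. z \<in> C \<inter> cyl (a ! j) \<and> fst (f z) = x \<and> f z \<notin> B" if "j < length a" for j
    proof -
      have "x \<in> fst ` Z (a ! j)" using xy(4) that unfolding X_def by (meson INT_D nth_mem)
      then show ?thesis unfolding Z_def by auto
    qed
    then obtain r where r: "\<And>j. j < length a \<Longrightarrow> r j \<in> C \<inter> cyl (a ! j) \<and> fst (f (r j)) = x \<and> f (r j) \<notin> B"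
      by metis
    define z where "z j = (if j = length a then q else if j = i then p else r j)" for j
    have z: "z j \<in> C" "fst (f (z j)) = x" "f (z j) \<notin> B" if "j \<le> length a" for j
      using that r[of j] pq notB by (auto simp: z_def)
    have z_cyl: "z j \<in> cyl (a ! j)" if "j < length a" for j
      using that r[of j] pq by (auto simp: z_def)
    \<comment> \<open>Long enough for the demanded length \<open>m\<close>, for the images near
      \<open>p\<close> and \<open>q\<close> to lie in \<open>U\<close> and \<open>V\<close>, and for
      the new cylinders to refine the old ones.\<close>
    define N where "N = Max (set (m # n # n' # map length a))"
    have N: "m \<le> N" "n \<le> N" "n' \<le> N" and N_len: "\<And>j. j < length a \<Longrightarrow> length (a ! j) \<le> N"
      unfolding N_def by (rule Max_ge; simp)+
    define a' where "a' = map (\<lambda>j. seg (z j) N) [0..<Suc (length a)]"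
    have len: "length a' = Suc (length a)" by (simp add: a'_def)
    have nth: "a' ! j = seg (z j) N" if "j \<le> length a" for j
      using that unfolding a'_def by (subst nth_map) (simp_all del: upt_Suc)
    have "live B a'"
      unfolding live_def
    proof (intro exI[of _ x] ballI)
      fix u assume "u \<in> set a'"
      then have "u \<in> (\<lambda>j. seg (z j) N) ` {0..<Suc (length a)}"
        by (simp only: a'_def set_map set_upt)
      then obtain j where "j \<in> {0..<Suc (length a)}" and u: "u = seg (z j) N" by (rule imageE)
      then have j: "j \<le> length a" by simp
      show "\<exists>z\<in>C \<inter> cyl u. fst (f z) = x \<and> f z \<notin> B"
        using z[OF j] u by (intro bexI[of _ "z j"]) auto
    qed
    moreover have "\<forall>u\<in>set a'. m \<le> length u"
      using N(1) unfolding a'_def by (auto simp del: upt_Suc)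
    moreover have "\<forall>j<length a. cyl (a' ! j) \<subseteq> cyl (a ! j)"
      using nth z_cyl N_len by (simp add: cyl_seg_subset)
    moreover have "cyl (a' ! length a) \<subseteq> cyl (a ! i)"
      using nth[of "length a"] pq(3) N_len[OF a(2)] by (simp add: z_def cyl_seg_subset)
    moreover have "f ` (C \<inter> cyl (a' ! i)) \<inter> f ` (C \<inter> cyl (a' ! length a)) = {}"
    proof -
      have "a' ! i = seg p N" "a' ! length a = seg q N"
        using nth[of i] nth[of "length a"] a(2) by (simp_all add: z_def)
      then show ?thesis using n[OF N(2)] n'[OF N(3)] UV(5) by auto
    qed
    ultimately show ?thesis using len by blast
  qed
  have "R \<subseteq> B"
  proof (rule ccontr)
    assume "\<not> R \<subseteq> B"
    then have live0: "live B [[]]" unfolding live_def using C(3) by auto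
    have "\<exists>a. \<forall>n. (live B (a n) \<and> length (a n) = Suc n \<and> (\<forall>u\<in>set (a n). n \<le> length u)) \<and>
        ((\<forall>j<Suc n. cyl (a (Suc n) ! j) \<subseteq> cyl (a n ! j)) \<and>
         cyl (a (Suc n) ! Suc n) \<subseteq> cyl (a n ! binary_parent (Suc n)) \<and>
         f ` (C \<inter> cyl (a (Suc n) ! binary_parent (Suc n))) \<inter> f ` (C \<inter> cyl (a (Suc n) ! Suc n)) = {})"
    proof (rule dependent_nat_choice)
      show "\<exists>a. live B a \<and> length a = Suc 0 \<and> (\<forall>u\<in>set a. 0 \<le> length u)"
        using live0 by (intro exI[of _ "[[]]"]) simp
    next
      fix a and n :: nat
      assume a: "live B a \<and> length a = Suc n \<and> (\<forall>u\<in>set a. n \<le> length u)"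
      then have "binary_parent (Suc n) < length a"
        using binary_parent_le[of n] by simp
      with a show "\<exists>a'. (live B a' \<and> length a' = Suc (Suc n) \<and> (\<forall>u\<in>set a'. Suc n \<le> length u)) \<and>
        ((\<forall>j<Suc n. cyl (a' ! j) \<subseteq> cyl (a ! j)) \<and>
         cyl (a' ! Suc n) \<subseteq> cyl (a ! binary_parent (Suc n)) \<and>
         f ` (C \<inter> cyl (a' ! binary_parent (Suc n))) \<inter> f ` (C \<inter> cyl (a' ! Suc n)) = {})"
        using step[of a "binary_parent (Suc n)" "Suc n"] by metis
    qed
    then obtain a where a: "\<And>n. live B (a n)" "\<And>n. length (a n) = Suc n"
      "\<And>n u. u \<in> set (a n) \<Longrightarrow> n \<le> length u"
      "\<And>n j. j < Suc n \<Longrightarrow> cyl (a (Suc n) ! j) \<subseteq> cyl (a n ! j)"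
      "\<And>n. cyl (a (Suc n) ! Suc n) \<subseteq> cyl (a n ! binary_parent (Suc n))"
      "\<And>n. f ` (C \<inter> cyl (a (Suc n) ! binary_parent (Suc n))) \<inter> f ` (C \<inter> cyl (a (Suc n) ! Suc n)) = {}"
      by metis
    have "\<exists>x. \<not> countable ((f ` C) `` {x})"
    proof (rule cantor_scheme[OF C(1,2) a(2) _ _ _ a(5,6)])
      show "n \<le> length (a n ! i)" if "i \<le> n" for n i
        using that a(2)[of n] by (intro a(3)) simp
      show "\<exists>x. \<forall>i\<le>n. \<exists>z\<in>C \<inter> cyl (a n ! i). fst (f z) = x" for n
      proof -
        obtain x where x: "\<And>u. u \<in> set (a n) \<Longrightarrow> \<exists>z\<in>C \<inter> cyl u. fst (f z) = x \<and> f z \<notin> B"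
          using a(1)[of n] unfolding live_def by blast
        have "\<exists>z\<in>C \<inter> cyl (a n ! i). fst (f z) = x" if "i \<le> n" for i
          using x[of "a n ! i"] that a(2)[of n] by (metis le_imp_less_Suc nth_mem)
        then show ?thesis by blast
      qed
      show "cyl (a (Suc n) ! i) \<subseteq> cyl (a n ! i)" if "i \<le> n" for n i
        using that by (intro a(4)) simp
    qed
    then show False using count C(3) by blast
  qed
  moreover obtain g where "\<And>n. g n \<in> borel_measurable borel" "B = graph_union g"
    using B unfolding small_def by blast
  ultimately show thesis using that by blast
qed

section \<open>Standard Borel spaces\<close>

text \<open>A point is coded by the set of basic open sets that contain it. The codes of points are
  characterised by conditions that quantify over indices only: upward closed families of nonempty
  basic sets in which any two members contain the closure of a common refinement of small diameter.
  By completeness such a family converges to a point, so the image is Borel.\<close>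

lemma standard_borel_embedding:
  fixes M :: "'a measure"
  assumes "standard_borel M"
  obtains h :: "'a \<Rightarrow> nat \<Rightarrow> real" where "h \<in> borel_measurable M" "inj_on h (space M)"
    "h ` space M \<in> sets borel" "h ` space M \<subseteq> cantor"
    "\<And>A. A \<in> sets M \<Longrightarrow> \<exists>A'\<in>sets borel. A = h -` A' \<inter> space M"
proof -
  obtain T where T: "completely_metrizable_space T" "second_countable T" "topspace T = space M"
    and sets_T: "sets M = sigma_sets (space M) {U. openin T U}"
    using assms unfolding standard_borel_def by blast
  obtain X d where Xd: "Metric_space X d" "Metric_space.mcomplete X d" "T = Metric_space.mtopology X d"
    using T(1) unfolding completely_metrizable_space_def by blast
  interpret Metric_space X d by (rule Xd(1))
  have X: "space M = X" using T(3) Xd(3) topspace_mtopology by simp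
  have T_eq: "T = mtopology" by (rule Xd(3))
  obtain \<B> where \<B>: "countable \<B>" "\<And>V. V \<in> \<B> \<Longrightarrow> openin T V"
    "\<And>U x. openin T U \<Longrightarrow> x \<in> U \<Longrightarrow> \<exists>V\<in>\<B>. x \<in> V \<and> V \<subseteq> U"
    using T(2) unfolding second_countable_def by metis
  define B where "B = from_nat_into (insert {} \<B>)"
  have range_B: "range B = insert {} \<B>"
    unfolding B_def using \<B>(1) by (intro range_from_nat_into) auto
  have open_B: "openin mtopology (B n)" for n
  proof -
    have "B n \<in> insert {} \<B>" unfolding range_B[symmetric] by simp
    then show ?thesis using \<B>(2) T_eq by auto
  qed
  have base: "\<exists>n. x \<in> B n \<and> B n \<subseteq> U" if U: "openin mtopology U" "x \<in> U" for U x
  proof -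
    obtain V where V: "V \<in> \<B>" "x \<in> V" "V \<subseteq> U" using \<B>(3)[of U x] U T_eq by blast
    have "V \<in> range B" unfolding range_B using V(1) by simp
    then show ?thesis using V by blast
  qed
  have B_sub: "B n \<subseteq> X" for n using openin_subset[OF open_B] by simp
  have meas_B[measurable]: "B n \<in> sets M" for n
    unfolding sets_T using open_B T_eq by (auto intro: sigma_sets.Basic)
  define h where "h x n = (indicator (B n) x :: real)" for x n
  have h1: "h x n = 1 \<longleftrightarrow> x \<in> B n" for x n by (simp add: h_def indicator_def)
  have h_meas: "h \<in> borel_measurable M"
    by (rule measurable_coordinatewise_then_product) (simp add: h_def borel_measurable_indicator)
  have h_inj: "inj_on h (space M)"
  proof (rule inj_onI, rule ccontr)
    fix x y assume xy: "x \<in> space M" "y \<in> space M" "h x = h y" "x \<noteq> y"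
    then have "x \<in> mball x (d x y)" "y \<notin> mball x (d x y)" by (auto simp: X)
    then obtain n where "x \<in> B n" "y \<notin> B n" using base[OF openin_mball] by blast
    then show False using h1 xy(3) by metis
  qed
  have h_cantor: "h ` space M \<subseteq> cantor"
    by (auto simp: cantor_def h_def indicator_def)
  have coord[measurable]: "(\<lambda>c :: nat \<Rightarrow> real. c n) \<in> borel_measurable borel" for n
    by (intro borel_measurable_continuous_onI continuous_on_product_coordinates)
  have h_pre: "\<exists>A'\<in>sets borel. A = h -` A' \<inter> space M" if "A \<in> sets M" for A
    using that unfolding sets_T
  proof (induction rule: sigma_sets.induct)
    case (Basic U)
    have U: "openin mtopology U" using Basic T_eq by simp
    let ?A = "\<Union>n\<in>{n. B n \<subseteq> U}. {c :: nat \<Rightarrow> real. c n = 1}"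
    have "{c \<in> space borel. c n = (1::real)} \<in> sets borel" for n
      by measurable
    then have "?A \<in> sets borel" by (intro sets.countable_UN'') auto
    moreover have "U = h -` ?A \<inter> space M"
    proof (intro subset_antisym subsetI)
      fix x assume x: "x \<in> U"
      then obtain n where "x \<in> B n" "B n \<subseteq> U" using base[OF U] by metis
      then show "x \<in> h -` ?A \<inter> space M"
        using x openin_subset[OF U] by (auto simp: X h1)
    qed (auto simp: h1)
    ultimately show ?case by blast
  next
    case Empty
    then show ?case by (intro bexI[of _ "{}"]) auto
  next
    case (Compl A)
    then obtain A' where "A' \<in> sets borel" "A = h -` A' \<inter> space M" by blast
    then show ?case by (intro bexI[of _ "- A'"]) auto
  next
    case (Union A)
    then have "\<forall>i. \<exists>A'. A' \<in> sets borel \<and> A i = h -` A' \<inter> space M" by blast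
    from choice[OF this] obtain A' where A': "\<And>i. A' i \<in> sets borel" "\<And>i. A i = h -` A' i \<inter> space M"
      by blast
    have "(\<Union>i. A i) = h -` (\<Union>i. A' i) \<inter> space M" unfolding A'(2) by blast
    moreover have "(\<Union>i. A' i) \<in> sets borel" using A'(1) by blast
    ultimately show ?case by blast
  qed
  \<comment> \<open>The closure makes the limit point a member of the given sets and not just
    adherent to them; the bound \<open>1 / (k + 1)\<close> makes the family Cauchy.\<close>
  define Q where "Q n m k p \<longleftrightarrow> mtopology closure_of B p \<subseteq> B n \<inter> B m \<and>
    (\<forall>u\<in>B p. \<forall>v\<in>B p. d u v \<le> inverse (real (Suc k)))" for n m k p
  define G where "G = {c \<in> space borel. (\<forall>n. c n = 0 \<or> c n = (1::real)) \<and> (\<exists>n. c n = 1) \<and>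
    (\<forall>n. c n = 1 \<longrightarrow> B n \<noteq> {}) \<and> (\<forall>n m. c n = 1 \<longrightarrow> B n \<subseteq> B m \<longrightarrow> c m = 1) \<and>
    (\<forall>n m k. c n = 1 \<longrightarrow> c m = 1 \<longrightarrow> (\<exists>p. c p = 1 \<and> Q n m k p))}"
  have "G \<in> sets borel" unfolding G_def by measurable
  moreover have "h ` space M = G"
  proof (intro subset_antisym subsetI)
    fix c assume "c \<in> h ` space M"
    then obtain x where x: "x \<in> X" "c = h x" using X by blast
    have "\<exists>p. x \<in> B p \<and> Q n m k p" if nm: "x \<in> B n" "x \<in> B m" for n m k
    proof -
      have "openin mtopology (B n \<inter> B m)" using open_B by blast
      then obtain r where r: "r > 0" "mball x r \<subseteq> B n \<inter> B m"
        using nm unfolding openin_mtopology by blast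
      define s where "s = min (r / 2) (inverse (real (Suc k)) / 2)"
      have s: "s > 0" "s < r" "2 * s \<le> inverse (real (Suc k))"
        using r(1) by (auto simp: s_def)
      obtain p where p: "x \<in> B p" "B p \<subseteq> mball x s"
        using base[OF openin_mball, of x x s] x(1) s(1) by auto
      have "mtopology closure_of B p \<subseteq> mcball x s"
        using p(2) mball_subset_mcball by (intro closure_of_minimal closedin_mcball) blast
      also have "\<dots> \<subseteq> mball x r" using s(2) by auto
      finally have "mtopology closure_of B p \<subseteq> B n \<inter> B m" using r(2) by blast
      moreover have "d u v \<le> inverse (real (Suc k))" if uv: "u \<in> B p" "v \<in> B p" for u v
      proof -
        have "d x u < s" "d x v < s" "u \<in> X" "v \<in> X" using p(2) uv by auto
        moreover have "d u v \<le> d u x + d x v" using x(1) calculation by (intro triangle)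
        ultimately show ?thesis using s(3) commute[of u x] by linarith
      qed
      ultimately show ?thesis using p(1) unfolding Q_def by blast
    qed
    moreover have "\<exists>n. x \<in> B n" using base[OF openin_topspace, of x] x(1) by auto
    ultimately show "c \<in> G"
      unfolding G_def x(2) mem_Collect_eq h1 by (auto simp: h_def indicator_def)
  next
    fix c assume "c \<in> G"
    then obtain n0 where c: "\<And>n. c n = 0 \<or> c n = 1" "c n0 = 1" "\<And>n. c n = 1 \<Longrightarrow> B n \<noteq> {}"
      "\<And>n m. c n = 1 \<Longrightarrow> B n \<subseteq> B m \<Longrightarrow> c m = 1"
      "\<And>n m k. c n = 1 \<Longrightarrow> c m = 1 \<Longrightarrow> \<exists>p. c p = 1 \<and> Q n m k p"
      unfolding G_def by blast
    \<comment> \<open>Members chosen so that the closure of each lies in the one before and the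
      diameters tend to 0; completeness is then applied to the closures.\<close>
    have "\<exists>p. \<forall>k. c (p k) = 1 \<and> Q (p k) (p k) k (p (Suc k))"
      using c(2,5) by (intro dependent_nat_choice) blast+
    then obtain p where p: "\<And>k. c (p k) = 1" "\<And>k. Q (p k) (p k) k (p (Suc k))" by blast
    define F where "F k = mtopology closure_of B (p k)" for k
    have F_Suc: "F (Suc k) \<subseteq> B (p k)" for k using p(2)[of k] by (auto simp: Q_def F_def)
    have B_F: "B (p k) \<subseteq> F k" for k
      unfolding F_def using B_sub by (intro closure_of_subset) simp
    have small: "d u v \<le> inverse (real (Suc k))" if "u \<in> B (p (Suc k))" "v \<in> B (p (Suc k))" for u v k
      using p(2)[of k] that by (auto simp: Q_def)
    have "\<Inter>(range F) \<noteq> {}"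
    proof (rule mcomplete_nest[THEN iffD1, rule_format, OF Xd(2)], intro conjI allI impI)
      show "closedin mtopology (F n)" for n unfolding F_def by simp
      show "F n \<noteq> {}" for n using B_F[of n] c(3)[OF p(1)] by blast
      show "decseq F" using F_Suc B_F by (intro decseq_SucI) blast
    next
      fix \<epsilon> :: real assume "\<epsilon> > 0"
      then obtain k where k: "inverse (real (Suc k)) < \<epsilon>" using reals_Archimedean by blast
      obtain a where a: "a \<in> B (p (Suc k))" using c(3)[OF p(1)] by blast
      have "F (Suc (Suc k)) \<subseteq> mcball a \<epsilon>"
      proof
        fix v assume "v \<in> F (Suc (Suc k))"
        then have v: "v \<in> B (p (Suc k))" using F_Suc by blast
        then have "d a v \<le> \<epsilon>" using small[OF a v] k by linarith
        moreover have "a \<in> X" "v \<in> X" using a v B_sub by blast+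
        ultimately show "v \<in> mcball a \<epsilon>" by simp
      qed
      then show "\<exists>n a. F n \<subseteq> mcball a \<epsilon>" by blast
    qed
    then obtain x where "\<And>k. x \<in> F k" by blast
    then have x: "x \<in> B (p k)" for k using F_Suc by blast
    have xX: "x \<in> X" using x B_sub by blast
    have "x \<in> B n" if n: "c n = 1" for n
    proof -
      \<comment> \<open>It suffices that \<open>x\<close> is adherent to \<open>B q\<close>, whose
        closure lies in \<open>B n\<close>. Arbitrarily small members of the family contain
        \<open>x\<close>, and each meets \<open>B q\<close> because the two have a common nonempty
        refinement \<open>B p'\<close>.\<close>
      obtain q where q: "c q = 1" "Q n n 0 q" using c(5)[OF n n] by blast
      have "x \<in> mtopology closure_of B q"
        unfolding in_closure_of
      proof (intro conjI allI impI)
        show "x \<in> topspace mtopology" using xX by simp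
        fix U assume "x \<in> U \<and> openin mtopology U"
        then obtain r where r: "r > 0" "mball x r \<subseteq> U" unfolding openin_mtopology by blast
        obtain k where k: "inverse (real (Suc k)) < r" using r(1) reals_Archimedean by blast
        obtain p' where p': "c p' = 1" "Q q (p (Suc k)) 0 p'" using c(5)[OF q(1) p(1)] by blast
        obtain v where v: "v \<in> B p'" using c(3)[OF p'(1)] by blast
        have "B p' \<subseteq> mtopology closure_of B p'" using B_sub by (intro closure_of_subset) simp
        then have v': "v \<in> B q" "v \<in> B (p (Suc k))" using v p'(2) unfolding Q_def by blast+
        have "d x v < r" using small[OF x v'(2)] k by linarith
        moreover have "v \<in> X" using v B_sub by blast
        ultimately have "v \<in> mball x r" using xX by simp
        then have "v \<in> U" using r(2) by blast
        then show "\<exists>y. y \<in> B q \<and> y \<in> U" using v'(1) by blast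
      qed
      then show ?thesis using q(2) unfolding Q_def by blast
    qed
    moreover have "c n = 1" if n: "x \<in> B n" for n
    proof -
      obtain r where r: "r > 0" "mball x r \<subseteq> B n" using open_B n unfolding openin_mtopology by blast
      obtain k where k: "inverse (real (Suc k)) < r" using r(1) reals_Archimedean by blast
      have "B (p (Suc k)) \<subseteq> mball x r"
      proof
        fix v assume v: "v \<in> B (p (Suc k))"
        then have "d x v < r" using small[OF x v] k by linarith
        moreover have "v \<in> X" using v B_sub by blast
        ultimately show "v \<in> mball x r" using xX by simp
      qed
      then show ?thesis using c(4)[OF p(1)] r(2) by blast
    qed
    ultimately have "c = h x" using c(1) h1 by (metis ext h_def indicator_simps(2))
    then show "c \<in> h ` space M" using xX X by blast
  qed
  ultimately show thesis using that[OF h_meas h_inj _ h_cantor h_pre] by simp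
qed

text \<open>The embedding carries \<open>E\<close> to a Borel relation on the Cantor set with
  countable sections, and the functions whose graphs cover that relation are pulled back.\<close>

lemma countable_borel_equiv_enum:
  fixes M :: "'a measure" and E :: "'a rel"
  assumes "standard_borel M" "countable_borel_equiv M E"
  obtains \<gamma> :: "nat \<Rightarrow> 'a \<Rightarrow> 'a" where "\<And>n. \<gamma> n \<in> measurable M M"
    "\<And>x. x \<in> space M \<Longrightarrow> E `` {x} = range (\<lambda>n. \<gamma> n x)" "\<And>x. \<gamma> 0 x = x"
proof -
  obtain h :: "'a \<Rightarrow> nat \<Rightarrow> real" where h: "h \<in> borel_measurable M" "inj_on h (space M)"
    "h ` space M \<in> sets borel" "h ` space M \<subseteq> cantor"
    "\<And>A. A \<in> sets M \<Longrightarrow> \<exists>A'\<in>sets borel. A = h -` A' \<inter> space M"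
    using standard_borel_embedding[OF assms(1)] by metis
  have E: "equiv (space M) E" "E \<in> sets (M \<Otimes>\<^sub>M M)" "\<And>x. x \<in> space M \<Longrightarrow> countable (E `` {x})"
    using assms(2) unfolding countable_borel_equiv_def by auto
  have E_sub: "E \<subseteq> space M \<times> space M" using equiv_type[OF E(1)] .
  let ?H = "\<lambda>p. (h (fst p), h (snd p))"
  have image: "h ` A \<in> sets borel" if A: "A \<in> sets M" for A
  proof -
    obtain A' where A': "A' \<in> sets borel" "A = h -` A' \<inter> space M" using h(5)[OF A] by blast
    have "h ` A = A' \<inter> h ` space M" unfolding A'(2) by blast
    then show ?thesis using A'(1) h(3) by simp
  qed
  have "\<exists>E'\<in>sets borel. E = ?H -` E' \<inter> (space M \<times> space M)"
    using E(2) unfolding sets_pair_measure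
  proof (induction rule: sigma_sets.induct)
    case (Basic a)
    then obtain A B where AB: "a = A \<times> B" "A \<in> sets M" "B \<in> sets M" by blast
    obtain A' B' where AB': "A' \<in> sets borel" "A = h -` A' \<inter> space M" "B' \<in> sets borel" "B = h -` B' \<inter> space M"
      using h(5)[OF AB(2)] h(5)[OF AB(3)] by blast
    have "A' \<times> B' \<in> sets borel"
      unfolding borel_prod[symmetric] using AB' by (intro pair_measureI)
    moreover have "a = ?H -` (A' \<times> B') \<inter> (space M \<times> space M)" using AB(1) AB' by auto
    ultimately show ?case by blast
  next
    case Empty
    then show ?case by (intro bexI[of _ "{}"]) auto
  next
    case (Compl A)
    then obtain A' where "A' \<in> sets borel" "A = ?H -` A' \<inter> (space M \<times> space M)" by blast
    then show ?case by (intro bexI[of _ "- A'"]) auto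
  next
    case (Union A)
    then have "\<forall>i. \<exists>A'. A' \<in> sets borel \<and> A i = ?H -` A' \<inter> (space M \<times> space M)" by blast
    from choice[OF this] obtain A' where A': "\<And>i. A' i \<in> sets borel" "\<And>i. A i = ?H -` A' i \<inter> (space M \<times> space M)"
      by blast
    have "(\<Union>i. A i) = ?H -` (\<Union>i. A' i) \<inter> (space M \<times> space M)" unfolding A'(2) by blast
    moreover have "(\<Union>i. A' i) \<in> sets borel" using A'(1) by blast
    ultimately show ?case by blast
  qed
  then obtain E' where E': "E' \<in> sets borel" "E = ?H -` E' \<inter> (space M \<times> space M)" by blast
  \<comment> \<open>The set \<open>E'\<close> may contain pairs that are not codes of points;
    cutting down to the image of \<open>h\<close> gives countable sections over every
    \<open>c\<close>.\<close>
  define R where "R = E' \<inter> (h ` space M \<times> h ` space M)"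
  have "h ` space M \<times> h ` space M \<in> sets borel"
    unfolding borel_prod[symmetric] using h(3) by (intro pair_measureI)
  then have R: "R \<in> sets borel" "R \<subseteq> cantor \<times> cantor"
    unfolding R_def using E'(1) h(4) by auto
  have R_iff: "(h x, h y) \<in> R \<longleftrightarrow> (x, y) \<in> E" if "x \<in> space M" "y \<in> space M" for x y
    using that by (auto simp: R_def E'(2))
  have R_sec: "countable (R `` {c})" for c
  proof (cases "c \<in> h ` space M")
    case True
    then obtain x where x: "x \<in> space M" "c = h x" by blast
    have "R `` {c} \<subseteq> h ` (E `` {x})"
    proof
      fix b assume "b \<in> R `` {c}"
      then obtain y where "b = h y" "y \<in> space M" "(h x, h y) \<in> R" using x(2) by (auto simp: R_def)
      then show "b \<in> h ` (E `` {x})" using R_iff x(1) by blast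
    qed
    then show ?thesis using E(3)[OF x(1)] by (meson countable_image countable_subset)
  next
    case False
    then have "R `` {c} = {}" by (auto simp: R_def)
    then show ?thesis by simp
  qed
  obtain g where g: "\<And>n::nat. g n \<in> borel_measurable borel" "R \<subseteq> graph_union g"
    using lusin_novikov_cantor[OF R R_sec] by metis
  define k where "k = inv_into (space M) h"
  \<comment> \<open>The graphs cover \<open>R\<close> but may leave it; at such arguments the value
    \<open>x\<close> keeps \<open>\<gamma> n x\<close> in the class of \<open>x\<close>.\<close>
  define \<gamma> where "\<gamma> n x = (if (h x, g n (h x)) \<in> R then k (g n (h x)) else x)" for n x
  have k: "k (h y) = y" if "y \<in> space M" for y
    unfolding k_def using h(2) that by (rule inv_into_f_f)
  have gh[measurable]: "(\<lambda>x. g n (h x)) \<in> borel_measurable M" for n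
    using measurable_compose[OF h(1) g(1)] .
  have pair: "(\<lambda>x. (h x, g n (h x))) \<in> borel_measurable M" for n
    using h(1) gh by (rule borel_measurable_Pair)
  have in_R: "\<exists>y\<in>space M. g n (h x) = h y \<and> (x, y) \<in> E" if xR: "x \<in> space M" "(h x, g n (h x)) \<in> R" for x n
  proof -
    obtain y where "y \<in> space M" "g n (h x) = h y" using xR(2) by (auto simp: R_def)
    then show ?thesis using xR R_iff by metis
  qed
  have meas: "\<gamma> n \<in> measurable M M" for n
  proof (rule measurableI)
    show "\<gamma> n x \<in> space M" if "x \<in> space M" for x
      using in_R[OF that, of n] k that by (auto simp: \<gamma>_def)
  next
    fix A assume A: "A \<in> sets M"
    let ?D = "(\<lambda>x. (h x, g n (h x))) -` R \<inter> space M"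
    let ?A = "(\<lambda>x. g n (h x)) -` (h ` A) \<inter> space M"
    have "?D \<in> sets M" using pair R(1) by (rule measurable_sets)
    moreover have "?A \<in> sets M" using gh image[OF A] by (rule measurable_sets)
    ultimately have "(?D \<inter> ?A) \<union> (A - ?D) \<in> sets M" using A by blast
    moreover have "\<gamma> n -` A \<inter> space M = (?D \<inter> ?A) \<union> (A - ?D)"
    proof (intro set_eqI)
      fix x
      show "x \<in> \<gamma> n -` A \<inter> space M \<longleftrightarrow> x \<in> (?D \<inter> ?A) \<union> (A - ?D)"
      proof (cases "x \<in> ?D")
        case True
        then obtain y where y: "y \<in> space M" "g n (h x) = h y" using in_R by blast
        have "h y \<in> h ` A \<longleftrightarrow> y \<in> A"
          using h(2) y(1) sets.sets_into_space[OF A] by (meson inj_on_image_mem_iff)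
        then show ?thesis using True y k by (simp add: \<gamma>_def)
      next
        case False
        then show ?thesis using sets.sets_into_space[OF A] by (auto simp: \<gamma>_def)
      qed
    qed
    ultimately show "\<gamma> n -` A \<inter> space M \<in> sets M" by simp
  qed
  have refl: "(x, x) \<in> E" if "x \<in> space M" for x
    using E(1) that by (auto simp: equiv_def refl_on_def)
  have mem: "(x, \<gamma> n x) \<in> E" if "x \<in> space M" for n x
    using in_R[OF that, of n] k refl[OF that] by (auto simp: \<gamma>_def)
  have ex: "\<exists>n. y = \<gamma> n x" if "(x, y) \<in> E" for x y
  proof -
    have xy: "x \<in> space M" "y \<in> space M" using that E_sub by auto
    then have R': "(h x, h y) \<in> R" using R_iff that by blast
    then obtain n where "h y = g n (h x)" using g(2) by (auto simp: graph_union_def)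
    then have "\<gamma> n x = y" using R' k[OF xy(2)] by (simp add: \<gamma>_def)
    then show ?thesis by blast
  qed
  \<comment> \<open>The identity is put at index 0: the layout of infinite tiles below needs each
    root to come first in its own enumeration.\<close>
  show thesis
  proof (rule that[of "case_nat (\<lambda>x. x) \<gamma>"])
    show "case_nat (\<lambda>x. x) \<gamma> n \<in> measurable M M" for n
      using meas by (cases n) auto
    fix x assume x: "x \<in> space M"
    have "(x, case_nat (\<lambda>x. x) \<gamma> n x) \<in> E" for n using mem[OF x] refl[OF x] by (cases n) auto
    moreover have "\<exists>n. y = case_nat (\<lambda>x. x) \<gamma> n x" if "(x, y) \<in> E" for y
      using ex[OF that] by (metis nat.case(2))
    ultimately show "E `` {x} = range (\<lambda>n. case_nat (\<lambda>x. x) \<gamma> n x)" by blast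
  qed simp
qed

section \<open>The space of weight-finite sets\<close>

lemma summable_on_ennreal [simp]: "f summable_on A" for f :: "'b \<Rightarrow> ennreal"
  by (rule nonneg_summable_on_complete) simp

text \<open>Standard Borelness is used through two families: the functions \<open>\<gamma> n\<close>
  enumerate every class, possibly with repetitions, and the sets \<open>\<beta> n\<close> separate
  points, which makes equality of measurable functions a measurable predicate.\<close>

locale enumerated_equiv =
  fixes M :: "'a measure" and E L :: "'a rel" and w :: "'a \<Rightarrow> 'a \<Rightarrow> real"
    and \<gamma> :: "nat \<Rightarrow> 'a \<Rightarrow> 'a" and \<beta> :: "nat \<Rightarrow> 'a set"
  assumes equiv_E: "equiv (space M) E" and E_meas [measurable]: "E \<in> sets (M \<Otimes>\<^sub>M M)"
    and cocycle: "borel_cocycle M E w" and order: "borel_linear_order M L"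
    and \<gamma>_meas [measurable]: "\<gamma> n \<in> measurable M M"
    and \<gamma>_range: "x \<in> space M \<Longrightarrow> E `` {x} = range (\<lambda>n. \<gamma> n x)" and \<gamma>_0 [simp]: "\<gamma> 0 x = x"
    and \<beta>_meas [measurable]: "\<beta> n \<in> sets M"
    and \<beta>_sep: "x \<in> space M \<Longrightarrow> y \<in> space M \<Longrightarrow> x \<noteq> y \<Longrightarrow> \<exists>n. (x \<in> \<beta> n) \<noteq> (y \<in> \<beta> n)"
begin

lemma E_space: "(x, y) \<in> E \<Longrightarrow> x \<in> space M \<and> y \<in> space M"
  using equiv_type[OF equiv_E] by blast

lemma E_refl: "x \<in> space M \<Longrightarrow> (x, x) \<in> E"
  using equiv_E by (auto simp: equiv_def refl_on_def)

lemma E_sym: "(x, y) \<in> E \<Longrightarrow> (y, x) \<in> E"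
  using equiv_E by (auto simp: equiv_def sym_def)

lemma E_trans: "(x, y) \<in> E \<Longrightarrow> (y, z) \<in> E \<Longrightarrow> (x, z) \<in> E"
  using equiv_E by (auto simp: equiv_def trans_def)

lemma E_\<gamma>: "x \<in> space M \<Longrightarrow> (x, \<gamma> n x) \<in> E"
  using \<gamma>_range by blast

lemma \<gamma>_space: "x \<in> space M \<Longrightarrow> \<gamma> n x \<in> space M"
  using E_\<gamma> E_space by blast

lemma E_obtain_\<gamma>:
  assumes "(x, y) \<in> E"
  obtains n where "y = \<gamma> n x"
  using assms \<gamma>_range[of x] E_space[of x y] by auto

lemma w_pos: "(x, y) \<in> E \<Longrightarrow> w x y > 0"
  using cocycle by (auto simp: borel_cocycle_def)

lemma w_mult: "(x, y) \<in> E \<Longrightarrow> (y, z) \<in> E \<Longrightarrow> w x y * w y z = w x z"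
  using cocycle unfolding borel_cocycle_def by blast

lemma w_refl: "x \<in> space M \<Longrightarrow> w x x = 1"
  using w_mult[of x x x] w_pos[of x x] E_refl[of x] by simp

lemma w_inverse: "(x, y) \<in> E \<Longrightarrow> w x y * w y x = 1"
  using w_mult[of x y x] w_refl[of x] E_sym[of x y] E_space[of x y] by simp

lemma L_meas [measurable]: "L \<in> sets (M \<Otimes>\<^sub>M M)"
  using order by (simp add: borel_linear_order_def)

lemma measurable_eq [measurable (raw)]:
  assumes [measurable]: "f \<in> measurable N M" "g \<in> measurable N M"
  shows "Measurable.pred N (\<lambda>x. f x = g x)"
proof -
  have "Measurable.pred N (\<lambda>x. \<forall>n. f x \<in> \<beta> n \<longleftrightarrow> g x \<in> \<beta> n)" by measurable
  moreover have "(\<forall>n. f x \<in> \<beta> n \<longleftrightarrow> g x \<in> \<beta> n) \<longleftrightarrow> f x = g x" if "x \<in> space N" for x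
    using \<beta>_sep[of "f x" "g x"] measurable_space[OF assms(1) that] measurable_space[OF assms(2) that]
    by auto
  ultimately show ?thesis by (subst measurable_cong[of N _ "\<lambda>x. \<forall>n. f x \<in> \<beta> n \<longleftrightarrow> g x \<in> \<beta> n"]) auto
qed

text \<open>The values of \<open>w\<close> off \<open>E\<close> are arbitrary; replacing them by 0
  gives a function that is measurable on the whole product.\<close>

definition wt :: "'a \<Rightarrow> 'a \<Rightarrow> real" where
  "wt x y = (if (x, y) \<in> E then w x y else 0)"

lemma wt_meas [measurable]:
  assumes [measurable]: "f \<in> measurable N M" "g \<in> measurable N M"
  shows "(\<lambda>x. wt (f x) (g x)) \<in> borel_measurable N"
proof -
  have "(\<lambda>p. if p \<in> E then case_prod w p else 0) \<in> borel_measurable (M \<Otimes>\<^sub>M M)"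
    using cocycle E_meas unfolding borel_cocycle_def
    by (intro measurable_If_restrict_space_iff[THEN iffD2]) (auto simp: space_pair_measure)
  moreover have "(\<lambda>p. if p \<in> E then case_prod w p else 0) = (\<lambda>p. wt (fst p) (snd p))"
    by (auto simp: wt_def)
  ultimately have "(\<lambda>p. wt (fst p) (snd p)) \<in> borel_measurable (M \<Otimes>\<^sub>M M)" by simp
  from measurable_compose[OF measurable_Pair[OF assms] this] show ?thesis by simp
qed

definition first_index :: "'a \<Rightarrow> nat \<Rightarrow> bool" where
  "first_index x n \<longleftrightarrow> (\<forall>m<n. \<gamma> m x \<noteq> \<gamma> n x)"

lemma first_index_meas [measurable]: "Measurable.pred M (\<lambda>x. first_index x n)"
  unfolding first_index_def by measurable

lemma first_index_inj: "first_index x m \<Longrightarrow> first_index x n \<Longrightarrow> \<gamma> m x = \<gamma> n x \<Longrightarrow> m = n"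
  unfolding first_index_def by (metis nat_neq_iff)

lemma first_index_ex:
  assumes "(x, y) \<in> E"
  shows "\<exists>n. first_index x n \<and> \<gamma> n x = y"
proof -
  have ex: "\<exists>n. \<gamma> n x = y" using assms by (metis E_obtain_\<gamma>)
  show ?thesis
    using LeastI_ex[OF ex] not_less_Least[of _ "\<lambda>n. \<gamma> n x = y"] unfolding first_index_def by metis
qed

text \<open>The enumeration of a class may repeat points, and \<open>first_index\<close> keeps one
  index for each. Sums over subsets of a class thus become series over the natural numbers, whose
  measurability in \<open>x\<close> can be read off.\<close>

lemma infsum_class:
  fixes f :: "'a \<Rightarrow> ennreal"
  assumes "A \<subseteq> E `` {x}"
  shows "infsum f A = (\<Sum>n. if first_index x n \<and> \<gamma> n x \<in> A then f (\<gamma> n x) else 0)"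
proof -
  define I where "I = {n. first_index x n \<and> \<gamma> n x \<in> A}"
  have inj: "inj_on (\<lambda>n. \<gamma> n x) I"
    by (rule inj_onI) (auto simp: I_def intro: first_index_inj)
  have "A = (\<lambda>n. \<gamma> n x) ` I"
    using first_index_ex assms by (fastforce simp: I_def)
  then have "infsum f A = infsum (f \<circ> (\<lambda>n. \<gamma> n x)) I"
    using infsum_reindex[OF inj] by simp
  also have "\<dots> = infsum (\<lambda>n. if n \<in> I then f (\<gamma> n x) else 0) UNIV"
    by (rule infsum_cong_neutral) auto
  also have "\<dots> = (\<Sum>n. if n \<in> I then f (\<gamma> n x) else 0)"
    by (intro sums_unique has_sum_imp_sums has_sum_infsum) simp
  finally show ?thesis by (simp add: I_def)
qed

section \<open>The order \<open>wless\<close> and decreasing enumerations\<close>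

lemma wless_irrefl: "\<not> wless L E w x x"
  using w_refl[of x] E_space[of x x] order
  by (auto simp: wless_def borel_linear_order_def strict_linear_order_on_def irrefl_def)

lemma wless_trans:
  assumes "wless L E w x y" "wless L E w y z"
  shows "wless L E w x z"
proof -
  have xy: "(x, y) \<in> E" "(y, z) \<in> E" "w x y \<ge> 1" "w y z \<ge> 1"
    and c: "w x y > 1 \<or> w x y = 1 \<and> (x, y) \<in> L" "w y z > 1 \<or> w y z = 1 \<and> (y, z) \<in> L"
    using assms by (auto simp: wless_def)
  have m: "w x z = w x y * w y z" using w_mult[OF xy(1,2)] by simp
  have L: "(x, y) \<in> L \<Longrightarrow> (y, z) \<in> L \<Longrightarrow> (x, z) \<in> L"
    using order unfolding borel_linear_order_def strict_linear_order_on_def trans_def by blast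
  have "w x z > 1 \<or> w x z = 1 \<and> (x, z) \<in> L"
  proof (cases "w x y > 1 \<or> w y z > 1")
    case True
    then have "w x z > 1" unfolding m using xy(3,4) less_1_mult[of "w x y" "w y z"]
      by (cases "w x y = 1"; cases "w y z = 1") auto
    then show ?thesis by simp
  next
    case False
    then show ?thesis using c L m by auto
  qed
  then show ?thesis using E_trans[OF xy(1,2)] by (simp add: wless_def)
qed

lemma wless_total:
  assumes "(x, y) \<in> E" "x \<noteq> y"
  shows "wless L E w x y \<or> wless L E w y x"
proof -
  have "x \<in> space M" "y \<in> space M" using assms(1) E_space by auto
  then have L: "(x, y) \<in> L \<or> (y, x) \<in> L"
    using order assms(2) unfolding borel_linear_order_def strict_linear_order_on_def total_on_def by blast
  consider "w x y > 1" | "w x y = 1" | "w x y < 1" by linarith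
  then show ?thesis
  proof cases
    case 3
    then have "w y x > 1"
      using w_inverse[OF assms(1)] w_pos[OF assms(1)]
      by (metis E_sym assms(1) less_eq_real_def linorder_not_less mult_left_le order_less_irrefl w_pos)
    then show ?thesis using E_sym[OF assms(1)] by (simp add: wless_def)
  next
    case 2
    then have "w y x = 1" using w_inverse[OF assms(1)] by simp
    then show ?thesis using L 2 assms(1) E_sym by (auto simp: wless_def)
  qed (use assms(1) in \<open>auto simp: wless_def\<close>)
qed

definition at_rank :: "'a set \<Rightarrow> nat \<Rightarrow> 'a \<Rightarrow> bool" where
  "at_rank A n y \<longleftrightarrow> y \<in> A \<and> finite {z\<in>A. wless L E w y z} \<and> card {z\<in>A. wless L E w y z} = n"

lemma wenum_eq: "wenum L E w A n = (if \<exists>y. at_rank A n y then Some (THE y. at_rank A n y) else None)"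
  unfolding wenum_def at_rank_def Let_def ..

lemma at_rank_less:
  assumes "at_rank A n y" "at_rank A n y'" "wless L E w y y'"
  shows False
proof -
  have "{z\<in>A. wless L E w y' z} \<subset> {z\<in>A. wless L E w y z}"
    using assms wless_trans[OF assms(3)] wless_irrefl[of y'] by (auto simp: at_rank_def)
  then have "card {z\<in>A. wless L E w y' z} < card {z\<in>A. wless L E w y z}"
    using assms(1) by (intro psubset_card_mono) (auto simp: at_rank_def)
  then show False using assms by (simp add: at_rank_def)
qed

lemma related_E: "related_set M E A \<Longrightarrow> x \<in> A \<Longrightarrow> y \<in> A \<Longrightarrow> (x, y) \<in> E"
  unfolding related_set_def using E_sym E_trans by blast

lemma wenum_Some:
  assumes "related_set M E A" "at_rank A n y"
  shows "wenum L E w A n = Some y"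
proof -
  have "(THE y. at_rank A n y) = y"
  proof (rule the_equality)
    show "at_rank A n y" by (rule assms(2))
    fix y' assume y': "at_rank A n y'"
    then have "(y, y') \<in> E" using related_E[OF assms(1)] assms(2) by (auto simp: at_rank_def)
    then show "y' = y" using wless_total[of y y'] at_rank_less assms(2) y' by metis
  qed
  then show ?thesis using assms(2) by (auto simp: wenum_eq)
qed

lemma wenum_mem:
  assumes "related_set M E A" "wenum L E w A n = Some y"
  shows "y \<in> A"
proof -
  obtain y' where "at_rank A n y'" using assms(2) by (auto simp: wenum_eq split: if_splits)
  then show ?thesis using wenum_Some[OF assms(1)] assms(2) by (auto simp: at_rank_def)
qed

text \<open>Points above \<open>y\<close> weigh at least as much as \<open>y\<close>, so infinitely
  many of them would have infinite weight. Hence every point of a weight-finite set has a rank and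
  is listed by \<open>wenum\<close>.\<close>

lemma wfin_finite_above:
  assumes A: "A \<in> wfin_sets M E w" and y: "y \<in> A"
  shows "finite {z\<in>A. wless L E w y z}"
proof (rule ccontr)
  assume inf: "infinite {z\<in>A. wless L E w y z}"
  obtain x where x: "x \<in> E `` A" "weight w x A < \<infinity>" and rel: "related_set M E A"
    using A by (auto simp: wfin_sets_def)
  have xy: "(x, y) \<in> E" using x(1) related_E[OF rel] y E_sym E_trans by blast
  have "ennreal (w x y) \<le> ennreal (w x z)" if "z \<in> {z\<in>A. wless L E w y z}" for z
  proof -
    have "w y z \<ge> 1" "(y, z) \<in> E" using that by (auto simp: wless_def)
    then have "w x y * 1 \<le> w x y * w y z" using w_pos[OF xy] by (intro mult_left_mono) auto
    then show ?thesis using w_mult[OF xy \<open>(y, z) \<in> E\<close>] by (simp add: ennreal_leI)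
  qed
  then have "infsum (\<lambda>z. ennreal (w x z)) {z\<in>A. wless L E w y z} = \<infinity>"
    using w_pos[OF xy] inf by (intro infsum_superconst_infinite_ennreal[of _ "ennreal (w x y)"]) auto
  moreover have "infsum (\<lambda>z. ennreal (w x z)) {z\<in>A. wless L E w y z} \<le> weight w x A"
    unfolding weight_def by (rule infsum_mono_neutral) auto
  ultimately show False using x(2) by (simp add: top_unique)
qed

lemma wenum_surj:
  assumes "A \<in> wfin_sets M E w" "y \<in> A"
  shows "\<exists>n. wenum L E w A n = Some y"
proof -
  have "at_rank A (card {z\<in>A. wless L E w y z}) y"
    using wfin_finite_above[OF assms] assms(2) by (simp add: at_rank_def)
  moreover have "related_set M E A" using assms(1) by (simp add: wfin_sets_def)
  ultimately show ?thesis using wenum_Some by blast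
qed

section \<open>Borel collections of weight-finite sets\<close>

lemma space_option_space: "space (option_space M) = insert None (Some ` space M)"
proof -
  have "(`) Some ` sets M \<subseteq> Pow (insert None (Some ` space M))"
    using sets.sets_into_space by blast
  then show ?thesis unfolding option_space_def by (rule space_measure_of)
qed

lemma sets_option_space: "A \<in> sets M \<Longrightarrow> Some ` A \<in> sets (option_space M)"
proof -
  assume "A \<in> sets M"
  moreover have "(`) Some ` sets M \<subseteq> Pow (insert None (Some ` space M))"
    using sets.sets_into_space by blast
  ultimately show ?thesis unfolding option_space_def by auto
qed

lemma None_meas: "{None} \<in> sets (option_space M)"
proof -
  have "space (option_space M) - Some ` space M \<in> sets (option_space M)"
    using sets_option_space[OF sets.top] by blast
  moreover have "space (option_space M) - Some ` space M = {None}"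
    by (auto simp: space_option_space)
  ultimately show ?thesis by simp
qed

lemma case_option_meas:
  assumes "x0 \<in> space M"
  shows "(\<lambda>s. case s of None \<Rightarrow> x0 | Some x \<Rightarrow> x) \<in> measurable (option_space M) M"
proof (rule measurableI)
  fix A assume A: "A \<in> sets M"
  have "(\<lambda>s. case s of None \<Rightarrow> x0 | Some x \<Rightarrow> x) -` A \<inter> space (option_space M) =
      Some ` A \<union> (if x0 \<in> A then {None} else {})"
    using sets.sets_into_space[OF A] by (auto simp: space_option_space split: option.splits)
  then show "(\<lambda>s. case s of None \<Rightarrow> x0 | Some x \<Rightarrow> x) -` A \<inter> space (option_space M) \<in> sets (option_space M)"
    using sets_option_space[OF A] sets.Un[OF sets_option_space[OF A] None_meas] by simp
qed (use assms in \<open>auto simp: space_option_space\<close>)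

lemma wenum_space:
  assumes "A \<in> wfin_sets M E w"
  shows "wenum L E w A \<in> space (\<Pi>\<^sub>M n\<in>(UNIV :: nat set). option_space M)"
proof -
  have rel: "related_set M E A" using assms by (simp add: wfin_sets_def)
  have "wenum L E w A n \<in> space (option_space M)" for n
  proof (cases "wenum L E w A n")
    case (Some y)
    then have "y \<in> A" by (rule wenum_mem[OF rel])
    then have "y \<in> space M" using related_E[OF rel] E_space by blast
    then show ?thesis using Some by (simp add: space_option_space)
  qed (simp add: space_option_space)
  then show ?thesis by (auto simp: space_PiM)
qed

text \<open>
  Whether a set is a class can be read off from the entries of its enumeration, without
  computing any ranks.
\<close>

lemma classes_meas:
  assumes R [measurable]: "R \<in> sets (M \<Otimes>\<^sub>M M)" and "R \<subseteq> E" "sym R" "trans R"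
    and wfin: "\<And>x. x \<in> Domain R \<Longrightarrow> R `` {x} \<in> wfin_sets M E w"
  shows "{R `` {x} |x. x \<in> Domain R} \<in> sets (wfin_space M L E w)"
proof (cases "space M = {}")
  case True
  then have "Domain R = {}" using assms(2) E_space by fastforce
  then show ?thesis by simp
next
  case False
  then obtain x0 where x0: "x0 \<in> space M" by blast
  let ?N = "\<Pi>\<^sub>M n\<in>(UNIV :: nat set). option_space M"
  \<comment> \<open>The default \<open>x0\<close> only makes \<open>v k\<close> total;
    \<open>W\<close> guards every use of \<open>v k s\<close> by the condition that
    \<open>s k\<close> is not \<open>None\<close>.\<close>
  define v where "v k s = (case s k of None \<Rightarrow> x0 | Some x \<Rightarrow> x)" for k and s :: "nat \<Rightarrow> 'a option"
  have comp: "(\<lambda>s. s k) \<in> measurable ?N (option_space M)" for k :: nat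
    by (rule measurable_component_singleton) simp
  have v_meas[measurable]: "v k \<in> measurable ?N M" for k
    unfolding v_def[abs_def] using measurable_compose[OF comp case_option_meas[OF x0]] .
  have None_pred[measurable]: "Measurable.pred ?N (\<lambda>s. s k = None)" for k
  proof -
    have "(\<lambda>s. s k) -` {None} \<inter> space ?N \<in> sets ?N" using comp None_meas by (rule measurable_sets)
    moreover have "(\<lambda>s. s k) -` {None} \<inter> space ?N = {s \<in> space ?N. s k = None}" by auto
    ultimately show ?thesis by (simp add: pred_def)
  qed
  define W where "W = {s \<in> space ?N.
    (\<forall>k l. \<not> s k = None \<longrightarrow> \<not> s l = None \<longrightarrow> (v k s, v l s) \<in> R) \<and>
    (\<forall>k i. \<not> s k = None \<longrightarrow> (v k s, \<gamma> i (v k s)) \<in> R \<longrightarrow> (\<exists>l. \<not> s l = None \<and> v l s = \<gamma> i (v k s)))}"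
  have "W \<in> sets ?N" unfolding W_def by measurable
  moreover have "{R `` {x} |x. x \<in> Domain R} = wenum L E w -` W \<inter> wfin_sets M E w"
  proof (intro subset_antisym subsetI)
    fix A assume "A \<in> {R `` {x} |x. x \<in> Domain R}"
    then obtain x where x: "x \<in> Domain R" "A = R `` {x}" by blast
    have A: "A \<in> wfin_sets M E w" using wfin[OF x(1)] x(2) by simp
    then have rel: "related_set M E A" by (simp add: wfin_sets_def)
    have v: "v k (wenum L E w A) \<in> A \<and> wenum L E w A k = Some (v k (wenum L E w A))"
      if "wenum L E w A k \<noteq> None" for k
      using that wenum_mem[OF rel] by (auto simp: v_def)
    have AA: "(y, z) \<in> R" if "y \<in> A" "z \<in> A" for y z
      using that \<open>sym R\<close> \<open>trans R\<close> unfolding x(2) by (meson Image_singleton_iff symD transD)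
    have AR: "z \<in> A" if "y \<in> A" "(y, z) \<in> R" for y z
      using that \<open>trans R\<close> unfolding x(2) by (meson Image_singleton_iff transD)
    have "wenum L E w A \<in> W"
      unfolding W_def
    proof (intro CollectI conjI allI impI)
      show "wenum L E w A \<in> space ?N" by (rule wenum_space[OF A])
    next
      fix k l assume "\<not> wenum L E w A k = None" "\<not> wenum L E w A l = None"
      then show "(v k (wenum L E w A), v l (wenum L E w A)) \<in> R" using v AA by blast
    next
      fix k i assume k: "\<not> wenum L E w A k = None" "(v k (wenum L E w A), \<gamma> i (v k (wenum L E w A))) \<in> R"
      then have "\<gamma> i (v k (wenum L E w A)) \<in> A" using v AR by blast
      then obtain l where "wenum L E w A l = Some (\<gamma> i (v k (wenum L E w A)))"
        using wenum_surj[OF A] by blast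
      then show "\<exists>l. \<not> wenum L E w A l = None \<and> v l (wenum L E w A) = \<gamma> i (v k (wenum L E w A))"
        by (intro exI[of _ l]) (simp add: v_def)
    qed
    then show "A \<in> wenum L E w -` W \<inter> wfin_sets M E w" using A by simp
  next
    fix A assume "A \<in> wenum L E w -` W \<inter> wfin_sets M E w"
    then have W: "wenum L E w A \<in> W" and A: "A \<in> wfin_sets M E w" by auto
    have rel: "related_set M E A" and ne: "A \<noteq> {}" using A by (auto simp: wfin_sets_def)
    obtain x where x: "x \<in> A" using ne by blast
    obtain k where k: "wenum L E w A k = Some x" using wenum_surj[OF A x] by blast
    then have vk: "v k (wenum L E w A) = x" by (simp add: v_def)
    have "A = R `` {x}"
    proof (intro subset_antisym subsetI)
      fix y assume "y \<in> A"
      then obtain l where l: "wenum L E w A l = Some y" using wenum_surj[OF A] by blast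
      then have "v l (wenum L E w A) = y" by (simp add: v_def)
      then have "(x, y) \<in> R" using W k l vk unfolding W_def by force
      then show "y \<in> R `` {x}" by blast
    next
      fix y assume "y \<in> R `` {x}"
      then have y: "(x, y) \<in> R" by blast
      then obtain i where i: "y = \<gamma> i x" using \<open>R \<subseteq> E\<close> E_obtain_\<gamma> by blast
      have "\<exists>l. \<not> wenum L E w A l = None \<and> v l (wenum L E w A) = \<gamma> i x"
        using W k vk y i unfolding W_def by force
      then obtain l where "\<not> wenum L E w A l = None" "v l (wenum L E w A) = y" using i by blast
      then have "wenum L E w A l = Some y" by (auto simp: v_def)
      then show "y \<in> A" by (rule wenum_mem[OF rel])
    qed
    then show "A \<in> {R `` {x} |x. x \<in> Domain R}" using x by blast
  qed
  ultimately show ?thesis unfolding wfin_space_def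
    using wenum_space by (subst sets_vimage_algebra2) auto
qed

section \<open>Finite sets given by sets of indices\<close>

definition \<gamma>_image :: "nat set \<Rightarrow> 'a \<Rightarrow> 'a set" where
  "\<gamma>_image F x = (\<lambda>n. \<gamma> n x) ` F"

definition first_in :: "nat set \<Rightarrow> 'a \<Rightarrow> nat \<Rightarrow> bool" where
  "first_in F x m \<longleftrightarrow> m \<in> F \<and> (\<forall>m'. m' < m \<longrightarrow> m' \<in> F \<longrightarrow> \<gamma> m' x \<noteq> \<gamma> m x)"

lemma first_in_meas [measurable]: "Measurable.pred M (\<lambda>x. first_in F x m)"
  unfolding first_in_def by measurable

lemma \<gamma>_image_first: "\<gamma>_image F x = (\<lambda>m. \<gamma> m x) ` {m. first_in F x m}"
proof (intro subset_antisym subsetI)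
  fix z assume "z \<in> \<gamma>_image F x"
  then have ex: "\<exists>m. m \<in> F \<and> z = \<gamma> m x" by (auto simp: \<gamma>_image_def)
  define m where "m = (LEAST m. m \<in> F \<and> z = \<gamma> m x)"
  have "m \<in> F \<and> z = \<gamma> m x" unfolding m_def by (rule LeastI_ex[OF ex])
  moreover have "\<gamma> m' x \<noteq> z" if "m' < m" "m' \<in> F" for m'
    using not_less_Least[OF that(1)[unfolded m_def]] that(2) by blast
  ultimately show "z \<in> (\<lambda>m. \<gamma> m x) ` {m. first_in F x m}" by (auto simp: first_in_def)
qed (auto simp: \<gamma>_image_def first_in_def)

lemma inj_on_first_in: "inj_on (\<lambda>m. \<gamma> m x) {m. first_in F x m}"
  by (rule inj_onI) (metis (mono_tags, lifting) first_in_def mem_Collect_eq nat_neq_iff)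

lemma related_\<gamma>_image: "x \<in> space M \<Longrightarrow> related_set M E (\<gamma>_image F x)"
  unfolding related_set_def \<gamma>_image_def using E_\<gamma> by blast

lemma fin_wfin: "fin_sets M E \<subseteq> wfin_sets M E w"
proof
  fix A assume "A \<in> fin_sets M E"
  then have A: "A \<noteq> {}" "related_set M E A" "finite A" by (auto simp: fin_sets_def)
  obtain x where x: "x \<in> A" using A(1) by blast
  have "(x, x) \<in> E" using related_E[OF A(2) x x] .
  moreover have "weight w x A < \<infinity>"
    unfolding weight_def using A(3) by (simp add: less_top[symmetric])
  ultimately show "A \<in> wfin_sets M E w" using A x unfolding wfin_sets_def by blast
qed

lemma \<gamma>_image_fin: "finite F \<Longrightarrow> F \<noteq> {} \<Longrightarrow> x \<in> space M \<Longrightarrow> \<gamma>_image F x \<in> fin_sets M E"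
  using related_\<gamma>_image[of x F] by (auto simp: fin_sets_def \<gamma>_image_def)

lemma wless_meas [measurable]:
  assumes [measurable]: "f \<in> measurable N M" "g \<in> measurable N M"
  shows "Measurable.pred N (\<lambda>x. wless L E w (f x) (g x))"
proof -
  have "Measurable.pred N (\<lambda>x. (f x, g x) \<in> E \<and> (wt (f x) (g x) > 1 \<or> wt (f x) (g x) = 1 \<and> (f x, g x) \<in> L))"
    by measurable
  moreover have "(\<lambda>x. (f x, g x) \<in> E \<and> (wt (f x) (g x) > 1 \<or> wt (f x) (g x) = 1 \<and> (f x, g x) \<in> L)) =
      (\<lambda>x. wless L E w (f x) (g x))"
    by (auto simp: wless_def wt_def)
  ultimately show ?thesis by simp
qed

text \<open>The rank of \<open>\<gamma> n x\<close> is the number of first indices in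
  \<open>F\<close> whose points lie above it, so each entry of the enumeration depends measurably on
  \<open>x\<close>. Through these maps, Borelness of a collection of sets becomes Borelness of sets
  of points.\<close>

lemma \<gamma>_image_meas:
  assumes F: "finite F" "F \<noteq> {}"
  shows "\<gamma>_image F \<in> measurable M (wfin_space M L E w)"
  unfolding wfin_space_def
proof (rule measurable_vimage_algebra2)
  show "\<gamma>_image F \<in> space M \<rightarrow> wfin_sets M E w" using \<gamma>_image_fin[OF F] fin_wfin by blast
  define r where "r k n x \<longleftrightarrow> card {m. first_in F x m \<and> wless L E w (\<gamma> n x) (\<gamma> m x)} = k" for k n x
  have r_meas: "Measurable.pred M (r k n)" for k n
    unfolding r_def[abs_def] by measurable
  have r_iff: "at_rank (\<gamma>_image F x) k (\<gamma> n x) \<longleftrightarrow> r k n x" if "n \<in> F" for k n x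
  proof -
    let ?J = "{m. first_in F x m \<and> wless L E w (\<gamma> n x) (\<gamma> m x)}"
    have "{z\<in>\<gamma>_image F x. wless L E w (\<gamma> n x) z} = (\<lambda>m. \<gamma> m x) ` ?J"
      unfolding \<gamma>_image_first by blast
    moreover have "inj_on (\<lambda>m. \<gamma> m x) ?J"
      by (rule inj_on_subset[OF inj_on_first_in]) blast
    ultimately have "card {z\<in>\<gamma>_image F x. wless L E w (\<gamma> n x) z} = card ?J" by (simp add: card_image)
    then show ?thesis using that F(1) unfolding at_rank_def r_def by (auto simp: \<gamma>_image_def)
  qed
  show "(\<lambda>x. wenum L E w (\<gamma>_image F x)) \<in> measurable M (\<Pi>\<^sub>M n\<in>(UNIV :: nat set). option_space M)"
  proof (rule measurable_PiM_single')
    fix k :: nat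
    have Some: "wenum L E w (\<gamma>_image F x) k = Some (\<gamma> n x)" if "x \<in> space M" "n \<in> F" "r k n x" for x n
      using wenum_Some[OF related_\<gamma>_image[OF that(1)]] r_iff that by blast
    have None: "wenum L E w (\<gamma>_image F x) k = None" if "\<forall>n\<in>F. \<not> r k n x" for x
    proof -
      have "\<not> at_rank (\<gamma>_image F x) k y" for y
        using that r_iff by (auto simp: \<gamma>_image_def at_rank_def)
      then show ?thesis by (simp add: wenum_eq)
    qed
    show "(\<lambda>x. wenum L E w (\<gamma>_image F x) k) \<in> measurable M (option_space M)"
      unfolding option_space_def
    proof (rule measurable_measure_of)
      show "(`) Some ` sets M \<subseteq> Pow (insert None (Some ` space M))"
        using sets.sets_into_space by blast
      show "(\<lambda>x. wenum L E w (\<gamma>_image F x) k) \<in> space M \<rightarrow> insert None (Some ` space M)"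
        using Some None \<gamma>_space by fastforce
      fix B assume "B \<in> (`) Some ` sets M"
      then obtain A where A: "A \<in> sets M" "B = Some ` A" by blast
      note [measurable] = r_meas A(1)
      have "{x\<in>space M. \<exists>n\<in>F. r k n x \<and> \<gamma> n x \<in> A} \<in> sets M"
        using F(1) by measurable
      moreover have "(\<lambda>x. wenum L E w (\<gamma>_image F x) k) -` B \<inter> space M = {x\<in>space M. \<exists>n\<in>F. r k n x \<and> \<gamma> n x \<in> A}"
      proof (intro subset_antisym subsetI)
        fix x assume x: "x \<in> (\<lambda>x. wenum L E w (\<gamma>_image F x) k) -` B \<inter> space M"
        then obtain a where a: "a \<in> A" "wenum L E w (\<gamma>_image F x) k = Some a" using A(2) by auto
        then obtain n where "n \<in> F" "r k n x" using None[of x] by auto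
        then show "x \<in> {x\<in>space M. \<exists>n\<in>F. r k n x \<and> \<gamma> n x \<in> A}" using a x Some[of x n] by auto
      next
        fix x assume "x \<in> {x\<in>space M. \<exists>n\<in>F. r k n x \<and> \<gamma> n x \<in> A}"
        then show "x \<in> (\<lambda>x. wenum L E w (\<gamma>_image F x) k) -` B \<inter> space M"
          using A(2) Some by auto
      qed
      ultimately show "(\<lambda>x. wenum L E w (\<gamma>_image F x) k) -` B \<inter> space M \<in> sets M" by simp
    qed
  qed (use wenum_space \<gamma>_image_fin[OF F] fin_wfin in \<open>auto simp: space_PiM\<close>)
qed

end

section \<open>Growing a tiling\<close>

context enumerated_equiv
begin

definition prefix :: "nat \<Rightarrow> 'a \<Rightarrow> bool list" where
  "prefix m x = map (\<lambda>i. x \<in> \<beta> i) [0..<m]"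

definition colour_indices :: "nat \<times> (bool list \<times> nat list) list \<Rightarrow> 'a \<Rightarrow> nat list" where
  "colour_indices c x = (case map_of (snd c) (prefix (fst c) x) of None \<Rightarrow> [] | Some l \<Rightarrow> l)"

definition colour_set :: "nat \<times> (bool list \<times> nat list) list \<Rightarrow> 'a \<Rightarrow> 'a set" where
  "colour_set c x = \<gamma>_image (set (colour_indices c x)) x"

text \<open>
  A colour assigns to each point one of finitely many index lists, according to an initial
  segment of its sequence of memberships in the sets \<open>\<beta> i\<close>. The sets \<open>U\<close> with
  \<open>colour_set c x = U\<close> for all \<open>x \<in> U\<close> are pairwise disjoint, and there are only countably many
  colours.
\<close>

lemma prefix_meas [measurable]: "prefix m \<in> measurable M (count_space UNIV)"
  unfolding measurable_count_space_eq2_countable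
proof (intro conjI ballI)
  fix bs
  have "{x \<in> space M. length bs = m \<and> (\<forall>i<m. (x \<in> \<beta> i) = bs ! i)} \<in> sets M"
    by measurable
  moreover have "prefix m -` {bs} \<inter> space M = {x \<in> space M. length bs = m \<and> (\<forall>i<m. (x \<in> \<beta> i) = bs ! i)}"
  proof -
    have "prefix m x = bs \<longleftrightarrow> length bs = m \<and> (\<forall>i<m. (x \<in> \<beta> i) = bs ! i)" for x
    proof
      assume "length bs = m \<and> (\<forall>i<m. (x \<in> \<beta> i) = bs ! i)"
      then show "prefix m x = bs" by (intro nth_equalityI) (simp_all add: prefix_def)
    next
      assume "prefix m x = bs"
      then have "bs = map (\<lambda>i. x \<in> \<beta> i) [0..<m]" by (simp only: prefix_def)
      then show "length bs = m \<and> (\<forall>i<m. (x \<in> \<beta> i) = bs ! i)" by simp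
    qed
    then show ?thesis by (simp add: set_eq_iff conj_commute)
  qed
  ultimately show "prefix m -` {bs} \<inter> space M \<in> sets M" by simp
qed auto

lemma colour_indices_meas [measurable]: "colour_indices c \<in> measurable M (count_space UNIV)"
  unfolding colour_indices_def[abs_def] by measurable

text \<open>If \<open>m\<close> is so large that \<open>\<beta> 0\<close>, ...,
  \<open>\<beta> (m - 1)\<close> separate the points of \<open>U\<close>, every point has its own
  prefix, to which a list of indices leading from it to all of \<open>U\<close> can be
  assigned.\<close>

lemma colour_exists:
  assumes U: "U \<in> fin_sets M E"
  obtains c where "\<And>x. x \<in> U \<Longrightarrow> colour_set c x = U"
proof -
  have U': "U \<noteq> {}" "related_set M E U" "finite U" using U by (auto simp: fin_sets_def)
  have UE: "(x, y) \<in> E" if "x \<in> U" "y \<in> U" for x y using related_E[OF U'(2)] that .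
  have US: "x \<in> space M" if "x \<in> U" for x using UE[OF that that] E_space by blast
  have "\<forall>x y. \<exists>n. x \<in> U \<longrightarrow> y \<in> U \<longrightarrow> x \<noteq> y \<longrightarrow> (x \<in> \<beta> n) \<noteq> (y \<in> \<beta> n)"
    using \<beta>_sep US by metis
  then obtain N where N: "\<And>x y. x \<in> U \<Longrightarrow> y \<in> U \<Longrightarrow> x \<noteq> y \<Longrightarrow> (x \<in> \<beta> (N x y)) \<noteq> (y \<in> \<beta> (N x y))"
    by metis
  define m where "m = Suc (Max ((\<lambda>(x, y). N x y) ` (U \<times> U)))"
  have m: "N x y < m" if "x \<in> U" "y \<in> U" for x y
  proof -
    have "N x y \<in> (\<lambda>(x, y). N x y) ` (U \<times> U)" using that by (auto intro!: image_eqI[of _ _ "(x, y)"])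
    then have "N x y \<le> Max ((\<lambda>(x, y). N x y) ` (U \<times> U))" using U'(3) by (intro Max_ge) auto
    then show ?thesis by (simp add: m_def)
  qed
  have inj: "inj_on (prefix m) U"
  proof (rule inj_onI, rule ccontr)
    fix x y assume xy: "x \<in> U" "y \<in> U" "prefix m x = prefix m y" "x \<noteq> y"
    then have "prefix m x ! N x y = prefix m y ! N x y" by simp
    then show False using N[OF xy(1,2,4)] m[OF xy(1,2)] by (simp add: prefix_def)
  qed
  have "\<exists>l. \<gamma>_image (set l) x = U" if x: "x \<in> U" for x
  proof -
    have "\<exists>n. \<gamma> n x = y" if "y \<in> U" for y
      using UE[OF x that] by (rule E_obtain_\<gamma>) blast
    then obtain n where n: "\<And>y. y \<in> U \<Longrightarrow> \<gamma> (n y) x = y" by metis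
    obtain l where l: "set l = n ` U" using finite_list[of "n ` U"] U'(3) by blast
    have "\<gamma>_image (set l) x = (\<lambda>y. \<gamma> (n y) x) ` U" by (simp add: l \<gamma>_image_def image_image)
    also have "\<dots> = U" using n by simp
    finally show ?thesis by blast
  qed
  then obtain l where l: "\<And>x. x \<in> U \<Longrightarrow> \<gamma>_image (set (l x)) x = U" by metis
  obtain xs where xs: "set xs = U" "distinct xs" using finite_distinct_list[OF U'(3)] by blast
  define al where "al = map (\<lambda>x. (prefix m x, l x)) xs"
  have al: "map_of al (prefix m x) = Some (l x)" if "x \<in> U" for x
  proof (rule map_of_is_SomeI)
    show "distinct (map fst al)"
      using inj xs by (simp add: al_def comp_def distinct_map)
    show "(prefix m x, l x) \<in> set al" using that xs(1) by (auto simp: al_def)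
  qed
  show thesis
  proof (rule that[of "(m, al)"])
    fix x assume "x \<in> U"
    then show "colour_set (m, al) x = U" using al l by (simp add: colour_set_def colour_indices_def)
  qed
qed

lemma sum_\<gamma>_image:
  assumes "finite F"
  shows "sum f (\<gamma>_image F x) = (\<Sum>m\<in>F. if first_in F x m then f (\<gamma> m x) else 0)"
proof -
  have "sum f (\<gamma>_image F x) = (\<Sum>m\<in>{m. first_in F x m}. f (\<gamma> m x))"
    unfolding \<gamma>_image_first by (simp add: sum.reindex[OF inj_on_first_in])
  also have "{m. first_in F x m} = {m\<in>F. first_in F x m}" by (auto simp: first_in_def)
  also have "(\<Sum>m\<in>{m\<in>F. first_in F x m}. f (\<gamma> m x)) = (\<Sum>m\<in>F. if first_in F x m then f (\<gamma> m x) else 0)"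
    using assms by (rule sum.inter_filter)
  finally show ?thesis .
qed

text \<open>
  A tiling is encoded as the partial equivalence relation \<open>R\<close> whose classes are the tiles,
  together with a set \<open>B\<close> of roots. Along \<open>state_le\<close> tiles grow but keep their roots, hence
  two tiles are never merged.
\<close>

definition tiling_state :: "'a rel \<Rightarrow> 'a set \<Rightarrow> bool" where
  "tiling_state R B \<longleftrightarrow> R \<in> sets (M \<Otimes>\<^sub>M M) \<and> B \<in> sets M \<and> R \<subseteq> E \<and> sym R \<and> trans R \<and>
     (\<forall>x\<in>B. (x, x) \<in> R) \<and> (\<forall>x. (x, x) \<in> R \<longrightarrow> (\<exists>!r. (x, r) \<in> R \<and> r \<in> B))"

definition state_le :: "'a rel \<times> 'a set \<Rightarrow> 'a rel \<times> 'a set \<Rightarrow> bool" where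
  "state_le s s' \<longleftrightarrow> fst s \<subseteq> fst s' \<and> snd s \<subseteq> snd s' \<and>
     (\<forall>x. (x, x) \<in> fst s \<longrightarrow> fst s' `` {x} \<inter> snd s' = fst s `` {x} \<inter> snd s)"

lemma state_le_refl: "state_le s s"
  by (simp add: state_le_def)

lemma state_le_trans:
  assumes "state_le s t" "state_le t u"
  shows "state_le s u"
proof -
  have "fst u `` {x} \<inter> snd u = fst s `` {x} \<inter> snd s" if "(x, x) \<in> fst s" for x
  proof -
    have "(x, x) \<in> fst t" using assms(1) that by (auto simp: state_le_def)
    then show ?thesis using assms that unfolding state_le_def by metis
  qed
  then show ?thesis using assms unfolding state_le_def by blast
qed

lemma state_le_chain:
  assumes "\<And>n. state_le (s n) (s (Suc n))" "m \<le> n"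
  shows "state_le (s m) (s n)"
  using assms(2) by (induction n rule: dec_induct) (auto intro: state_le_refl state_le_trans assms(1))

definition join :: "(nat \<Rightarrow> 'a rel \<times> 'a set) \<Rightarrow> 'a rel \<times> 'a set" where
  "join s = (\<Union>n. fst (s n), \<Union>n. snd (s n))"

lemma state_le_join:
  assumes "\<And>n. state_le (s n) (s (Suc n))"
  shows "state_le (s m) (join s)"
proof -
  have le: "state_le (s i) (s j)" if "i \<le> j" for i j using state_le_chain[of s, OF assms that] .
  have "fst (join s) `` {x} \<inter> snd (join s) = fst (s m) `` {x} \<inter> snd (s m)" if x: "(x, x) \<in> fst (s m)" for x
  proof (intro subset_antisym subsetI)
    fix r assume "r \<in> fst (join s) `` {x} \<inter> snd (join s)"
    then obtain i j where ij: "(x, r) \<in> fst (s i)" "r \<in> snd (s j)" by (auto simp: join_def)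
    define n where "n = max m (max i j)"
    have "i \<le> n" "j \<le> n" by (auto simp: n_def)
    then have "fst (s i) \<subseteq> fst (s n)" "snd (s j) \<subseteq> snd (s n)"
      using le by (auto simp: state_le_def)
    then have "(x, r) \<in> fst (s n)" "r \<in> snd (s n)" using ij by blast+
    moreover have "state_le (s m) (s n)" by (intro le) (simp add: n_def)
    ultimately show "r \<in> fst (s m) `` {x} \<inter> snd (s m)" using x unfolding state_le_def by blast
  qed (auto simp: join_def)
  then show ?thesis unfolding state_le_def by (auto simp: join_def)
qed

lemma tiling_state_join:
  assumes st: "\<And>n. tiling_state (fst (s n)) (snd (s n))" and le: "\<And>n. state_le (s n) (s (Suc n))"
  shows "tiling_state (fst (join s)) (snd (join s))"
  unfolding tiling_state_def
proof (intro conjI ballI allI impI)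
  have le': "state_le (s i) (s j)" if "i \<le> j" for i j using state_le_chain[of s, OF le that] .
  have st': "fst (s n) \<in> sets (M \<Otimes>\<^sub>M M)" "snd (s n) \<in> sets M" "fst (s n) \<subseteq> E" for n
    using st by (simp_all add: tiling_state_def)
  show "fst (join s) \<in> sets (M \<Otimes>\<^sub>M M)" "snd (join s) \<in> sets M"
    using st' by (simp_all add: join_def)
  show "fst (join s) \<subseteq> E"
    using st'(3) unfolding join_def fst_conv by (rule UN_least)
  show "sym (fst (join s))"
  proof (rule symI)
    fix x y assume "(x, y) \<in> fst (join s)"
    then obtain n where n: "(x, y) \<in> fst (s n)" by (auto simp: join_def)
    have "sym (fst (s n))" using st by (simp add: tiling_state_def)
    then have "(y, x) \<in> fst (s n)" using n by (rule symD)
    then show "(y, x) \<in> fst (join s)" by (auto simp: join_def)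
  qed
  show "trans (fst (join s))"
  proof (rule transI)
    fix x y z assume "(x, y) \<in> fst (join s)" "(y, z) \<in> fst (join s)"
    then obtain i j where ij: "(x, y) \<in> fst (s i)" "(y, z) \<in> fst (s j)" by (auto simp: join_def)
    have "fst (s i) \<subseteq> fst (s (max i j))" "fst (s j) \<subseteq> fst (s (max i j))"
      using le'[of i "max i j"] le'[of j "max i j"] by (auto simp: state_le_def)
    then have "(x, y) \<in> fst (s (max i j))" "(y, z) \<in> fst (s (max i j))" using ij by blast+
    then have "(x, z) \<in> fst (s (max i j))" using st[of "max i j"] unfolding tiling_state_def by (meson transD)
    then show "(x, z) \<in> fst (join s)" by (auto simp: join_def)
  qed
  show "(x, x) \<in> fst (join s)" if "x \<in> snd (join s)" for x
    using that st by (auto simp: join_def tiling_state_def)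
  fix x assume "(x, x) \<in> fst (join s)"
  then obtain n where n: "(x, x) \<in> fst (s n)" by (auto simp: join_def)
  then have "\<exists>!r. r \<in> fst (s n) `` {x} \<inter> snd (s n)"
    using st[of n] unfolding tiling_state_def by simp
  moreover have "fst (join s) `` {x} \<inter> snd (join s) = fst (s n) `` {x} \<inter> snd (s n)"
    using state_le_join[of s n, OF le] n by (simp add: state_le_def)
  ultimately have "\<exists>!r. r \<in> fst (join s) `` {x} \<inter> snd (join s)" by simp
  then show "\<exists>!r. (x, r) \<in> fst (join s) \<and> r \<in> snd (join s)" by simp
qed

text \<open>Supplies the root of a new tile: its greatest element with respect to
  \<open>wless\<close>, which is a Borel choice.\<close>

lemma max_unique:
  assumes "U \<in> fin_sets M E"
  shows "\<exists>!x. x \<in> U \<and> (\<forall>y\<in>U. \<not> wless L E w x y)"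
proof -
  have U: "U \<noteq> {}" "related_set M E U" "finite U" using assms by (auto simp: fin_sets_def)
  have "\<exists>x\<in>U. \<forall>y\<in>U. wless L E w x y \<longrightarrow> \<not> wless L E w x y"
    using U(3,1)
  proof (induction rule: finite_ne_induct)
    case (insert a A)
    then obtain x where x: "x \<in> A" "\<forall>y\<in>A. \<not> wless L E w x y" by blast
    show ?case
    proof (cases "wless L E w x a")
      case True
      then have "\<not> wless L E w a y" if "y \<in> A" for y using x(2) that wless_trans by blast
      then show ?thesis using wless_irrefl by blast
    qed (use x in blast)
  qed (use wless_irrefl in blast)
  then obtain x where x: "x \<in> U" "\<forall>y\<in>U. \<not> wless L E w x y" by blast
  have "x' = x" if "x' \<in> U" "\<forall>y\<in>U. \<not> wless L E w x' y" for x'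
    using wless_total[OF related_E[OF U(2) x(1) that(1)]] x that by blast
  then show ?thesis using x by blast
qed

end

locale tiling_setup = enumerated_equiv +
  fixes S :: "'a set set"
  assumes S_fin: "S \<subseteq> fin_sets M E" and S_meas: "S \<in> sets (wfin_space M L E w)"
begin

lemma S_pred [measurable]: "Measurable.pred M (\<lambda>x. \<gamma>_image (set l) x \<in> S)"
proof (cases "l = []")
  case True
  then have "\<not> \<gamma>_image (set l) x \<in> S" for x using S_fin by (auto simp: \<gamma>_image_def fin_sets_def)
  then show ?thesis by simp
next
  case False
  then have "\<gamma>_image (set l) \<in> measurable M (wfin_space M L E w)" by (intro \<gamma>_image_meas) auto
  then have "\<gamma>_image (set l) -` S \<inter> space M \<in> sets M" using S_meas by (rule measurable_sets)
  moreover have "\<gamma>_image (set l) -` S \<inter> space M = {x \<in> space M. \<gamma>_image (set l) x \<in> S}" by auto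
  ultimately show ?thesis by (simp add: pred_def)
qed

text \<open>
  The sum is nonnegative iff the weight of the part of \<open>U\<close> outside the tiling is at least
  \<open>\<epsilon>\<close> times the weight of the tile inside \<open>U\<close>.
\<close>

definition candidate :: "'a rel \<Rightarrow> nat \<times> (bool list \<times> nat list) list \<Rightarrow> real \<Rightarrow> 'a set \<Rightarrow> bool" where
  "candidate R c \<epsilon> U \<longleftrightarrow> U \<in> S \<and> (\<forall>x\<in>U. colour_set c x = U) \<and> (\<forall>x\<in>U. R `` {x} \<subseteq> U) \<and>
     (\<forall>x\<in>U. \<forall>y\<in>U. (x, x) \<in> R \<longrightarrow> (y, y) \<in> R \<longrightarrow> (x, y) \<in> R) \<and>
     (\<forall>x\<in>U. 0 \<le> (\<Sum>y\<in>U. (if (y, y) \<in> R then - \<epsilon> else 1) * wt x y))"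

text \<open>All candidates of one colour are added at once, which causes no conflict as they are
  pairwise disjoint and respect the old tiles. A new root is placed only in candidates that do not
  meet the tiling; the others contain exactly one old tile and keep its root.\<close>

definition step :: "nat \<times> (bool list \<times> nat list) list \<Rightarrow> real \<Rightarrow> 'a rel \<times> 'a set \<Rightarrow> 'a rel \<times> 'a set" where
  "step c \<epsilon> s = ({(x, y). (\<exists>U. candidate (fst s) c \<epsilon> U \<and> x \<in> U \<and> y \<in> U) \<or>
      (x, y) \<in> fst s \<and> \<not> (\<exists>U. candidate (fst s) c \<epsilon> U \<and> x \<in> U)},
    snd s \<union> {x. \<exists>U. candidate (fst s) c \<epsilon> U \<and> x \<in> U \<and> (\<forall>y\<in>U. (y, y) \<notin> fst s) \<and>
      (\<forall>y\<in>U. \<not> wless L E w x y)})"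

lemma candidate_eq: "candidate R c \<epsilon> U \<Longrightarrow> x \<in> U \<Longrightarrow> U = colour_set c x"
  by (simp add: candidate_def)

lemma candidate_fin: "candidate R c \<epsilon> U \<Longrightarrow> U \<in> fin_sets M E"
  using S_fin by (auto simp: candidate_def)

lemma candidate_unique: "candidate R c \<epsilon> U \<Longrightarrow> candidate R c \<epsilon> V \<Longrightarrow> x \<in> U \<Longrightarrow> x \<in> V \<Longrightarrow> U = V"
  using candidate_eq by blast

lemma candidate_space: "candidate R c \<epsilon> U \<Longrightarrow> U \<subseteq> space M"
  using candidate_fin[of R c \<epsilon> U] E_space unfolding fin_sets_def related_set_def by blast

lemma mem_\<gamma>_image: "y \<in> \<gamma>_image F x \<longleftrightarrow> (\<exists>n\<in>F. \<gamma> n x = y)"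
  by (auto simp: \<gamma>_image_def)

lemma ball_\<gamma>_image: "(\<forall>y\<in>\<gamma>_image F x. P y) \<longleftrightarrow> (\<forall>n\<in>F. P (\<gamma> n x))"
  by (auto simp: \<gamma>_image_def)

lemma \<gamma>_image_eq:
  "\<gamma>_image F x = \<gamma>_image G y \<longleftrightarrow> (\<forall>n\<in>F. \<exists>m\<in>G. \<gamma> m y = \<gamma> n x) \<and> (\<forall>m\<in>G. \<exists>n\<in>F. \<gamma> n x = \<gamma> m y)"
  by (simp add: set_eq_subset subset_eq ball_\<gamma>_image mem_\<gamma>_image)

text \<open>For a fixed list \<open>l\<close> of indices every quantifier over the set
  \<open>\<gamma>_image (set l) x\<close> is one over \<open>l\<close>, which turns the definition
  into the measurable predicate \<open>Q l\<close>. The list prescribed by the colour takes only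
  countably many values.\<close>

lemma candidate_meas [measurable]:
  assumes R [measurable]: "R \<in> sets (M \<Otimes>\<^sub>M M)" and "R \<subseteq> E"
  shows "Measurable.pred M (\<lambda>x. candidate R c \<epsilon> (colour_set c x) \<and> x \<in> colour_set c x)"
proof -
  have Sub: "R `` {\<gamma> i x} \<subseteq> \<gamma>_image (set l) x \<longleftrightarrow>
      (\<forall>n. (\<gamma> i x, \<gamma> n (\<gamma> i x)) \<in> R \<longrightarrow> (\<exists>m\<in>set l. \<gamma> m x = \<gamma> n (\<gamma> i x)))" for i x l
  proof
    assume H: "\<forall>n. (\<gamma> i x, \<gamma> n (\<gamma> i x)) \<in> R \<longrightarrow> (\<exists>m\<in>set l. \<gamma> m x = \<gamma> n (\<gamma> i x))"
    show "R `` {\<gamma> i x} \<subseteq> \<gamma>_image (set l) x"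
    proof
      fix y assume "y \<in> R `` {\<gamma> i x}"
      then have y: "(\<gamma> i x, y) \<in> R" by blast
      then obtain n where "y = \<gamma> n (\<gamma> i x)" using assms(2) E_obtain_\<gamma>[of "\<gamma> i x" y] by blast
      then show "y \<in> \<gamma>_image (set l) x" using H y unfolding mem_\<gamma>_image by blast
    qed
  qed (auto simp: mem_\<gamma>_image)
  define Q where "Q l x \<longleftrightarrow> \<gamma>_image (set l) x \<in> S \<and>
    (\<forall>i\<in>set l. \<exists>l'. colour_indices c (\<gamma> i x) = l' \<and>
      (\<forall>n\<in>set l'. \<exists>m\<in>set l. \<gamma> m x = \<gamma> n (\<gamma> i x)) \<and> (\<forall>m\<in>set l. \<exists>n\<in>set l'. \<gamma> n (\<gamma> i x) = \<gamma> m x)) \<and>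
    (\<forall>i\<in>set l. \<forall>n. (\<gamma> i x, \<gamma> n (\<gamma> i x)) \<in> R \<longrightarrow> (\<exists>m\<in>set l. \<gamma> m x = \<gamma> n (\<gamma> i x))) \<and>
    (\<forall>i\<in>set l. \<forall>j\<in>set l. (\<gamma> i x, \<gamma> i x) \<in> R \<longrightarrow> (\<gamma> j x, \<gamma> j x) \<in> R \<longrightarrow> (\<gamma> i x, \<gamma> j x) \<in> R) \<and>
    (\<forall>i\<in>set l. 0 \<le> (\<Sum>m\<in>set l. if first_in (set l) x m
       then (if (\<gamma> m x, \<gamma> m x) \<in> R then - \<epsilon> else 1) * wt (\<gamma> i x) (\<gamma> m x) else 0)) \<and>
    (\<exists>m\<in>set l. \<gamma> m x = x)" for l x
  have Q: "candidate R c \<epsilon> (\<gamma>_image (set l) x) \<and> x \<in> \<gamma>_image (set l) x \<longleftrightarrow> Q l x" for l x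
    unfolding candidate_def Q_def ball_\<gamma>_image mem_\<gamma>_image Sub colour_set_def \<gamma>_image_eq
      sum_\<gamma>_image[OF finite_set]
    by (simp only: conj_assoc simp_thms)
  have "Measurable.pred M (Q l)" for l
    unfolding Q_def by measurable
  note [measurable] = this
  have "Measurable.pred M (\<lambda>x. \<exists>l. colour_indices c x = l \<and> Q l x)" by measurable
  then show ?thesis unfolding Q[symmetric] colour_set_def by simp
qed

end

context tiling_setup
begin

text \<open>The only possible candidate through \<open>x\<close> is \<open>colour_set c x\<close>.
  So the quantifier over sets disappears, which is how the result of a step is seen to be
  Borel.\<close>

lemma candidate_iff:
  "(\<exists>U. candidate R c \<epsilon> U \<and> x \<in> U \<and> P U) \<longleftrightarrow>
    (candidate R c \<epsilon> (colour_set c x) \<and> x \<in> colour_set c x) \<and> P (colour_set c x)"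
  using candidate_eq by metis

lemma step_Image_new:
  assumes "candidate (fst s) c \<epsilon> U" "x \<in> U"
  shows "fst (step c \<epsilon> s) `` {x} = U"
proof (intro subset_antisym subsetI)
  fix y assume "y \<in> fst (step c \<epsilon> s) `` {x}"
  then obtain V where "candidate (fst s) c \<epsilon> V" "x \<in> V" "y \<in> V"
    using assms unfolding step_def by auto
  then show "y \<in> U" using candidate_unique assms by metis
qed (use assms in \<open>auto simp: step_def\<close>)

lemma step_Image_old:
  assumes "\<nexists>U. candidate (fst s) c \<epsilon> U \<and> x \<in> U"
  shows "fst (step c \<epsilon> s) `` {x} = fst s `` {x}"
  using assms by (auto simp: step_def)

lemma candidate_tile:
  assumes s: "tiling_state R B" and U: "candidate R c \<epsilon> U" "x \<in> U" "(x, x) \<in> R"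
  shows "R `` {x} = {y\<in>U. (y, y) \<in> R}"
proof (intro subset_antisym subsetI)
  fix y assume "y \<in> R `` {x}"
  then have y: "(x, y) \<in> R" by blast
  then have "(y, y) \<in> R" using s unfolding tiling_state_def by (meson symD transD)
  then show "y \<in> {y\<in>U. (y, y) \<in> R}" using y U by (auto simp: candidate_def)
qed (use U in \<open>auto simp: candidate_def\<close>)

lemma tiling_dom: "tiling_state R B \<Longrightarrow> (x, y) \<in> R \<Longrightarrow> (x, x) \<in> R \<and> (y, y) \<in> R"
  unfolding tiling_state_def by (meson symD transD)

text \<open>An old tile met by a candidate is contained in it, so tiles only grow. A candidate
  containing an old tile receives no new root, because new roots require that it be disjoint from
  the tiling.\<close>

lemma step_state_le:
  assumes s: "tiling_state (fst s) (snd s)"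
  shows "state_le s (step c \<epsilon> s)"
  unfolding state_le_def
proof (intro conjI allI impI)
  let ?C = "candidate (fst s) c \<epsilon>"
  show "fst s \<subseteq> fst (step c \<epsilon> s)"
  proof
    fix p assume p: "p \<in> fst s"
    obtain x y where xy: "p = (x, y)" by fastforce
    have "y \<in> U" if "?C U" "x \<in> U" for U using that p xy by (auto simp: candidate_def)
    then show "p \<in> fst (step c \<epsilon> s)" using p xy unfolding step_def by auto
  qed
  show "snd s \<subseteq> snd (step c \<epsilon> s)" by (auto simp: step_def)
  fix x assume x: "(x, x) \<in> fst s"
  have new: "r \<in> snd s" if "r \<in> snd (step c \<epsilon> s)" "(r, r) \<in> fst s" for r
    using that by (auto simp: step_def)
  show "fst (step c \<epsilon> s) `` {x} \<inter> snd (step c \<epsilon> s) = fst s `` {x} \<inter> snd s"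
  proof (cases "\<exists>U. ?C U \<and> x \<in> U")
    case False
    have "fst (step c \<epsilon> s) `` {x} = fst s `` {x}" by (rule step_Image_old[OF False])
    then show ?thesis using new tiling_dom[OF s] by (auto simp: step_def)
  next
    case True
    then obtain U where U: "?C U" "x \<in> U" by blast
    have I: "fst (step c \<epsilon> s) `` {x} = U" by (rule step_Image_new[OF U])
    have T: "fst s `` {x} = {y\<in>U. (y, y) \<in> fst s}" by (rule candidate_tile[OF s U x])
    have "r \<in> snd s" if r: "r \<in> U" "r \<in> snd (step c \<epsilon> s)" for r
    proof (rule ccontr)
      assume "r \<notin> snd s"
      then obtain V where V: "?C V" "r \<in> V" "\<forall>y\<in>V. (y, y) \<notin> fst s" using r(2) by (auto simp: step_def)
      then have "V = U" using candidate_unique U(1) r(1) by metis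
      then show False using V(3) U(2) x by blast
    qed
    moreover have "(r, r) \<in> fst s" if "r \<in> snd s" for r using s that by (simp add: tiling_state_def)
    ultimately show ?thesis unfolding I T by (auto simp: step_def)
  qed
qed

lemma step_tiling_state:
  assumes s: "tiling_state (fst s) (snd s)"
  shows "tiling_state (fst (step c \<epsilon> s)) (snd (step c \<epsilon> s))"
proof -
  let ?C = "candidate (fst s) c \<epsilon>"
  let ?R = "fst (step c \<epsilon> s)" and ?B = "snd (step c \<epsilon> s)"
  have R[measurable]: "fst s \<in> sets (M \<Otimes>\<^sub>M M)" and B[measurable]: "snd s \<in> sets M" and RE: "fst s \<subseteq> E"
    and sym: "sym (fst s)" and trans: "trans (fst s)"
    using s by (auto simp: tiling_state_def)
  \<comment> \<open>\<open>K x\<close> expresses that \<open>x\<close> is covered by a candidate.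
    Since candidates are invariant under the old relation, \<open>K\<close> is constant on old
    tiles, and where it fails the new relation is the old one.\<close>
  define K where "K x \<longleftrightarrow> ?C (colour_set c x) \<and> x \<in> colour_set c x" for x
  have K_meas[measurable]: "Measurable.pred M K"
    unfolding K_def[abs_def] by (rule candidate_meas[OF R RE])
  have K: "(\<exists>U. ?C U \<and> x \<in> U \<and> P U) \<longleftrightarrow> K x \<and> P (colour_set c x)" for x P
    unfolding K_def by (rule candidate_iff)
  have K1: "(\<exists>U. ?C U \<and> x \<in> U) \<longleftrightarrow> K x" for x using K[of x "\<lambda>_. True"] by simp
  have K_space: "x \<in> space M" if "K x" for x
    using that candidate_space[of "fst s" c \<epsilon> "colour_set c x"] by (auto simp: K_def)
  have colour_space: "colour_set c x \<subseteq> space M" if "K x" for x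
    using that candidate_space[of "fst s" c \<epsilon> "colour_set c x"] by (simp add: K_def)
  let ?X = "{p \<in> space (M \<Otimes>\<^sub>M M). K (fst p) \<and> (\<exists>l. colour_indices c (fst p) = l \<and> (\<exists>n\<in>set l. \<gamma> n (fst p) = snd p))}
      \<union> {p \<in> space (M \<Otimes>\<^sub>M M). p \<in> fst s \<and> \<not> K (fst p)}"
  have "?R = ?X"
  proof (intro set_eqI iffI)
    fix p assume "p \<in> ?R"
    then consider "K (fst p)" "snd p \<in> colour_set c (fst p)" | "p \<in> fst s" "\<not> K (fst p)"
      unfolding step_def fst_conv K1 K[of _ "\<lambda>U. _ \<in> U"] by auto
    then show "p \<in> ?X"
    proof cases
      case 1
      moreover have "p \<in> space (M \<Otimes>\<^sub>M M)"
        using 1 K_space colour_space by (auto simp: space_pair_measure mem_Times_iff)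
      ultimately show ?thesis by (auto simp: colour_set_def mem_\<gamma>_image)
    next
      case 2
      then show ?thesis using sets.sets_into_space[OF R] by auto
    qed
  next
    fix p assume "p \<in> ?X"
    then show "p \<in> ?R"
      unfolding step_def fst_conv K1 K[of _ "\<lambda>U. _ \<in> U"]
      by (auto simp: colour_set_def mem_\<gamma>_image)
  qed
  also have "\<dots> \<in> sets (M \<Otimes>\<^sub>M M)" by measurable
  finally have R': "?R \<in> sets (M \<Otimes>\<^sub>M M)" .
  have "?B = snd s \<union> {x \<in> space M. K x \<and> (\<exists>l. colour_indices c x = l \<and>
      (\<forall>n\<in>set l. (\<gamma> n x, \<gamma> n x) \<notin> fst s) \<and> (\<forall>n\<in>set l. \<not> wless L E w x (\<gamma> n x)))}"
    unfolding step_def snd_conv K[of _ "\<lambda>U. (\<forall>y\<in>U. (y, y) \<notin> fst s) \<and> (\<forall>y\<in>U. \<not> wless L E w _ y)"]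
    unfolding colour_set_def ball_\<gamma>_image using K_space by auto
  also have "\<dots> \<in> sets M" by measurable
  finally have B': "?B \<in> sets M" .
  have CE: "(x, y) \<in> E" if "?C U" "x \<in> U" "y \<in> U" for U x y
    using candidate_fin[OF that(1)] related_E that(2,3) by (auto simp: fin_sets_def)
  have Ksym: "K y" if "(x, y) \<in> fst s" "K x" for x y
  proof -
    obtain U where U: "?C U" "x \<in> U" using K1 \<open>K x\<close> by blast
    then have "y \<in> U" using that(1) by (auto simp: candidate_def)
    then show ?thesis using K1 U(1) by blast
  qed
  have R_K: "(x, y) \<in> ?R \<longleftrightarrow> (if K x then \<exists>U. ?C U \<and> x \<in> U \<and> y \<in> U else (x, y) \<in> fst s)" for x y
    using K1[of x] unfolding step_def by auto
  have R'E: "?R \<subseteq> E" using RE CE by (auto simp: step_def)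
  have R'sym: "sym ?R"
  proof (rule symI)
    fix x y assume xy: "(x, y) \<in> ?R"
    show "(y, x) \<in> ?R"
    proof (cases "K x")
      case True
      then obtain U where "?C U" "x \<in> U" "y \<in> U" using xy R_K by auto
      then show ?thesis unfolding step_def by auto
    next
      case False
      then have "(y, x) \<in> fst s" using xy symD[OF sym] R_K by metis
      moreover then have "\<not> K y" using Ksym False by blast
      ultimately show ?thesis by (simp add: R_K)
    qed
  qed
  have R'trans: "trans ?R"
  proof (rule transI)
    fix x y z assume xyz: "(x, y) \<in> ?R" "(y, z) \<in> ?R"
    show "(x, z) \<in> ?R"
    proof (cases "K x")
      case True
      then obtain U where U: "?C U" "x \<in> U" "y \<in> U" using xyz(1) R_K by auto
      then have "z \<in> U" using step_Image_new[OF U(1,3)] xyz(2) by blast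
      then show ?thesis using U unfolding step_def by auto
    next
      case False
      then have xy: "(x, y) \<in> fst s" using xyz(1) R_K by simp
      then have "\<not> K y" using Ksym[of y x] symD[OF sym] False by blast
      then have "(y, z) \<in> fst s" using xyz(2) R_K by simp
      then show ?thesis using xy transD[OF trans] False R_K by metis
    qed
  qed
  have le: "state_le s (step c \<epsilon> s)" by (rule step_state_le[OF s])
  have root_dom: "(x, x) \<in> ?R" if "x \<in> ?B" for x
  proof (cases "x \<in> snd s")
    case True
    then have "(x, x) \<in> fst s" using s by (simp add: tiling_state_def)
    then show ?thesis using le by (auto simp: state_le_def)
  qed (use that in \<open>auto simp: step_def\<close>)
  have old: "\<exists>!r. r \<in> ?R `` {x} \<inter> ?B" if x: "(x, x) \<in> fst s" for x
  proof -
    have "\<exists>!r. r \<in> fst s `` {x} \<inter> snd s" using s x by (simp add: tiling_state_def)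
    moreover have "?R `` {x} \<inter> ?B = fst s `` {x} \<inter> snd s" using le x by (simp add: state_le_def)
    ultimately show ?thesis by simp
  qed
  have root: "\<exists>!r. r \<in> ?R `` {x} \<inter> ?B" if x: "(x, x) \<in> ?R" for x
  proof (cases "\<exists>U. ?C U \<and> x \<in> U")
    case False
    then have "(x, x) \<in> fst s" using x K1 R_K by auto
    then show ?thesis by (rule old)
  next
    case True
    then obtain U where U: "?C U" "x \<in> U" by blast
    show ?thesis
    proof (cases "\<exists>y\<in>U. (y, y) \<in> fst s")
      case True
      then obtain y where y: "y \<in> U" "(y, y) \<in> fst s" by blast
      then show ?thesis using old[OF y(2)] step_Image_new[OF U] step_Image_new[OF U(1) y(1)] by simp
    next
      case False
      have "U \<inter> ?B = {r. r \<in> U \<and> (\<forall>y\<in>U. \<not> wless L E w r y)}"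
      proof (intro set_eqI iffI)
        fix r assume r: "r \<in> U \<inter> ?B"
        then have "r \<notin> snd s" using False s by (auto simp: tiling_state_def)
        then obtain V where V: "?C V" "r \<in> V" "\<forall>y\<in>V. \<not> wless L E w r y"
          using r by (auto simp: step_def)
        then have "V = U" using candidate_unique U(1) r by blast
        then show "r \<in> {r. r \<in> U \<and> (\<forall>y\<in>U. \<not> wless L E w r y)}" using V by blast
      next
        fix r assume "r \<in> {r. r \<in> U \<and> (\<forall>y\<in>U. \<not> wless L E w r y)}"
        then show "r \<in> U \<inter> ?B" using U(1) False unfolding step_def by auto
      qed
      then show ?thesis using max_unique[OF candidate_fin[OF U(1)]] step_Image_new[OF U] by simp
    qed
  qed
  show ?thesis
    unfolding tiling_state_def using R' B' R'E R'sym R'trans root_dom root by simp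
qed

section \<open>Stages, phases and the whole run\<close>

definition colour_seq :: "nat \<Rightarrow> nat \<times> (bool list \<times> nat list) list" where
  "colour_seq n = from_nat (fst (prod_decode n))"

text \<open>The second component of the decoded pair serves only to repeat each colour infinitely
  often, so that a set which becomes eligible late still gets its turn.\<close>

lemma colour_seq_recurrent: "\<exists>n\<ge>N. colour_seq n = c"
proof (intro exI conjI)
  show "N \<le> prod_encode (to_nat c, N)" by (rule le_prod_encode_2)
  show "colour_seq (prod_encode (to_nat c, N)) = c" by (simp add: colour_seq_def)
qed

primrec stage :: "real \<Rightarrow> 'a rel \<times> 'a set \<Rightarrow> nat \<Rightarrow> 'a rel \<times> 'a set" where
  "stage \<epsilon> s 0 = s"
| "stage \<epsilon> s (Suc n) = step (colour_seq n) \<epsilon> (stage \<epsilon> s n)"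

definition phase :: "real \<Rightarrow> 'a rel \<times> 'a set \<Rightarrow> 'a rel \<times> 'a set" where
  "phase \<epsilon> s = join (stage \<epsilon> s)"

primrec run :: "'a rel \<times> 'a set \<Rightarrow> nat \<Rightarrow> 'a rel \<times> 'a set" where
  "run s 0 = s"
| "run s (Suc k) = phase (inverse (real (Suc k))) (run s k)"

lemma stage_state: "tiling_state (fst s) (snd s) \<Longrightarrow> tiling_state (fst (stage \<epsilon> s n)) (snd (stage \<epsilon> s n))"
  by (induction n) (auto intro: step_tiling_state)

lemma stage_le: "tiling_state (fst s) (snd s) \<Longrightarrow> state_le (stage \<epsilon> s n) (stage \<epsilon> s (Suc n))"
  using step_state_le[OF stage_state] by simp

lemma stage_mono:
  "tiling_state (fst s) (snd s) \<Longrightarrow> m \<le> n \<Longrightarrow> state_le (stage \<epsilon> s m) (stage \<epsilon> s n)"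
  by (rule state_le_chain[of "stage \<epsilon> s"]) (rule stage_le)

lemma stage_le_phase: "tiling_state (fst s) (snd s) \<Longrightarrow> state_le (stage \<epsilon> s n) (phase \<epsilon> s)"
  unfolding phase_def by (rule state_le_join) (rule stage_le)

lemma phase_le: "tiling_state (fst s) (snd s) \<Longrightarrow> state_le s (phase \<epsilon> s)"
  using stage_le_phase[of s \<epsilon> 0] by simp

lemma phase_state: "tiling_state (fst s) (snd s) \<Longrightarrow> tiling_state (fst (phase \<epsilon> s)) (snd (phase \<epsilon> s))"
  unfolding phase_def by (rule tiling_state_join) (rule stage_state stage_le, assumption)+

lemma run_state: "tiling_state (fst s) (snd s) \<Longrightarrow> tiling_state (fst (run s k)) (snd (run s k))"
  by (induction k) (auto intro: phase_state)

lemma run_le: "tiling_state (fst s) (snd s) \<Longrightarrow> state_le (run s k) (run s (Suc k))"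
  using phase_le[OF run_state] by simp

lemma run_mono: "tiling_state (fst s) (snd s) \<Longrightarrow> j \<le> k \<Longrightarrow> state_le (run s j) (run s k)"
  by (rule state_le_chain[of "run s"]) (rule run_le)

lemma sum_wt_le_weight:
  assumes "finite A" "A \<subseteq> C" "C \<subseteq> E `` {x}" "weight w x C < \<infinity>"
  shows "(\<Sum>y\<in>A. wt x y) \<le> enn2real (weight w x C)"
proof -
  have nn: "0 \<le> wt x y" for y using w_pos[of x y] by (auto simp: wt_def)
  have "ennreal (\<Sum>y\<in>A. wt x y) = (\<Sum>y\<in>A. ennreal (wt x y))"
    using nn by (intro sum_ennreal[symmetric]) auto
  also have "\<dots> = (\<Sum>y\<in>A. ennreal (w x y))"
    using assms(2,3) by (intro sum.cong) (auto simp: wt_def)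
  also have "\<dots> = infsum (\<lambda>y. ennreal (w x y)) A" using assms(1) by simp
  also have "\<dots> \<le> weight w x C"
    unfolding weight_def using assms(2) by (intro infsum_mono_neutral) auto
  finally show ?thesis
    using assms(4) nn by (metis enn2real_ennreal enn2real_mono infinity_ennreal_def sum_nonneg)
qed

text \<open>The tile of \<open>x\<close> is either unchanged since the start of the phase or equal
  to the last candidate that covered \<open>x\<close>. The assumption is restricted to this one tile
  because other tiles may have become infinite in earlier phases.\<close>

lemma stage_mem_S:
  assumes s: "tiling_state (fst s) (snd s)" and "(x, x) \<in> fst s \<Longrightarrow> fst s `` {x} \<in> S"
    and "(x, x) \<in> fst (stage \<epsilon> s n)"
  shows "fst (stage \<epsilon> s n) `` {x} \<in> S"
  using assms(3)
proof (induction n)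
  case 0
  then show ?case using assms(2) by simp
next
  case (Suc n)
  show ?case
  proof (cases "\<exists>U. candidate (fst (stage \<epsilon> s n)) (colour_seq n) \<epsilon> U \<and> x \<in> U")
    case True
    then obtain U where U: "candidate (fst (stage \<epsilon> s n)) (colour_seq n) \<epsilon> U" "x \<in> U" by blast
    then have "U \<in> S" by (simp add: candidate_def)
    then show ?thesis using step_Image_new[OF U] by simp
  next
    case False
    then have eq: "fst (stage \<epsilon> s (Suc n)) `` {x} = fst (stage \<epsilon> s n) `` {x}"
      using step_Image_old by simp
    then have "(x, x) \<in> fst (stage \<epsilon> s n)" using Suc.prems by blast
    then show ?thesis using Suc.IH eq by simp
  qed
qed

text \<open>
  Each proper growth step multiplies the weight of a tile by at least \<open>1 + \<epsilon>\<close>, so a tile of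
  finite final weight grows only finitely often during a phase.
\<close>

lemma phase_stabilises:
  assumes s: "tiling_state (fst s) (snd s)" and \<epsilon>: "\<epsilon> > 0"
    and S0: "(x, x) \<in> fst s \<Longrightarrow> fst s `` {x} \<in> S"
    and x: "(x, x) \<in> fst (phase \<epsilon> s)" and fin: "weight w x (fst (phase \<epsilon> s) `` {x}) < \<infinity>"
  obtains N where "\<And>n. n \<ge> N \<Longrightarrow> fst (stage \<epsilon> s n) `` {x} = fst (phase \<epsilon> s) `` {x}"
    "fst (phase \<epsilon> s) `` {x} \<in> S"
proof -
  define A where "A n = fst (stage \<epsilon> s n) `` {x}" for n
  define a where "a n = (\<Sum>y\<in>A n. wt x y)" for n
  have nn: "0 \<le> wt x y" for y using w_pos[of x y] by (auto simp: wt_def)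
  obtain N0 where N0: "(x, x) \<in> fst (stage \<epsilon> s N0)" using x by (auto simp: phase_def join_def)
  have mono: "fst (stage \<epsilon> s m) \<subseteq> fst (stage \<epsilon> s n)" if "m \<le> n" for m n
    using stage_mono[OF s that, of \<epsilon>] by (simp add: state_le_def)
  have dom: "(x, x) \<in> fst (stage \<epsilon> s n)" if "n \<ge> N0" for n
    using mono[OF that] N0 by blast
  have A_mono: "A m \<subseteq> A n" if "m \<le> n" for m n
    using mono[OF that] by (auto simp: A_def)
  have A_S: "A n \<in> S" if "n \<ge> N0" for n
    unfolding A_def using stage_mem_S[OF s S0 dom[OF that]] .
  then have A_fin: "finite (A n)" if "n \<ge> N0" for n
    using that S_fin by (auto simp: fin_sets_def)
  have phaseE: "fst (phase \<epsilon> s) `` {x} \<subseteq> E `` {x}"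
    using phase_state[OF s, of \<epsilon>] by (auto simp: tiling_state_def)
  have A_phase: "A n \<subseteq> fst (phase \<epsilon> s) `` {x}" for n
    using stage_le_phase[OF s, of \<epsilon> n] by (auto simp: A_def state_le_def)
  have xs: "x \<in> space M" using x phaseE E_space by blast
  have a_bound: "a n \<le> enn2real (weight w x (fst (phase \<epsilon> s) `` {x}))" if "n \<ge> N0" for n
    unfolding a_def by (rule sum_wt_le_weight[OF A_fin[OF that] A_phase phaseE fin])
  have a_mono: "a m \<le> a n" if "N0 \<le> m" "m \<le> n" for m n
    unfolding a_def using A_fin[of n] A_mono[OF that(2)] nn that by (intro sum_mono2) auto
  \<comment> \<open>Seen from \<open>x\<close> the tile weighs at least \<open>w x x = 1\<close>, so
    that growth by the factor \<open>1 + \<epsilon>\<close> adds at least the constant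
    \<open>\<epsilon>\<close>.\<close>
  have a_ge: "1 \<le> a n" if "n \<ge> N0" for n
  proof -
    have "wt x x \<le> a n"
      unfolding a_def using dom[OF that] A_fin[OF that] nn by (intro member_le_sum) (auto simp: A_def)
    then show ?thesis using w_refl[OF xs] E_refl[OF xs] by (simp add: wt_def)
  qed
  have grow: "a n + \<epsilon> \<le> a (Suc n)" if n: "n \<ge> N0" and ne: "A (Suc n) \<noteq> A n" for n
  proof -
    obtain U where U: "candidate (fst (stage \<epsilon> s n)) (colour_seq n) \<epsilon> U" "x \<in> U"
      using step_Image_old[of "stage \<epsilon> s n" "colour_seq n" \<epsilon> x] ne by (auto simp: A_def)
    have AU: "A (Suc n) = U" unfolding A_def using step_Image_new[OF U] by simp
    have An: "A n = {y\<in>U. (y, y) \<in> fst (stage \<epsilon> s n)}"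
      unfolding A_def by (rule candidate_tile[OF stage_state[OF s] U dom[OF n]])
    have U_fin: "finite U" using A_fin[of "Suc n"] n AU by simp
    have "0 \<le> (\<Sum>y\<in>U. (if (y, y) \<in> fst (stage \<epsilon> s n) then - \<epsilon> else 1) * wt x y)"
      using U by (simp add: candidate_def)
    also have "\<dots> = (\<Sum>y\<in>A n. (if (y, y) \<in> fst (stage \<epsilon> s n) then - \<epsilon> else 1) * wt x y) +
        (\<Sum>y\<in>U - A n. (if (y, y) \<in> fst (stage \<epsilon> s n) then - \<epsilon> else 1) * wt x y)"
      using U_fin An by (subst sum.subset_diff[of "A n" U]) auto
    also have "(\<Sum>y\<in>A n. (if (y, y) \<in> fst (stage \<epsilon> s n) then - \<epsilon> else 1) * wt x y) = - \<epsilon> * a n"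
      unfolding a_def sum_distrib_left using An by (intro sum.cong) auto
    also have "(\<Sum>y\<in>U - A n. (if (y, y) \<in> fst (stage \<epsilon> s n) then - \<epsilon> else 1) * wt x y) = (\<Sum>y\<in>U - A n. wt x y)"
      using An by (intro sum.cong) auto
    also have "\<dots> = a (Suc n) - a n"
      unfolding a_def AU using An U_fin by (subst sum_diff) auto
    finally have "\<epsilon> * a n \<le> a (Suc n) - a n" by simp
    moreover have "\<epsilon> * 1 \<le> \<epsilon> * a n" using a_ge[OF n] \<epsilon> by (intro mult_left_mono) auto
    ultimately show ?thesis by simp
  qed
  have "incseq (\<lambda>n. a (n + N0))" using a_mono by (intro incseq_SucI) simp
  moreover have "\<forall>n. a (n + N0) \<le> enn2real (weight w x (fst (phase \<epsilon> s) `` {x}))"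
    using a_bound by simp
  ultimately obtain l where l: "(\<lambda>n. a (n + N0)) \<longlonglongrightarrow> l" by (metis incseq_convergent)
  have "(\<lambda>n. a (Suc n + N0) - a (n + N0)) \<longlonglongrightarrow> l - l"
    using l LIMSEQ_Suc[OF l] by (intro tendsto_diff)
  then have "\<forall>\<^sub>F n in sequentially. a (Suc n + N0) - a (n + N0) < \<epsilon>"
    using \<epsilon> by (intro order_tendstoD(2)) auto
  then obtain N1 where N1: "\<And>n. n \<ge> N1 \<Longrightarrow> a (Suc n + N0) - a (n + N0) < \<epsilon>"
    by (auto simp: eventually_sequentially)
  define N where "N = N1 + N0"
  have same: "A (Suc n) = A n" if "n \<ge> N" for n
  proof (rule ccontr)
    assume ne: "A (Suc n) \<noteq> A n"
    have m: "n = (n - N0) + N0" "n - N0 \<ge> N1" using \<open>n \<ge> N\<close> by (auto simp: N_def)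
    have "a n + \<epsilon> \<le> a (Suc n)" using ne m by (intro grow) auto
    then show False using N1[OF m(2)] m(1) by simp
  qed
  have A_N: "A n = A N" if "n \<ge> N" for n
    using that by (induction n rule: dec_induct) (auto simp: same)
  have "fst (phase \<epsilon> s) `` {x} = (\<Union>n. A n)" by (auto simp: phase_def join_def A_def)
  also have "\<dots> = A N"
  proof (intro subset_antisym subsetI)
    fix y assume "y \<in> (\<Union>n. A n)"
    then obtain n where "y \<in> A n" by blast
    then have "y \<in> A (max n N)" using A_mono[of n "max n N"] by auto
    then show "y \<in> A N" using A_N[of "max n N"] by simp
  qed blast
  finally have phase_N: "fst (phase \<epsilon> s) `` {x} = A N" .
  show thesis
  proof (rule that[of N])
    show "fst (stage \<epsilon> s n) `` {x} = fst (phase \<epsilon> s) `` {x}" if "n \<ge> N" for n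
      using A_N[OF that] unfolding phase_N by (simp only: A_def)
    show "fst (phase \<epsilon> s) `` {x} \<in> S"
      unfolding phase_N by (rule A_S) (simp add: N_def)
  qed
qed

text \<open>A set that from some stage on meets all conditions for a candidate except the colour
  becomes a candidate when its colour recurs, and is then covered.\<close>

lemma phase_saturated:
  assumes s: "tiling_state (fst s) (snd s)" and U: "U \<in> S"
    and N: "\<And>n x. n \<ge> N \<Longrightarrow> x \<in> U \<Longrightarrow> fst (stage \<epsilon> s n) `` {x} \<subseteq> U"
      "\<And>n x y. n \<ge> N \<Longrightarrow> x \<in> U \<Longrightarrow> y \<in> U \<Longrightarrow> (x, x) \<in> fst (stage \<epsilon> s n) \<Longrightarrow>
        (y, y) \<in> fst (stage \<epsilon> s n) \<Longrightarrow> (x, y) \<in> fst (stage \<epsilon> s n)"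
      "\<And>n x. n \<ge> N \<Longrightarrow> x \<in> U \<Longrightarrow>
        0 \<le> (\<Sum>y\<in>U. (if (y, y) \<in> fst (stage \<epsilon> s n) then - \<epsilon> else 1) * wt x y)"
    and x: "x \<in> U"
  shows "(x, x) \<in> fst (phase \<epsilon> s)"
proof -
  obtain c where c: "\<And>x. x \<in> U \<Longrightarrow> colour_set c x = U" using U S_fin colour_exists[of U] by blast
  obtain n where n: "n \<ge> N" "colour_seq n = c" using colour_seq_recurrent by blast
  have "candidate (fst (stage \<epsilon> s n)) (colour_seq n) \<epsilon> U"
    unfolding candidate_def using U c n(2) N[OF n(1)] by blast
  then have "fst (stage \<epsilon> s (Suc n)) `` {x} = U" using step_Image_new x by simp
  then have "(x, x) \<in> fst (stage \<epsilon> s (Suc n))" using x by blast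
  then show ?thesis using stage_le_phase[OF s, of \<epsilon> "Suc n"] by (auto simp: state_le_def)
qed

end

section \<open>Transport along infinite tiles\<close>

text \<open>For \<open>a \<le> b\<close> and \<open>c \<le> d\<close> this is the length of the intersection of \<open>[a, b)\<close> and \<open>[c, d)\<close>.\<close>

definition overlap :: "real \<Rightarrow> real \<Rightarrow> real \<Rightarrow> real \<Rightarrow> real" where
  "overlap a b c d = min b (max a d) - min b (max a c)"

lemma overlap_nonneg: "c \<le> d \<Longrightarrow> 0 \<le> overlap a b c d"
  by (auto simp: overlap_def min_def max_def)

lemma overlap_commute: "a \<le> b \<Longrightarrow> c \<le> d \<Longrightarrow> overlap a b c d = overlap c d a b"
  by (auto simp: overlap_def min_def max_def)

lemma overlap_shift: "overlap (a + s) (b + s) c d = overlap a b (c - s) (d - s)"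
  by (auto simp: overlap_def min_def max_def)

text \<open>The sum telescopes, and it is eventually constant as \<open>T\<close> is unbounded. The
  limit is the length of the part of \<open>[a, b)\<close> in
  \<open>[0, \<infinity>)\<close>.\<close>

lemma overlap_sums:
  assumes T: "mono T" "T 0 = 0" "\<And>K. \<exists>n. K \<le> T n" and "a \<le> b"
  shows "(\<lambda>j. overlap a b (T j) (T (Suc j))) sums (b - min b (max a 0))"
proof -
  have "(\<Sum>j<n. overlap a b (T j) (T (Suc j))) = min b (max a (T n)) - min b (max a 0)" for n
    using T(2) by (induction n) (auto simp: overlap_def)
  moreover obtain N where N: "b \<le> T N" using T(3) by blast
  have "min b (max a (T n)) = b" if "n \<ge> N" for n
    using monoD[OF T(1) that] N by auto
  ultimately have "\<forall>\<^sub>F n in sequentially. (\<Sum>j<n. overlap a b (T j) (T (Suc j))) = b - min b (max a 0)"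
    by (auto simp: eventually_sequentially)
  then show ?thesis unfolding sums_def by (rule tendsto_eventually)
qed

context enumerated_equiv
begin

lemma wt_nonneg: "0 \<le> wt x y"
  using w_pos[of x y] by (auto simp: wt_def)

lemma infsum_cmult_class:
  fixes f :: "'a \<Rightarrow> ennreal"
  assumes "A \<subseteq> E `` {x}"
  shows "(\<Sum>\<^sub>\<infinity>y\<in>A. c * f y) = c * infsum f A"
proof -
  have "(\<Sum>\<^sub>\<infinity>y\<in>A. c * f y) = (\<Sum>n. c * (if first_index x n \<and> \<gamma> n x \<in> A then f (\<gamma> n x) else 0))"
    unfolding infsum_class[OF assms] by (intro suminf_cong) simp
  also have "\<dots> = c * infsum f A"
    unfolding infsum_class[OF assms] by (rule ennreal_suminf_cmult)
  finally show ?thesis .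
qed

lemma weight_scale:
  assumes "(r, x) \<in> E" "A \<subseteq> E `` {r}"
  shows "weight w r A = ennreal (w r x) * weight w x A"
proof -
  have eq: "ennreal (w r y) = ennreal (w r x) * ennreal (w x y)" if "y \<in> A" for y
  proof -
    have xy: "(x, y) \<in> E" using assms that E_sym E_trans by blast
    show ?thesis
      using w_mult[OF assms(1) xy] w_pos[OF assms(1)] w_pos[OF xy] by (simp add: ennreal_mult[symmetric])
  qed
  have "weight w r A = (\<Sum>\<^sub>\<infinity>y\<in>A. ennreal (w r x) * ennreal (w x y))"
    unfolding weight_def by (rule infsum_cong) (rule eq)
  then show ?thesis unfolding weight_def infsum_cmult_class[OF assms(2)] .
qed

end

locale tiling = enumerated_equiv +
  fixes R :: "'a rel" and B :: "'a set"
  assumes state: "tiling_state R B"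
begin

section \<open>Roots, intervals and the flow along infinite tiles\<close>

lemma R_meas [measurable]: "R \<in> sets (M \<Otimes>\<^sub>M M)" and B_meas [measurable]: "B \<in> sets M"
  and R_E: "R \<subseteq> E" and R_sym: "sym R" and R_trans: "trans R"
  using state by (auto simp: tiling_state_def)

lemma R_Image_eq: "(x, y) \<in> R \<Longrightarrow> R `` {x} = R `` {y}"
  using R_sym R_trans by (auto dest: symD transD)

lemma R_dom: "(x, y) \<in> R \<Longrightarrow> (x, x) \<in> R \<and> (y, y) \<in> R"
  using R_sym R_trans by (meson symD transD)

definition infinite_part :: "'a set" where
  "infinite_part = {x. (x, x) \<in> R \<and> weight w x (R `` {x}) = \<infinity>}"

definition root :: "'a \<Rightarrow> 'a" where
  "root x = \<gamma> (LEAST n. (x, \<gamma> n x) \<in> R \<and> \<gamma> n x \<in> B) x"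

text \<open>The weight, seen from \<open>r\<close>, of the point with index \<open>j\<close>.
  Repeated indices and points outside the tile get mass 0, hence empty intervals, so the points of
  the tile can keep their original indices.\<close>

definition mass :: "'a \<Rightarrow> nat \<Rightarrow> real" where
  "mass r j = (if first_index r j \<and> (r, \<gamma> j r) \<in> R then wt r (\<gamma> j r) else 0)"

definition total :: "'a \<Rightarrow> nat \<Rightarrow> real" where
  "total r n = (\<Sum>j<n. mass r j)"

definition index :: "'a \<Rightarrow> nat" where
  "index x = (LEAST n. \<gamma> n (root x) = x)"

definition lo :: "'a \<Rightarrow> real" where
  "lo x = total (root x) (index x)"

definition hi :: "'a \<Rightarrow> real" where
  "hi x = total (root x) (Suc (index x))"

text \<open>
  An infinite tile is laid out on \<open>[0, \<infinity>)\<close> as consecutive intervals \<open>[lo x, hi x)\<close>, starting at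
  its root and with the weights as lengths. The flow is the translation by \<open>1\<close>, which is the
  length of the interval of the root, so that nothing flows into the root.
\<close>

definition flow :: "'a \<Rightarrow> 'a \<Rightarrow> real" where
  "flow x y = (if (x, y) \<in> R \<and> x \<in> infinite_part
    then overlap (lo x + 1) (hi x + 1) (lo y) (hi y) / (hi x - lo x) else 0)"

lemma root_meas [measurable]: "root \<in> measurable M M"
  unfolding root_def[abs_def] by (rule measurable_compose_countable) measurable

lemma index_meas [measurable]: "index \<in> measurable M (count_space UNIV)"
  unfolding index_def[abs_def] by measurable

lemma mass_meas [measurable]: "(\<lambda>r. mass r j) \<in> borel_measurable M"
  unfolding mass_def by measurable

lemma total_meas [measurable]: "(\<lambda>r. total r n) \<in> borel_measurable M"
  unfolding total_def by measurable

lemma lo_meas [measurable]: "lo \<in> borel_measurable M"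
proof -
  have "(\<lambda>x. total (root x) (index x)) \<in> borel_measurable M"
    by (rule measurable_compose_countable[of "\<lambda>n x. total (root x) n"]) measurable
  then show ?thesis by (simp add: lo_def[abs_def])
qed

lemma hi_meas [measurable]: "hi \<in> borel_measurable M"
proof -
  have "(\<lambda>x. total (root x) (Suc (index x))) \<in> borel_measurable M"
    by (rule measurable_compose_countable[of "\<lambda>n x. total (root x) (Suc n)"]) measurable
  then show ?thesis by (simp add: hi_def[abs_def])
qed

lemma infinite_part_meas [measurable]: "infinite_part \<in> sets M"
proof -
  have "weight w x (R `` {x}) = (\<Sum>n. if first_index x n \<and> (x, \<gamma> n x) \<in> R then ennreal (wt x (\<gamma> n x)) else 0)" for x
  proof -
    have "weight w x (R `` {x}) = (\<Sum>n. if first_index x n \<and> \<gamma> n x \<in> R `` {x} then ennreal (w x (\<gamma> n x)) else 0)"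
      unfolding weight_def using R_E by (intro infsum_class) auto
    also have "\<dots> = (\<Sum>n. if first_index x n \<and> (x, \<gamma> n x) \<in> R then ennreal (wt x (\<gamma> n x)) else 0)"
      using R_E by (intro suminf_cong) (auto simp: wt_def)
    finally show ?thesis .
  qed
  then have "infinite_part = {x \<in> space M. (x, x) \<in> R \<and>
      (\<Sum>n. if first_index x n \<and> (x, \<gamma> n x) \<in> R then ennreal (wt x (\<gamma> n x)) else 0) = \<infinity>}"
    using R_E E_space by (auto simp: infinite_part_def)
  also have "\<dots> \<in> sets M" by measurable
  finally show ?thesis .
qed

lemma flow_meas: "(\<lambda>p. flow (fst p) (snd p)) \<in> borel_measurable (M \<Otimes>\<^sub>M M)"
  unfolding flow_def overlap_def by measurable

lemma root_props:
  assumes "(x, x) \<in> R"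
  shows "(x, root x) \<in> R" "root x \<in> B"
proof -
  obtain r where r: "(x, r) \<in> R" "r \<in> B" using state assms unfolding tiling_state_def by blast
  have "(x, r) \<in> E" using r(1) R_E by blast
  then obtain n where "r = \<gamma> n x" by (rule E_obtain_\<gamma>)
  then have ex: "\<exists>n. (x, \<gamma> n x) \<in> R \<and> \<gamma> n x \<in> B" using r by blast
  show "(x, root x) \<in> R" "root x \<in> B" unfolding root_def using LeastI_ex[OF ex] by auto
qed

lemma root_unique: "(x, r) \<in> R \<Longrightarrow> r \<in> B \<Longrightarrow> root x = r"
  using state root_props[of x] R_dom[of x r] unfolding tiling_state_def by blast

lemma root_eq: "(x, y) \<in> R \<Longrightarrow> root x = root y"
  using root_unique[of x "root y"] root_props[of y] R_dom[of x y] R_trans by (meson transD)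

lemma mass_nonneg: "0 \<le> mass r j"
  by (simp add: mass_def wt_nonneg)

lemma total_mono: "mono (total r)"
  unfolding total_def by (intro monoI sum_mono2) (auto simp: mass_nonneg)

lemma index_props:
  assumes "(x, x) \<in> R"
  shows "first_index (root x) (index x)" "\<gamma> (index x) (root x) = x"
proof -
  have "(root x, x) \<in> E" using root_props(1)[OF assms] R_sym R_E by (blast dest: symD)
  then have ex: "\<exists>n. \<gamma> n (root x) = x" using first_index_ex by blast
  show *: "\<gamma> (index x) (root x) = x" unfolding index_def using ex by (rule LeastI_ex)
  show "first_index (root x) (index x)"
    unfolding first_index_def * using not_less_Least[of _ "\<lambda>n. \<gamma> n (root x) = x"]
    by (auto simp: index_def)
qed

lemma mass_index:
  assumes "(x, x) \<in> R"
  shows "hi x - lo x = w (root x) x"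
proof -
  have R: "(root x, x) \<in> R" using root_props(1)[OF assms] R_sym by (blast dest: symD)
  then have "(root x, x) \<in> E" using R_E by blast
  then show ?thesis
    using index_props[OF assms] R by (simp add: hi_def lo_def total_def mass_def wt_def)
qed

lemma lo_hi_\<gamma>:
  assumes "r \<in> B" "(r, \<gamma> j r) \<in> R" "first_index r j"
  shows "lo (\<gamma> j r) = total r j" "hi (\<gamma> j r) = total r (Suc j)"
proof -
  have x: "(\<gamma> j r, \<gamma> j r) \<in> R" "(\<gamma> j r, r) \<in> R" using assms(2) R_dom R_sym by (auto dest: symD)
  have r: "root (\<gamma> j r) = r" by (rule root_unique[OF x(2) assms(1)])
  have "index (\<gamma> j r) = j"
    using index_props[OF x(1)] assms(3) unfolding r by (intro first_index_inj) auto
  then show "lo (\<gamma> j r) = total r j" "hi (\<gamma> j r) = total r (Suc j)"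
    by (simp_all add: lo_def hi_def r)
qed

lemma lo_root:
  assumes "x \<in> B"
  shows "lo x = 0"
proof -
  have "(x, x) \<in> R" using assms state by (simp add: tiling_state_def)
  then have "root x = x" using root_unique assms by blast
  then have "index x = 0" unfolding index_def by (intro Least_eq_0) simp
  then show ?thesis by (simp add: lo_def total_def)
qed

text \<open>As \<open>\<gamma> 0\<close> is the identity, the root has index 0 and occupies
  \<open>[0, 1)\<close>; all other points of the tile come after it.\<close>

lemma lo_nonroot:
  assumes "(x, x) \<in> R" "x \<notin> B"
  shows "1 \<le> lo x"
proof -
  let ?r = "root x"
  have r: "(x, ?r) \<in> R" "?r \<in> B" using root_props[OF assms(1)] by auto
  have rR: "(?r, ?r) \<in> R" using r(1) R_dom by blast
  have rs: "?r \<in> space M" using rR R_E E_space by blast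
  have "index x \<noteq> 0" using index_props(2)[OF assms(1)] r(2) assms(2) by (metis \<gamma>_0)
  then have "total ?r 1 \<le> lo x" unfolding lo_def using monoD[OF total_mono, of 1 "index x" ?r] by simp
  moreover have "total ?r 1 = 1"
    using rR E_refl[OF rs] w_refl[OF rs] by (simp add: total_def mass_def first_index_def wt_def)
  ultimately show ?thesis by simp
qed

lemma infinite_part_eq:
  assumes "(x, y) \<in> R" "x \<in> infinite_part"
  shows "y \<in> infinite_part"
proof -
  have E: "(x, y) \<in> E" using assms(1) R_E by blast
  have "weight w x (R `` {x}) = ennreal (w x y) * weight w y (R `` {x})"
    using R_E by (intro weight_scale[OF E]) auto
  moreover have "weight w x (R `` {x}) = \<infinity>" using assms(2) by (simp add: infinite_part_def)
  ultimately have "ennreal (w x y) * weight w y (R `` {x}) = top" by simp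
  then have "weight w y (R `` {x}) = \<infinity>" by (auto simp: ennreal_mult_eq_top_iff)
  then have "weight w y (R `` {y}) = \<infinity>" unfolding R_Image_eq[OF assms(1)] .
  then show ?thesis using R_dom[OF assms(1)] by (simp add: infinite_part_def)
qed

lemma total_unbounded:
  assumes "r \<in> infinite_part"
  shows "\<exists>n. K \<le> total r n"
proof (rule ccontr)
  assume "\<nexists>n. K \<le> total r n"
  then have K: "total r n \<le> K" for n by (meson linear)
  have "weight w r (R `` {r}) = (\<Sum>j. if first_index r j \<and> \<gamma> j r \<in> R `` {r} then ennreal (w r (\<gamma> j r)) else 0)"
    unfolding weight_def using R_E by (intro infsum_class) auto
  also have "\<dots> = (\<Sum>j. ennreal (mass r j))"
    using R_E by (intro suminf_cong) (auto simp: mass_def wt_def)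
  also have "\<dots> = (SUP n. \<Sum>j<n. ennreal (mass r j))" by (rule suminf_eq_SUP)
  also have "\<dots> \<le> ennreal K"
  proof (rule SUP_least)
    fix n
    have "(\<Sum>j<n. ennreal (mass r j)) = ennreal (total r n)"
      unfolding total_def using mass_nonneg by (intro sum_ennreal) auto
    also have "\<dots> \<le> ennreal K" using K by (intro ennreal_leI)
    finally show "(\<Sum>j<n. ennreal (mass r j)) \<le> ennreal K" .
  qed
  finally show False using assms by (simp add: infinite_part_def top_unique)
qed

text \<open>The intervals of the points partition \<open>[0, \<infinity>)\<close>. An index that
  contributes no point satisfies \<open>total r (Suc j) = total r j\<close> and adds nothing, so the
  sum over the tile is a series over all indices.\<close>

lemma infsum_overlap:
  assumes r: "r \<in> B" "r \<in> infinite_part" and ab: "a \<le> b"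
  shows "(\<Sum>\<^sub>\<infinity>y\<in>R `` {r}. ennreal (overlap a b (lo y) (hi y))) = ennreal (b - min b (max a 0))"
proof -
  have "(\<Sum>\<^sub>\<infinity>y\<in>R `` {r}. ennreal (overlap a b (lo y) (hi y))) =
      (\<Sum>j. if first_index r j \<and> \<gamma> j r \<in> R `` {r} then ennreal (overlap a b (lo (\<gamma> j r)) (hi (\<gamma> j r))) else 0)"
    using R_E by (intro infsum_class) auto
  also have "\<dots> = (\<Sum>j. ennreal (overlap a b (total r j) (total r (Suc j))))"
  proof (rule suminf_cong)
    fix j
    show "(if first_index r j \<and> \<gamma> j r \<in> R `` {r} then ennreal (overlap a b (lo (\<gamma> j r)) (hi (\<gamma> j r))) else 0) =
        ennreal (overlap a b (total r j) (total r (Suc j)))"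
    proof (cases "first_index r j \<and> (r, \<gamma> j r) \<in> R")
      case True
      then show ?thesis using lo_hi_\<gamma>[OF r(1)] by simp
    next
      case False
      then have "total r (Suc j) = total r j" by (auto simp: total_def mass_def)
      moreover have "\<not> (first_index r j \<and> \<gamma> j r \<in> R `` {r})" using False by blast
      ultimately show ?thesis unfolding overlap_def by (subst if_not_P) simp_all
    qed
  qed
  also have "\<dots> = ennreal (b - min b (max a 0))"
  proof (rule suminf_ennreal_eq)
    show "0 \<le> overlap a b (total r j) (total r (Suc j))" for j
      using monoD[OF total_mono, of j "Suc j" r] by (intro overlap_nonneg) simp
    show "(\<lambda>j. overlap a b (total r j) (total r (Suc j))) sums (b - min b (max a 0))"
      by (intro overlap_sums total_mono total_unbounded[OF r(2)] ab) (simp add: total_def)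
  qed
  finally show ?thesis .
qed

text \<open>The interval of \<open>x\<close>, moved to the right by 1, stays in
  \<open>[0, \<infinity>)\<close> and is covered completely; the division by its length normalises
  the total to 1.\<close>

lemma outflow_flow: "outflow E flow x = (if x \<in> infinite_part then 1 else 0)"
proof (cases "x \<in> infinite_part")
  case False
  then show ?thesis by (simp add: outflow_def flow_def)
next
  case True
  then have xR: "(x, x) \<in> R" by (simp add: infinite_part_def)
  let ?r = "root x" and ?m = "hi x - lo x"
  have r: "(x, ?r) \<in> R" "?r \<in> B" using root_props[OF xR] by auto
  have "(?r, x) \<in> E" using r(1) R_sym R_E by (blast dest: symD)
  then have m: "?m > 0" using mass_index[OF xR] w_pos by simp
  have lo: "0 \<le> lo x" using lo_root lo_nonroot[OF xR] by (cases "x \<in> B") fastforce+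
  have "outflow E flow x = (\<Sum>\<^sub>\<infinity>y\<in>R `` {x}. ennreal (flow x y))"
    unfolding outflow_def using R_E by (intro infsum_cong_neutral) (auto simp: flow_def)
  also have "\<dots> = (\<Sum>\<^sub>\<infinity>y\<in>R `` {x}. ennreal (overlap (lo x + 1) (hi x + 1) (lo y) (hi y) / ?m))"
    using True by (intro infsum_cong) (auto simp: flow_def)
  also have "\<dots> = (\<Sum>\<^sub>\<infinity>y\<in>R `` {x}. ennreal (1 / ?m) * ennreal (overlap (lo x + 1) (hi x + 1) (lo y) (hi y)))"
  proof (rule infsum_cong)
    fix y assume "y \<in> R `` {x}"
    then have y: "(y, y) \<in> R" using R_dom by blast
    have "lo y \<le> hi y" unfolding lo_def hi_def using monoD[OF total_mono] by simp
    then show "ennreal (overlap (lo x + 1) (hi x + 1) (lo y) (hi y) / ?m) =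
        ennreal (1 / ?m) * ennreal (overlap (lo x + 1) (hi x + 1) (lo y) (hi y))"
      using m overlap_nonneg[of "lo y" "hi y"] by (simp add: ennreal_mult[symmetric])
  qed
  also have "\<dots> = ennreal (1 / ?m) * (\<Sum>\<^sub>\<infinity>y\<in>R `` {x}. ennreal (overlap (lo x + 1) (hi x + 1) (lo y) (hi y)))"
    using R_E by (intro infsum_cmult_class) auto
  also have "(\<Sum>\<^sub>\<infinity>y\<in>R `` {x}. ennreal (overlap (lo x + 1) (hi x + 1) (lo y) (hi y))) = ennreal ?m"
    unfolding R_Image_eq[OF r(1)] using infsum_overlap[OF r(2) infinite_part_eq[OF r(1) True], of "lo x + 1" "hi x + 1"] m lo
    by (simp add: max_def min_def)
  also have "ennreal (1 / ?m) * ennreal ?m = 1"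
    using m by (simp add: ennreal_mult[symmetric])
  finally show ?thesis using True by simp
qed

text \<open>By the cocycle identity \<open>w y x\<close> is the quotient of the interval lengths of
  \<open>x\<close> and \<open>y\<close>, so the length of the source interval cancels and the inflow
  is the fraction of \<open>[lo y - 1, hi y - 1)\<close> inside \<open>[0, \<infinity>)\<close>.
  This is everything unless \<open>y\<close> is the root, whose interval \<open>[0, 1)\<close> is
  moved to \<open>[-1, 0)\<close>.\<close>

lemma inflow_flow: "inflow E w flow y = (if y \<in> infinite_part \<and> y \<notin> B then 1 else 0)"
proof (cases "y \<in> infinite_part")
  case False
  then have "flow x y = 0" for x using infinite_part_eq[of x y] by (auto simp: flow_def)
  then show ?thesis using False by (simp add: inflow_def)
next
  case True
  then have yR: "(y, y) \<in> R" by (simp add: infinite_part_def)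
  let ?r = "root y" and ?m = "hi y - lo y"
  have r: "(y, ?r) \<in> R" "?r \<in> B" using root_props[OF yR] by auto
  have rE: "(?r, y) \<in> E" "(y, ?r) \<in> E" using r(1) R_sym R_E by (blast dest: symD)+
  then have m: "?m > 0" using mass_index[OF yR] w_pos by simp
  have "inflow E w flow y = (\<Sum>\<^sub>\<infinity>x\<in>R `` {y}. ennreal (flow x y * w y x))"
    unfolding inflow_def using R_E R_sym
    by (intro infsum_cong_neutral) (auto simp: flow_def dest: symD)
  also have "\<dots> = (\<Sum>\<^sub>\<infinity>x\<in>R `` {y}. ennreal (1 / ?m) * ennreal (overlap (lo y - 1) (hi y - 1) (lo x) (hi x)))"
  proof (rule infsum_cong)
    fix x assume "x \<in> R `` {y}"
    then have x: "(y, x) \<in> R" by blast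
    then have x': "(x, y) \<in> R" "(x, x) \<in> R" using R_sym R_dom by (auto dest: symD)
    have rx: "root x = ?r" using root_eq[OF x] by simp
    have rxE: "(?r, x) \<in> E" using rE(1) x R_E E_trans by blast
    have mx: "hi x - lo x = w ?r x" "hi x - lo x > 0"
      using mass_index[OF x'(2)] w_pos[OF rxE] by (simp_all add: rx)
    have "w y x = w y ?r * w ?r x" using w_mult[OF rE(2) rxE] by simp
    moreover have "w y ?r = 1 / ?m"
      using w_inverse[OF rE(2)] mass_index[OF yR] m by (simp add: field_simps)
    ultimately have wyx: "w y x = (hi x - lo x) / ?m" using mx(1) by simp
    have "flow x y = overlap (lo x + 1) (hi x + 1) (lo y) (hi y) / (hi x - lo x)"
      using infinite_part_eq[OF x True] x'(1) by (simp add: flow_def)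
    also have "overlap (lo x + 1) (hi x + 1) (lo y) (hi y) = overlap (lo y - 1) (hi y - 1) (lo x) (hi x)"
      unfolding overlap_shift using mx(2) m by (intro overlap_commute) auto
    finally have "flow x y * w y x = 1 / ?m * overlap (lo y - 1) (hi y - 1) (lo x) (hi x)"
      using mx(2) wyx by simp
    then show "ennreal (flow x y * w y x) =
        ennreal (1 / ?m) * ennreal (overlap (lo y - 1) (hi y - 1) (lo x) (hi x))"
      using m mx(2) overlap_nonneg[of "lo x" "hi x" "lo y - 1" "hi y - 1"] by (simp add: ennreal_mult[symmetric])
  qed
  also have "\<dots> = ennreal (1 / ?m) * (\<Sum>\<^sub>\<infinity>x\<in>R `` {y}. ennreal (overlap (lo y - 1) (hi y - 1) (lo x) (hi x)))"
    using R_E by (intro infsum_cmult_class) auto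
  also have "(\<Sum>\<^sub>\<infinity>x\<in>R `` {y}. ennreal (overlap (lo y - 1) (hi y - 1) (lo x) (hi x))) = ennreal (if y \<in> B then 0 else ?m)"
  proof -
    have "hi y = 1" if "y \<in> B"
    proof -
      have "?r = y" using root_unique[OF yR that] .
      then show ?thesis using mass_index[OF yR] lo_root[OF that] w_refl E_space rE(1) by fastforce
    qed
    then have "y \<in> B \<and> lo y = 0 \<and> hi y = 1 \<or> y \<notin> B \<and> 1 \<le> lo y"
      using lo_root lo_nonroot[OF yR] by blast
    then have "hi y - 1 - min (hi y - 1) (max (lo y - 1) 0) = (if y \<in> B then 0 else ?m)"
      using m by (auto simp: max_def min_def)
    then show ?thesis
      unfolding R_Image_eq[OF r(1)]
      using infsum_overlap[OF r(2) infinite_part_eq[OF r(1) True], of "lo y - 1" "hi y - 1"] m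
      by simp
  qed
  also have "ennreal (1 / ?m) * ennreal (if y \<in> B then 0 else ?m) = (if y \<in> B then 0 else 1)"
    using m by (simp add: ennreal_mult[symmetric])
  finally show ?thesis using True by simp
qed

lemma saturation_meas: "A \<in> sets M \<Longrightarrow> E `` A \<in> sets M"
proof -
  assume A[measurable]: "A \<in> sets M"
  have "E `` A = {x \<in> space M. \<exists>n. \<gamma> n x \<in> A}"
  proof (intro set_eqI iffI)
    fix x assume "x \<in> E `` A"
    then obtain y where y: "y \<in> A" "(x, y) \<in> E" using E_sym by blast
    then obtain n where "y = \<gamma> n x" using E_obtain_\<gamma> by blast
    then show "x \<in> {x \<in> space M. \<exists>n. \<gamma> n x \<in> A}" using y E_space by blast
  next
    fix x assume "x \<in> {x \<in> space M. \<exists>n. \<gamma> n x \<in> A}"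
    then show "x \<in> E `` A" using E_\<gamma> E_sym by blast
  qed
  then show ?thesis by simp
qed

lemma saturation_invariant: "E `` (E `` A) \<subseteq> E `` A"
  using E_trans by blast

text \<open>Outflow and inflow balance everywhere except at the roots of infinite tiles, which send
  out 1 and receive nothing. So there are no sinks, and each class in question contains a
  source.\<close>

theorem deficient_infinite_part: "deficient M E w (E `` infinite_part)"
  unfolding deficient_def
proof (intro exI[of _ flow] conjI ballI impI)
  show "borel_transport M E flow"
    unfolding borel_transport_def
  proof (intro conjI allI impI)
    show "(\<lambda>(x, y). flow x y) \<in> borel_measurable (restrict_space (M \<Otimes>\<^sub>M M) E)"
      unfolding case_prod_unfold by (rule measurable_restrict_space1[OF flow_meas])
    fix x y assume "(x, y) \<in> E"
    have "lo z \<le> hi z" for z unfolding lo_def hi_def using monoD[OF total_mono] by simp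
    then show "0 \<le> flow x y" by (auto simp: flow_def intro!: divide_nonneg_nonneg overlap_nonneg)
  qed
  show "w_bounded M E w flow"
    by (simp add: w_bounded_def outflow_flow inflow_flow)
  fix C assume C: "C \<in> space M // E" "C \<subseteq> E `` (E `` infinite_part)"
  obtain x where x: "x \<in> space M" "C = E `` {x}" using C(1) by (rule quotientE)
  have "x \<in> C" using x E_refl by blast
  then have "x \<in> E `` infinite_part" using C(2) saturation_invariant by blast
  then obtain y where y: "y \<in> infinite_part" "(y, x) \<in> E" by blast
  have yR: "(y, y) \<in> R" using y(1) by (simp add: infinite_part_def)
  have r: "(y, root y) \<in> R" "root y \<in> B" using root_props[OF yR] by auto
  have "root y \<in> infinite_part" using infinite_part_eq[OF r(1) y(1)] .
  then have "is_source E w flow (root y)"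
    using r(2) by (simp add: is_source_def outflow_flow inflow_flow)
  moreover have "root y \<in> C" using r(1) R_E y(2) E_sym E_trans x(2) by blast
  moreover have "\<not> is_sink E w flow z" for z
    by (simp add: is_sink_def outflow_flow inflow_flow)
  ultimately show "disbalances E w flow C" unfolding disbalances_def by blast
qed

end

section \<open>Saturated tilings\<close>

context tiling_setup
begin

lemma tiles_state:
  assumes P0: "P0 \<in> sets (wfin_space M L E w)" "P0 \<subseteq> S" "disjoint P0"
  shows "tiling_state (\<Union>U\<in>P0. U \<times> U) {x. \<exists>U\<in>P0. x \<in> U \<and> (\<forall>y\<in>U. \<not> wless L E w x y)}"
    (is "tiling_state ?R ?B")
proof -
  \<comment> \<open>\<open>P0\<close> is itself a Borel collection of finite sets, so the
    measurability lemma for \<open>S\<close> can be used with \<open>P0\<close> in its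
    place.\<close>
  interpret P: tiling_setup M E L w \<gamma> \<beta> P0
    using P0 S_fin by unfold_locales auto
  have fin: "U \<in> fin_sets M E" if "U \<in> P0" for U using that P0(2) S_fin by blast
  have UE: "(x, y) \<in> E" if "U \<in> P0" "x \<in> U" "y \<in> U" for U x y
    using fin[OF that(1)] related_E that(2,3) by (auto simp: fin_sets_def)
  have uniq: "U = V" if "U \<in> P0" "V \<in> P0" "x \<in> U" "x \<in> V" for U V x
    using that P0(3) by (auto simp: disjoint_def)
  have tile: "\<exists>l. \<gamma>_image (set l) x = U" if U: "U \<in> P0" "x \<in> U" for U x
  proof -
    obtain c where "\<And>x. x \<in> U \<Longrightarrow> colour_set c x = U" using colour_exists[OF fin[OF U(1)]] by blast
    then show ?thesis using U(2) unfolding colour_set_def by blast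
  qed
  note [measurable] = P.S_pred
  let ?X = "{p \<in> space (M \<Otimes>\<^sub>M M). \<exists>l. \<gamma>_image (set l) (fst p) \<in> P0 \<and>
      (\<exists>n\<in>set l. \<gamma> n (fst p) = fst p) \<and> (\<exists>n\<in>set l. \<gamma> n (fst p) = snd p)}"
  have "?R = ?X"
  proof (intro set_eqI iffI)
    fix p assume "p \<in> ?R"
    then obtain U where U: "U \<in> P0" "fst p \<in> U" "snd p \<in> U" by auto
    obtain l where l: "\<gamma>_image (set l) (fst p) = U" using tile[OF U(1,2)] by blast
    have "p \<in> space (M \<Otimes>\<^sub>M M)" using E_space[OF UE[OF U]] by (simp add: space_pair_measure mem_Times_iff)
    moreover have "(\<exists>n\<in>set l. \<gamma> n (fst p) = fst p) \<and> (\<exists>n\<in>set l. \<gamma> n (fst p) = snd p)"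
      using U(2,3) unfolding l[symmetric] mem_\<gamma>_image by blast
    ultimately show "p \<in> ?X"
      using l U(1) by blast
  next
    fix p assume "p \<in> ?X"
    then obtain l where l: "\<gamma>_image (set l) (fst p) \<in> P0"
      "fst p \<in> \<gamma>_image (set l) (fst p)" "snd p \<in> \<gamma>_image (set l) (fst p)"
      unfolding mem_\<gamma>_image by blast
    then have "(fst p, snd p) \<in> ?R" by blast
    then show "p \<in> ?R" by simp
  qed
  also have "\<dots> \<in> sets (M \<Otimes>\<^sub>M M)" by measurable
  finally have R: "?R \<in> sets (M \<Otimes>\<^sub>M M)" .
  let ?Z = "{x \<in> space M. \<exists>l. \<gamma>_image (set l) x \<in> P0 \<and> (\<exists>n\<in>set l. \<gamma> n x = x) \<and>
      (\<forall>n\<in>set l. \<not> wless L E w x (\<gamma> n x))}"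
  have "?B = ?Z"
  proof (intro set_eqI iffI)
    fix x assume "x \<in> ?B"
    then obtain U where U: "U \<in> P0" "x \<in> U" "\<forall>y\<in>U. \<not> wless L E w x y" by blast
    obtain l where l: "\<gamma>_image (set l) x = U" using tile[OF U(1,2)] by blast
    have "x \<in> space M" using UE[OF U(1,2,2)] E_space by blast
    then show "x \<in> ?Z"
      using U unfolding l[symmetric] mem_\<gamma>_image ball_\<gamma>_image by blast
  next
    fix x assume "x \<in> ?Z"
    then obtain l where l: "\<gamma>_image (set l) x \<in> P0" "x \<in> \<gamma>_image (set l) x"
      "\<forall>y\<in>\<gamma>_image (set l) x. \<not> wless L E w x y"
      unfolding mem_\<gamma>_image ball_\<gamma>_image by blast
    then show "x \<in> ?B" by blast
  qed
  also have "\<dots> \<in> sets M" by measurable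
  finally have B: "?B \<in> sets M" .
  have sym: "sym ?R" by (auto intro: symI)
  have trans: "trans ?R" using uniq by (intro transI) blast
  have root: "\<exists>!r. (x, r) \<in> ?R \<and> r \<in> ?B" if x: "(x, x) \<in> ?R" for x
  proof -
    obtain U where U: "U \<in> P0" "x \<in> U" using x by blast
    have "(x, r) \<in> ?R \<and> r \<in> ?B \<longleftrightarrow> r \<in> U \<and> (\<forall>y\<in>U. \<not> wless L E w r y)" for r
      using U uniq by blast
    then show ?thesis using max_unique[OF fin[OF U(1)]] by presburger
  qed
  have RE: "?R \<subseteq> E" using UE by blast
  have BR: "\<forall>x\<in>?B. (x, x) \<in> ?R" by blast
  show ?thesis unfolding tiling_state_def using R B RE sym trans BR root by blast
qed

lemma wt_mult: "(z, x) \<in> E \<Longrightarrow> (x, y) \<in> E \<Longrightarrow> wt z y = wt z x * wt x y"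
  using w_mult[of z x y] E_trans[of z x y] by (simp add: wt_def)

theorem saturating_tiling_exists:
  assumes P0: "P0 \<in> sets (wfin_space M L E w)" "P0 \<subseteq> S" "disjoint P0"
  shows "\<exists>P D. disjoint P \<and> P \<in> sets (wfin_space M L E w) \<and> P \<subseteq> increasing_closure M E w S \<and>
    D \<in> sets M \<and> E `` D \<subseteq> D \<and> deficient M E w D \<and>
    (\<exists>Pn. saturating_approximation M E w (restrict_to S (space M - D)) (restrict_to P (space M - D)) Pn \<and>
      Pn 0 = restrict_to P0 (space M - D))"
proof -
  define s where "s = (\<Union>U\<in>P0. U \<times> U, {x. \<exists>U\<in>P0. x \<in> U \<and> (\<forall>y\<in>U. \<not> wless L E w x y)})"
  have s: "tiling_state (fst s) (snd s)" unfolding s_def using tiles_state[OF P0] by simp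
  define T where "T k = fst (run s k)" for k
  define R where "R = fst (join (run s))"
  have T_state: "tiling_state (T k) (snd (run s k))" for k unfolding T_def by (rule run_state[OF s])
  have R_state: "tiling_state R (snd (join (run s)))"
    unfolding R_def by (rule tiling_state_join) (rule run_state[OF s] run_le[OF s])+
  interpret tiling M E L w \<gamma> \<beta> R "snd (join (run s))"
    using R_state by unfold_locales
  have R_T: "R = (\<Union>k. T k)" by (simp add: R_def T_def join_def)
  have T_mono: "T j \<subseteq> T k" if "j \<le> k" for j k
    using run_mono[OF s that] by (simp add: state_le_def T_def)
  have T_sym: "sym (T k)" and T_trans: "trans (T k)" and T_E: "T k \<subseteq> E" for k
    using T_state[of k] by (auto simp: tiling_state_def)
  have T_dom: "(x, x) \<in> T k \<and> (y, y) \<in> T k" if "(x, y) \<in> T k" for x y k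
    using tiling_dom[OF T_state that] .
  have T_Image: "T k `` {x} = T k `` {y}" if "(x, y) \<in> T k" for x y k
    using that T_sym[of k] T_trans[of k] by (auto dest: symD transD)
  \<comment> \<open>It covers tiles whose weight becomes infinite within one phase and those for
    which this takes all phases, since \<open>R\<close> is the union of the whole run.\<close>
  define D where "D = E `` infinite_part"
  define Y where "Y = space M - D"
  have D: "D \<in> sets M" "E `` D \<subseteq> D" "deficient M E w D"
    unfolding D_def by (rule saturation_meas[OF infinite_part_meas] saturation_invariant deficient_infinite_part)+
  have Y_meas: "Y \<in> sets M" unfolding Y_def using D(1) by blast
  have Y_E: "y \<in> Y" if "(x, y) \<in> E" "x \<in> Y" for x y
    using that D(2) E_space E_sym unfolding Y_def by blast
  have fin: "weight w x (R `` {x}) < \<infinity>" if "x \<in> Y" "(x, x) \<in> R" for x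
  proof -
    have "x \<notin> infinite_part" using that(1) E_refl unfolding Y_def D_def by blast
    then show ?thesis using that(2) by (simp add: infinite_part_def less_top[symmetric])
  qed
  have fin_T: "weight w x (T k `` {x}) < \<infinity>" if "x \<in> Y" "(x, x) \<in> T k" for x k
  proof -
    have "weight w x (T k `` {x}) \<le> weight w x (R `` {x})"
      unfolding weight_def by (rule infsum_mono_neutral) (auto simp: R_T)
    then show ?thesis using fin[OF that(1)] that(2) R_T by (metis UN_I UNIV_I le_less_trans)
  qed
  \<comment> \<open>Outside \<open>D\<close> the weight of the final tile is finite and bounds the
    weight of the tile after each phase. So no tile of a point of \<open>Y\<close> grows infinitely
    often within a phase, and each phase ends with a set in \<open>S\<close>.\<close>
  have T_S: "T k `` {x} \<in> S" if "x \<in> Y" "(x, x) \<in> T k" for x k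
    using that(2)
  proof (induction k)
    case 0
    then obtain U where U: "U \<in> P0" "x \<in> U" by (auto simp: T_def s_def)
    have "T 0 `` {x} = U"
      using U P0(3) by (fastforce simp: T_def s_def disjoint_def)
    then show ?case using U(1) P0(2) by blast
  next
    case (Suc k)
    have eq: "T (Suc k) = fst (phase (inverse (real (Suc k))) (run s k))" by (simp add: T_def)
    show ?case
      unfolding eq
    proof (rule phase_stabilises)
      show "tiling_state (fst (run s k)) (snd (run s k))" by (rule run_state[OF s])
      show "(0::real) < inverse (real (Suc k))" by simp
      show "(x, x) \<in> fst (run s k) \<Longrightarrow> fst (run s k) `` {x} \<in> S" using Suc.IH by (simp add: T_def)
      show "(x, x) \<in> fst (phase (inverse (real (Suc k))) (run s k))" using Suc.prems eq by simp
      show "weight w x (fst (phase (inverse (real (Suc k))) (run s k)) `` {x}) < \<infinity>"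
        using fin_T[OF that(1) Suc.prems] eq by simp
    qed
  qed
  define Pn where "Pn k = {T k `` {x} |x. x \<in> Y \<and> (x, x) \<in> T k}" for k
  define P where "P = {R `` {x} |x. x \<in> Y \<and> (x, x) \<in> R}"
  have T_R: "T k \<subseteq> R" for k using R_T by blast
  have R_Y: "R `` {x} \<subseteq> Y" if "x \<in> Y" for x using R_E Y_E that by blast
  have T_Y: "T k `` {x} \<subseteq> Y" if "x \<in> Y" for x k using R_Y[OF that] T_R by blast
  have Un_P: "\<Union>P = {x \<in> Y. (x, x) \<in> R}"
  proof (intro subset_antisym subsetI)
    fix y assume "y \<in> \<Union>P"
    then obtain x where "x \<in> Y" "(x, y) \<in> R" by (auto simp: P_def)
    then show "y \<in> {x \<in> Y. (x, x) \<in> R}" using R_Y R_dom by blast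
  qed (auto simp: P_def)
  have Un_Pn: "\<Union>(Pn k) = {x \<in> Y. (x, x) \<in> T k}" for k
  proof (intro subset_antisym subsetI)
    fix y assume "y \<in> \<Union>(Pn k)"
    then obtain x where "x \<in> Y" "(x, y) \<in> T k" by (auto simp: Pn_def)
    then show "y \<in> {x \<in> Y. (x, x) \<in> T k}" using T_Y T_dom by blast
  qed (auto simp: Pn_def)
  have tile_rel_Pn: "tile_rel M (Pn k) = Id_on (space M) \<union> T k \<inter> Y \<times> Y" for k
  proof -
    have "(\<Union>U\<in>Pn k. U \<times> U) = T k \<inter> Y \<times> Y"
    proof (intro set_eqI iffI)
      fix p assume "p \<in> (\<Union>U\<in>Pn k. U \<times> U)"
      then obtain x where x: "x \<in> Y" "(x, fst p) \<in> T k" "(x, snd p) \<in> T k" by (auto simp: Pn_def)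
      then have "(fst p, snd p) \<in> T k" using T_Image by blast
      then show "p \<in> T k \<inter> Y \<times> Y" using x T_Y[OF x(1)] by (auto simp: mem_Times_iff)
    next
      fix p assume p: "p \<in> T k \<inter> Y \<times> Y"
      then have "(fst p, fst p) \<in> T k" using T_dom by (metis IntD1 prod.collapse)
      then show "p \<in> (\<Union>U\<in>Pn k. U \<times> U)"
        using p by (intro UN_I[of "T k `` {fst p}"]) (auto simp: Pn_def mem_Times_iff)
    qed
    then show ?thesis by (simp add: tile_rel_def)
  qed
  have wfin: "R `` {x} \<in> wfin_sets M E w" if "x \<in> Y" "(x, x) \<in> R" for x
  proof -
    have "x \<in> space M" using that(1) by (simp add: Y_def)
    then have "related_set M E (R `` {x})" unfolding related_set_def using R_E by blast
    moreover have "x \<in> E `` (R `` {x})" using that(2) R_E by blast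
    ultimately show ?thesis using that(2) fin[OF that] by (auto simp: wfin_sets_def)
  qed
  have P_disj: "disjoint P"
    unfolding disjoint_def P_def using R_Image_eq by blast
  have P_wfin: "P \<subseteq> wfin_sets M E w" using wfin by (auto simp: P_def)
  have P_meas: "P \<in> sets (wfin_space M L E w)"
  proof -
    \<comment> \<open>Off \<open>D\<close> all classes are weight-finite, as
      \<open>classes_meas\<close> demands; \<open>R\<close> itself may have classes of infinite
      weight.\<close>
    let ?Q = "R \<inter> Y \<times> Y"
    have Q_dom: "Domain ?Q = {x \<in> Y. (x, x) \<in> R}" using R_dom by blast
    have Q_Im: "?Q `` {x} = R `` {x}" if "x \<in> Y" for x using R_Y[OF that] that by blast
    have "{?Q `` {x} |x. x \<in> Domain ?Q} \<in> sets (wfin_space M L E w)"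
    proof (rule classes_meas)
      show "?Q \<in> sets (M \<Otimes>\<^sub>M M)" using R_meas Y_meas by blast
      show "?Q \<subseteq> E" using R_E by blast
      show "sym ?Q" using R_sym by (auto intro!: symI dest: symD)
      show "trans ?Q" using R_trans by (auto intro!: transI dest: transD)
      show "?Q `` {x} \<in> wfin_sets M E w" if "x \<in> Domain ?Q" for x
        using that wfin[of x] Q_Im[of x] unfolding Q_dom by simp
    qed
    moreover have "{?Q `` {x} |x. x \<in> Domain ?Q} = P"
      unfolding Q_dom P_def using Q_Im by blast
    ultimately show ?thesis by simp
  qed
  have P_inc: "P \<subseteq> increasing_closure M E w S"
  proof
    fix A assume "A \<in> P"
    then obtain x where x: "x \<in> Y" "(x, x) \<in> R" "A = R `` {x}" by (auto simp: P_def)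
    obtain k where k: "(x, x) \<in> T k" using x(2) R_T by blast
    \<comment> \<open>The sequence starts at a time \<open>k\<close> when \<open>x\<close> is
      already covered; before that, the image of \<open>x\<close> under \<open>T n\<close> is empty
      and not in \<open>S\<close>.\<close>
    define F where "F n = T (k + n) `` {x}" for n
    have "F m \<subseteq> F n" if "m \<le> n" for m n using T_mono[of "k + m" "k + n"] that by (auto simp: F_def)
    then have "incseq F" by (intro monoI)
    moreover have "F n \<in> S" for n
      unfolding F_def using T_S[OF x(1)] T_mono[of k "k + n"] k by auto
    moreover have "A = (\<Union>n. F n)"
    proof (intro subset_antisym subsetI)
      fix y assume "y \<in> A"
      then obtain j where "(x, y) \<in> T j" using x(3) R_T by blast
      then have "(x, y) \<in> T (k + j)" using T_mono[of j "k + j"] by auto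
      then show "y \<in> (\<Union>n. F n)" by (auto simp: F_def)
    next
      fix y assume "y \<in> (\<Union>n. F n)"
      then show "y \<in> A" using x(3) T_R by (auto simp: F_def)
    qed
    moreover have "A \<in> wfin_sets M E w" using wfin x by simp
    ultimately show "A \<in> increasing_closure M E w S" unfolding increasing_closure_def by blast
  qed
  have P_restr: "restrict_to P Y = P" using R_Y by (auto simp: restrict_to_def P_def)
  have T0: "T 0 `` {x} = U" if "U \<in> P0" "x \<in> U" for U x
    using that P0(3) by (fastforce simp: T_def s_def disjoint_def)
  have Pn0: "Pn 0 = restrict_to P0 Y"
  proof (intro subset_antisym subsetI)
    fix A assume "A \<in> Pn 0"
    then obtain x where x: "x \<in> Y" "(x, x) \<in> T 0" "A = T 0 `` {x}" by (auto simp: Pn_def)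
    then obtain U where "U \<in> P0" "x \<in> U" by (auto simp: T_def s_def)
    then show "A \<in> restrict_to P0 Y" using T0 x(3) T_Y[OF x(1), of 0] by (simp add: restrict_to_def)
  next
    fix A assume "A \<in> restrict_to P0 Y"
    then have A: "A \<in> P0" "A \<subseteq> Y" by (auto simp: restrict_to_def)
    have "A \<noteq> {}" using A(1) P0(2) S_fin by (auto simp: fin_sets_def)
    then obtain x where x: "x \<in> A" by blast
    then have "T 0 `` {x} = A" using T0 A(1) by blast
    then show "A \<in> Pn 0" using x A(2) unfolding Pn_def by blast
  qed
  have Pn_S: "Pn k \<subseteq> restrict_to S Y" for k
  proof
    fix A assume "A \<in> Pn k"
    then obtain x where x: "x \<in> Y" "(x, x) \<in> T k" "A = T k `` {x}" by (auto simp: Pn_def)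
    show "A \<in> restrict_to S Y" unfolding x(3) restrict_to_def using T_S[OF x(1,2)] T_Y[OF x(1)] by simp
  qed
  have inj: "injective_tilings M Pn"
    unfolding injective_tilings_def
  proof (intro conjI allI ballI impI)
    show "disjoint (Pn n)" for n
      unfolding disjoint_def Pn_def using T_Image by blast
  next
    fix n U assume "U \<in> Pn (Suc n)"
    then obtain u where u: "u \<in> Y" "U = T (Suc n) `` {u}" by (auto simp: Pn_def)
    show "tile_rel M (Pn n) `` U \<subseteq> U"
    proof
      fix z assume "z \<in> tile_rel M (Pn n) `` U"
      then obtain y where y: "y \<in> U" "(y, z) \<in> tile_rel M (Pn n)" by blast
      then have "y = z \<or> (y, z) \<in> T (Suc n)"
        using T_mono[of n "Suc n"] by (auto simp: tile_rel_Pn)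
      then show "z \<in> U" using y(1) u(2) transD[OF T_trans] by blast
    qed
    fix V V' assume V: "V \<in> Pn n" "V' \<in> Pn n" "V \<subseteq> U" "V' \<subseteq> U"
    obtain v v' where v: "(v, v) \<in> T n" "V = T n `` {v}" "(v', v') \<in> T n" "V' = T n `` {v'}"
      using V(1,2) by (auto simp: Pn_def)
    have "(u, v) \<in> T (Suc n)" "(u, v') \<in> T (Suc n)" using v V(3,4) u(2) by blast+
    then have eq: "T (Suc n) `` {v} = T (Suc n) `` {v'}" using T_Image by blast
    \<comment> \<open>Passing to a larger state leaves the roots of a tile unchanged. So
      \<open>V\<close> and \<open>V'\<close> both have the root of the tile \<open>U\<close>
      containing them, and tiles with a common point coincide.\<close>
    have "state_le (run s n) (run s (Suc n))" by (rule run_le[OF s])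
    then have "T n `` {v} \<inter> snd (run s n) = T n `` {v'} \<inter> snd (run s n)"
      using eq v(1,3) unfolding state_le_def T_def by metis
    moreover obtain r where "r \<in> T n `` {v} \<inter> snd (run s n)"
      using T_state[of n] v(1) unfolding tiling_state_def by blast
    ultimately have "(v, r) \<in> T n" "(v', r) \<in> T n" by blast+
    then show "V = V'" using T_Image v by blast
  next
    show "\<Union>(Pn n) \<subseteq> \<Union>(Pn (Suc n))" for n
      unfolding Un_Pn using T_mono[of n "Suc n"] by auto
  qed
  have P_join: "P = tiling_join M Pn"
  proof -
    have rel: "Id_on (space M) \<union> (\<Union>n. tile_rel M (Pn n)) = Id_on (space M) \<union> R \<inter> Y \<times> Y"
      unfolding tile_rel_Pn R_T by blast
    have dom: "(\<Union>n. \<Union>(Pn n)) = {x \<in> Y. (x, x) \<in> R}"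
      unfolding Un_Pn R_T by blast
    have cls: "(Id_on (space M) \<union> R \<inter> Y \<times> Y) `` {x} = R `` {x}" if "x \<in> Y" "(x, x) \<in> R" for x
      using that R_Y[OF that(1)] by (auto simp: Y_def)
    show ?thesis
      unfolding tiling_join_def rel dom
    proof (intro subset_antisym subsetI)
      fix C assume C: "C \<in> P"
      then obtain x where x: "x \<in> Y" "(x, x) \<in> R" "C = R `` {x}" by (auto simp: P_def)
      have "C \<in> space M // (Id_on (space M) \<union> R \<inter> Y \<times> Y)"
        unfolding x(3) cls[OF x(1,2), symmetric] using x(1) by (intro quotientI) (simp add: Y_def)
      moreover have "C \<subseteq> {x \<in> Y. (x, x) \<in> R}" using C Un_P by blast
      ultimately show "C \<in> {C \<in> space M // (Id_on (space M) \<union> R \<inter> Y \<times> Y). C \<subseteq> {x \<in> Y. (x, x) \<in> R}}"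
        by blast
    next
      fix C assume "C \<in> {C \<in> space M // (Id_on (space M) \<union> R \<inter> Y \<times> Y). C \<subseteq> {x \<in> Y. (x, x) \<in> R}}"
      then obtain x where x: "x \<in> space M" "C = (Id_on (space M) \<union> R \<inter> Y \<times> Y) `` {x}"
        "C \<subseteq> {x \<in> Y. (x, x) \<in> R}"
        by (auto elim: quotientE)
      then have "x \<in> C" by auto
      then have "x \<in> Y" "(x, x) \<in> R" using x(3) by auto
      then show "C \<in> P" using cls x(2) by (auto simp: P_def)
    qed
  qed
  \<comment> \<open>Both ways of violating saturation at once: \<open>A = {}\<close> stands for a
    set \<open>Q\<close> in \<open>S\<close>, and otherwise \<open>A\<close> is the tile to be
    extended. Comparing \<open>Q\<close> with the final weight of the tile, and not with that of
    \<open>A\<close>, allows \<open>k\<close> to be chosen before \<open>A\<close> is known.\<close>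
  have sat: False
    if Q: "Q \<in> wfin_sets M E w" "Q \<inter> \<Union>P = {}" "Q \<subseteq> Y" and A: "A \<union> Q \<in> S"
      and AQ: "A = {} \<or> (\<exists>x\<in>Y. (x, x) \<in> T (Suc k) \<and> A = T (Suc k) `` {x} \<and>
        inverse (real (Suc k)) * enn2real (weight w x (R `` {x})) \<le> (\<Sum>y\<in>Q. wt x y))" for Q A k
  proof -
    let ?\<epsilon> = "inverse (real (Suc k))"
    let ?st = "stage ?\<epsilon> (run s k)"
    have Tk: "T (Suc k) = fst (phase ?\<epsilon> (run s k))" by (simp add: T_def)
    have st_T: "fst (?st n) \<subseteq> T (Suc k)" for n
      unfolding Tk using stage_le_phase[OF run_state[OF s]] by (simp add: state_le_def)
    have Q_dom: "(y, z) \<notin> R" if "y \<in> Q" for y z using that Q(2,3) R_dom unfolding Un_P by blast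
    have Q_st: "(y, z) \<notin> fst (?st n)" if "y \<in> Q" for y z n
      using Q_dom[OF that] st_T T_R by blast
    have AQ_E: "(y, z) \<in> E" if "y \<in> A \<union> Q" "z \<in> A \<union> Q" for y z
      using A S_fin related_E[of "A \<union> Q"] that by (auto simp: fin_sets_def)
    have AQ_fin: "finite A" "finite Q" using A S_fin by (auto simp: fin_sets_def)
    obtain q where q: "q \<in> Q" using Q(1) by (auto simp: wfin_sets_def)
    \<comment> \<open>A nonempty \<open>A\<close> is reached at a finite stage of the phase and then
      stays unchanged; the weight comparison, given at \<open>x\<close>, is carried to every base
      point \<open>z\<close> by the cocycle identity.\<close>
    have "\<exists>N. \<forall>n\<ge>N. (\<forall>y\<in>A. fst (?st n) `` {y} = A) \<and>
        (\<forall>z\<in>A \<union> Q. ?\<epsilon> * (\<Sum>y\<in>A. wt z y) \<le> (\<Sum>y\<in>Q. wt z y))"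
    proof (cases "A = {}")
      case True
      then show ?thesis by (auto simp: wt_nonneg sum_nonneg)
    next
      case False
      then obtain x where x: "x \<in> Y" "(x, x) \<in> T (Suc k)" "A = T (Suc k) `` {x}"
        "?\<epsilon> * enn2real (weight w x (R `` {x})) \<le> (\<Sum>y\<in>Q. wt x y)"
        using AQ by blast
      have xA: "x \<in> A" using x by blast
      obtain N where N: "\<And>n. n \<ge> N \<Longrightarrow> fst (?st n) `` {x} = A"
      proof (rule phase_stabilises[of "run s k" ?\<epsilon> x])
        show "tiling_state (fst (run s k)) (snd (run s k))" by (rule run_state[OF s])
        show "0 < ?\<epsilon>" by simp
        show "(x, x) \<in> fst (run s k) \<Longrightarrow> fst (run s k) `` {x} \<in> S" using T_S[OF x(1), of k] by (simp add: T_def)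
        show "(x, x) \<in> fst (phase ?\<epsilon> (run s k))" using x(2) Tk by simp
        show "weight w x (fst (phase ?\<epsilon> (run s k)) `` {x}) < \<infinity>" using fin_T[OF x(1,2)] Tk by simp
        fix N assume "\<And>n. N \<le> n \<Longrightarrow> fst (?st n) `` {x} = fst (phase ?\<epsilon> (run s k)) `` {x}"
        then show thesis using that[of N] x(3) Tk by simp
      qed
      have "fst (?st n) `` {y} = A" if "n \<ge> N" "y \<in> A" for n y
      proof -
        have "(x, y) \<in> fst (?st n)" using N[OF that(1)] that(2) by blast
        moreover have "sym (fst (?st n))" "trans (fst (?st n))"
          using stage_state[OF run_state[OF s], of ?\<epsilon> k n] by (auto simp: tiling_state_def)
        ultimately have "fst (?st n) `` {x} = fst (?st n) `` {y}" by (auto dest: symD transD)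
        then show ?thesis using N[OF that(1)] by simp
      qed
      moreover have "?\<epsilon> * (\<Sum>y\<in>A. wt z y) \<le> (\<Sum>y\<in>Q. wt z y)" if z: "z \<in> A \<union> Q" for z
      proof -
        have "(\<Sum>y\<in>A. wt x y) \<le> enn2real (weight w x (R `` {x}))"
          using x(3) T_R R_E fin[OF x(1)] x(2) AQ_fin(1) by (intro sum_wt_le_weight) auto
        then have "?\<epsilon> * (\<Sum>y\<in>A. wt x y) \<le> ?\<epsilon> * enn2real (weight w x (R `` {x}))"
          by (intro mult_left_mono) auto
        also note x(4)
        finally have "wt z x * (?\<epsilon> * (\<Sum>y\<in>A. wt x y)) \<le> wt z x * (\<Sum>y\<in>Q. wt x y)"
          using wt_nonneg by (intro mult_left_mono)
        moreover have "(\<Sum>y\<in>A. wt z y) = wt z x * (\<Sum>y\<in>A. wt x y)"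
          unfolding sum_distrib_left using AQ_E z xA by (intro sum.cong refl wt_mult) auto
        moreover have "(\<Sum>y\<in>Q. wt z y) = wt z x * (\<Sum>y\<in>Q. wt x y)"
          unfolding sum_distrib_left using AQ_E z xA by (intro sum.cong refl wt_mult) auto
        ultimately show ?thesis by (simp add: mult.left_commute)
      qed
      ultimately show ?thesis by blast
    qed
    then obtain N where N: "\<And>n y. n \<ge> N \<Longrightarrow> y \<in> A \<Longrightarrow> fst (?st n) `` {y} = A"
      "\<And>z. z \<in> A \<union> Q \<Longrightarrow> ?\<epsilon> * (\<Sum>y\<in>A. wt z y) \<le> (\<Sum>y\<in>Q. wt z y)"
      by (meson order_refl)
    have AQ_disj: "A \<inter> Q = {}"
    proof -
      have "y \<notin> Q" if "y \<in> A" for y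
        using N(1)[of N y] that Q_st[of y y N] by blast
      then show ?thesis by blast
    qed
    \<comment> \<open>\<open>Q\<close> misses every tile, so \<open>A \<union> Q\<close> stays
      eligible from stage \<open>N\<close> on and the phase must cover it, which is the
      contradiction sought.\<close>
    have "(q, q) \<in> fst (phase ?\<epsilon> (run s k))"
    proof (rule phase_saturated[OF run_state[OF s] A])
      show "q \<in> A \<union> Q" using q by blast
      show "fst (?st n) `` {y} \<subseteq> A \<union> Q" if "N \<le> n" "y \<in> A \<union> Q" for n y
        using N(1)[OF that(1)] that(2) Q_st by blast
      show "(y, z) \<in> fst (?st n)" if "N \<le> n" "y \<in> A \<union> Q" "z \<in> A \<union> Q"
        "(y, y) \<in> fst (?st n)" "(z, z) \<in> fst (?st n)" for n y z
        using N(1)[OF that(1)] that(2-) Q_st by blast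
      show "0 \<le> (\<Sum>y\<in>A \<union> Q. (if (y, y) \<in> fst (?st n) then - ?\<epsilon> else 1) * wt z y)"
        if n: "N \<le> n" and z: "z \<in> A \<union> Q" for n z
      proof -
        have "(\<Sum>y\<in>A \<union> Q. (if (y, y) \<in> fst (?st n) then - ?\<epsilon> else 1) * wt z y) =
            (\<Sum>y\<in>A. (if (y, y) \<in> fst (?st n) then - ?\<epsilon> else 1) * wt z y) +
            (\<Sum>y\<in>Q. (if (y, y) \<in> fst (?st n) then - ?\<epsilon> else 1) * wt z y)"
          by (rule sum.union_disjoint[OF AQ_fin AQ_disj])
        also have "(\<Sum>y\<in>A. (if (y, y) \<in> fst (?st n) then - ?\<epsilon> else 1) * wt z y) = (\<Sum>y\<in>A. - ?\<epsilon> * wt z y)"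
          using N(1)[OF n] by (intro sum.cong) auto
        also have "\<dots> = - ?\<epsilon> * (\<Sum>y\<in>A. wt z y)" by (simp only: sum_distrib_left)
        also have "(\<Sum>y\<in>Q. (if (y, y) \<in> fst (?st n) then - ?\<epsilon> else 1) * wt z y) = (\<Sum>y\<in>Q. wt z y)"
          using Q_st by (intro sum.cong) auto
        finally show ?thesis using N(2)[OF z] by simp
      qed
    qed
    then show False using Q_dom[OF q] T_R Tk by blast
  qed
  have "saturating_approximation M E w (restrict_to S Y) P Pn"
    unfolding saturating_approximation_def
  proof (intro conjI allI)
    show "disjoint P" by (rule P_disj)
    show "P \<subseteq> wfin_sets M E w" by (rule P_wfin)
    show "injective_tilings M Pn" by (rule inj)
    show "Pn n \<subseteq> restrict_to S Y" for n by (rule Pn_S)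
    show "P = tiling_join M Pn" by (rule P_join)
    show "\<not> (\<exists>Q\<in>wfin_sets M E w. Q \<inter> \<Union>P = {} \<and> (Q \<in> restrict_to S Y \<or>
      (\<exists>x\<in>\<Union>P. \<forall>\<^sub>F n in sequentially. tile_rel M (Pn n) `` {x} \<union> Q \<in> restrict_to S Y)))"
    proof
      assume "\<exists>Q\<in>wfin_sets M E w. Q \<inter> \<Union>P = {} \<and> (Q \<in> restrict_to S Y \<or>
        (\<exists>x\<in>\<Union>P. \<forall>\<^sub>F n in sequentially. tile_rel M (Pn n) `` {x} \<union> Q \<in> restrict_to S Y))"
      then obtain Q where Q0: "Q \<in> wfin_sets M E w" and Q1: "Q \<inter> \<Union>P = {} \<and> (Q \<in> restrict_to S Y \<or>
        (\<exists>x\<in>\<Union>P. \<forall>\<^sub>F n in sequentially. tile_rel M (Pn n) `` {x} \<union> Q \<in> restrict_to S Y))"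
        by (rule bexE)
      note Q = Q0 conjunct1[OF Q1]
      from conjunct2[OF Q1] show False
      proof (rule disjE)
        assume "Q \<in> restrict_to S Y"
        then show False using sat[OF Q, of "{}"] by (simp add: restrict_to_def)
      next
        assume "\<exists>x\<in>\<Union>P. \<forall>\<^sub>F n in sequentially. tile_rel M (Pn n) `` {x} \<union> Q \<in> restrict_to S Y"
        then obtain x n0 where x: "x \<in> Y" "(x, x) \<in> R"
          and n0: "\<And>n. n \<ge> n0 \<Longrightarrow> tile_rel M (Pn n) `` {x} \<union> Q \<in> restrict_to S Y"
          unfolding Un_P eventually_sequentially by blast
        obtain n1 where n1: "(x, x) \<in> T n1" using x(2) R_T by blast
        have tile: "tile_rel M (Pn n) `` {x} = T n `` {x}" if "n \<ge> n1" for n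
          using T_mono[OF that] n1 x(1) T_Y[OF x(1), of n] unfolding tile_rel_Pn by auto
        have U: "T n `` {x} \<union> Q \<in> S" "Q \<subseteq> Y" if "n \<ge> max n0 n1" for n
          using n0[of n] tile[of n] that by (auto simp: restrict_to_def)
        have fin_U: "T (max n0 n1) `` {x} \<union> Q \<in> fin_sets M E" using U(1)[of "max n0 n1"] S_fin by auto
        then have Q_fin: "finite Q" by (simp add: fin_sets_def)
        have x_in: "(x, x) \<in> T n" if "n \<ge> max n0 n1" for n using T_mono[of n1 n] n1 that by auto
        have Q_E: "(x, y) \<in> E" if "y \<in> Q" for y
        proof (rule related_E)
          show "related_set M E (T (max n0 n1) `` {x} \<union> Q)" using fin_U by (simp add: fin_sets_def)
        qed (use x_in[of "max n0 n1"] that in auto)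
        obtain q where q: "q \<in> Q" using Q(1) by (auto simp: wfin_sets_def)
        define c where "c = (\<Sum>y\<in>Q. wt x y)"
        have "0 < wt x q" using w_pos Q_E[OF q] by (simp add: wt_def)
        also have "wt x q \<le> c" unfolding c_def using Q_fin q wt_nonneg by (intro member_le_sum) auto
        finally have c: "c > 0" .
        define W where "W = enn2real (weight w x (R `` {x}))"
        obtain m where m: "W / c \<le> real m" using real_arch_simple by blast
        \<comment> \<open>The bound \<open>m\<close> makes the threshold \<open>1 / (k + 1)\<close>
          times the final weight \<open>W\<close> at most the weight \<open>c\<close> of
          \<open>Q\<close>, which is positive; the bounds \<open>n0\<close> and \<open>n1\<close>
          ensure that at time \<open>Suc k\<close> the point \<open>x\<close> is covered and the
          union of its tile with \<open>Q\<close> lies in \<open>S\<close>.\<close>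
        define k where "k = max m (max n0 n1)"
        have "real m \<le> real (Suc k)" by (simp add: k_def)
        then have "W / c \<le> real (Suc k)" using m by linarith
        then have "W \<le> real (Suc k) * c" using c by (simp add: divide_le_eq)
        then have ineq: "inverse (real (Suc k)) * W \<le> c" by (simp add: field_simps)
        have "max n0 n1 \<le> k" by (simp add: k_def)
        then have "max n0 n1 \<le> Suc k" by (rule le_SucI)
        then show False
          using sat[OF Q, of "T (Suc k) `` {x}" k] U[of "Suc k"] x(1) x_in[of "Suc k"] ineq
          unfolding W_def c_def by blast
      qed
    qed
  qed
  then show ?thesis
    using P_disj P_meas P_inc D P_restr Pn0 unfolding Y_def by metis
qed

end

theorem theorem7p13:
  fixes M :: "'a measure"
    and E L :: "'a rel"
    and w :: "'a \<Rightarrow> 'a \<Rightarrow> real"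
    and S :: "'a set set"
  assumes "standard_borel M"
    and "countable_borel_equiv M E"
    and "borel_cocycle M E w"
    and "borel_linear_order M L"
    and "S \<subseteq> fin_sets M E"
    and "S \<in> sets (wfin_space M L E w)"
  shows "(\<exists>P D. disjoint P \<and> P \<in> sets (wfin_space M L E w) \<and>
            P \<subseteq> increasing_closure M E w S \<and>
            D \<in> sets M \<and> E `` D \<subseteq> D \<and> deficient M E w D \<and>
            approximately_saturated M E w
              (restrict_to S (space M - D)) (restrict_to P (space M - D)))
       \<and> (\<forall>P0. disjoint P0 \<and> P0 \<in> sets (wfin_space M L E w) \<and> P0 \<subseteq> S \<longrightarrow>
            (\<exists>P D. disjoint P \<and> P \<in> sets (wfin_space M L E w) \<and>
               P \<subseteq> increasing_closure M E w S \<and>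
               D \<in> sets M \<and> E `` D \<subseteq> D \<and> deficient M E w D \<and>
               (\<exists>Pn. saturating_approximation M E w
                       (restrict_to S (space M - D)) (restrict_to P (space M - D)) Pn \<and>
                     Pn 0 = restrict_to P0 (space M - D))))"
  proof -
  note EQ = \<open>countable_borel_equiv M E\<close>
  obtain h :: "'a \<Rightarrow> nat \<Rightarrow> real" where h: "h \<in> borel_measurable M" "inj_on h (space M)"
    "h ` space M \<subseteq> cantor"
    using standard_borel_embedding[OF \<open>standard_borel M\<close>] by metis
  obtain \<gamma> :: "nat \<Rightarrow> 'a \<Rightarrow> 'a" where \<gamma>: "\<And>n. \<gamma> n \<in> measurable M M"
    "\<And>x. x \<in> space M \<Longrightarrow> E `` {x} = range (\<lambda>n. \<gamma> n x)" "\<And>x. \<gamma> 0 x = x"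
    using countable_borel_equiv_enum[OF \<open>standard_borel M\<close> EQ] by metis
  \<comment> \<open>Since \<open>h\<close> is injective with values in the Cantor set, the sets on
    which a coordinate is 1 separate points.\<close>
  define \<beta> where "\<beta> n = {x \<in> space M. h x n = 1}" for n
  have coord: "(\<lambda>x. h x n) \<in> borel_measurable M" for n
    using h(1) by (rule measurable_product_then_coordinatewise)
  have \<beta>_sets: "\<beta> n \<in> sets M" for n
    unfolding \<beta>_def using borel_measurable_vimage[OF coord, of n 1]
    by (simp add: vimage_def Int_def conj_commute)
  have \<beta>_sep: "\<exists>n. (x \<in> \<beta> n) \<noteq> (y \<in> \<beta> n)" if xy: "x \<in> space M" "y \<in> space M" "x \<noteq> y" for x y
  proof (rule ccontr)
    assume "\<nexists>n. (x \<in> \<beta> n) \<noteq> (y \<in> \<beta> n)"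
    then have one: "h x n = 1 \<longleftrightarrow> h y n = 1" for n using xy by (simp add: \<beta>_def)
    have "h x \<in> cantor" "h y \<in> cantor" using h(3) xy by auto
    then have "h x n = 0 \<or> h x n = 1" "h y n = 0 \<or> h y n = 1" for n by (auto simp: cantor_def)
    then have "h x n = h y n" for n using one[of n] by metis
    then have "h x = h y" by (rule ext)
    then show False using h(2) xy by (meson inj_onD)
  qed
  interpret tiling_setup M E L w \<gamma> \<beta> S
    using assms \<gamma> \<beta>_sets \<beta>_sep by unfold_locales (auto simp: countable_borel_equiv_def)
  have *: "\<exists>P D. disjoint P \<and> P \<in> sets (wfin_space M L E w) \<and> P \<subseteq> increasing_closure M E w S \<and>
      D \<in> sets M \<and> E `` D \<subseteq> D \<and> deficient M E w D \<and>
      (\<exists>Pn. saturating_approximation M E w (restrict_to S (space M - D)) (restrict_to P (space M - D)) Pn \<and>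
        Pn 0 = restrict_to P0 (space M - D))"
    if "disjoint P0" "P0 \<in> sets (wfin_space M L E w)" "P0 \<subseteq> S" for P0
    using saturating_tiling_exists[OF that(2,3,1)] .
  show ?thesis
  proof (intro conjI allI impI)
    \<comment> \<open>The empty collection is a Borel tiling contained in \<open>S\<close>, so it
      may serve as the first term.\<close>
    show "\<exists>P D. disjoint P \<and> P \<in> sets (wfin_space M L E w) \<and> P \<subseteq> increasing_closure M E w S \<and>
        D \<in> sets M \<and> E `` D \<subseteq> D \<and> deficient M E w D \<and>
        approximately_saturated M E w (restrict_to S (space M - D)) (restrict_to P (space M - D))"
      using *[of "{}"] unfolding approximately_saturated_def by (auto simp: disjoint_def)
  qed (use * in blast)
qed

end
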